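(* Let $m\ge 3$, $k\ge 0$ and $1\le\ell\le m-1$ be integers, and let $P_{k,\ell}(\underline x)$ be an $\mathbb R_{0,m}^{(\ell)}$-valued polynomial belonging to $\mathsf{M}_{l}(k)$. Let $h(x,y)=u(x,y)+iv(x,y)$ be a holomorphic function (of $x+iy$) on an open set $U\subset\mathbb R^2\cong\mathbb C$, and consider the points $(x_0,\underline x)\in\mathbb R^{m+1}$ with $\{x_0\}\times[-|\underline x|,|\underline x|]\subset U$. The function defined at these points by $$I_h(x_0,\underline x)=\frac{1}{\sigma_{m-1}}\int_{S^{m-1}}h(x_0,\langle\underline x,\underline t\rangle)(1-i\underline t)P_{k,\ell}(\underline t)(1-i\underline t)\,dS(\underline t)$$ is axial two-sided monogenic, that is, it is two-sided monogenic and, with $r=|\underline x|>0$, $$I_h(x_0,\underline x)=A_h(x_0,r)P_{k,\ell}(\underline x)+B_h(x_0,r)\,\underline x P_{k,\ell}(\underline x)+C_h(x_0,r)P_{k,\ell}(\underline x)\,\underline x+D_h(x_0,r)\,\underline x P_{k,\ell}(\underline x)\,\underline x,$$ where $$A_h(x_0,r)=\frac{r^{-k}}{2k+m}\left((2k+m-\mu_{\ell})\,C_k(1)^{-1}\int_{-1}^1h(x_0,rt)C_k(t)(1-t^2)^{(m-3)/2}dt+\mu_{\ell}\,C_{k+2}(1)^{-1}\int_{-1}^1h(x_0,rt)C_{k+2}(t)(1-t^2)^{(m-3)/2}dt\right),$$ $$B_h(x_0,r)=C_h(x_0,r)=-i\,r^{-k-1}C_{k+1}(1)^{-1}\int_{-1}^1h(x_0,rt)C_{k+1}(t)(1-t^2)^{(m-3)/2}dt,$$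 $$D_h(x_0,r)=-r^{-k-2}C_{k+2}(1)^{-1}\int_{-1}^1h(x_0,rt)C_{k+2}(t)(1-t^2)^{(m-3)/2}dt,$$ and $\mu_\ell=(-1)^\ell(2\ell-m)$.
   Context: $\mathbb R_{0,m}$ is the real Clifford algebra generated by the canonical basis $e_1,\dots,e_m$ of $\mathbb R^m$ with $e_je_k+e_ke_j=-2\delta_{jk}$. For $A=\{j_1<\dots<j_s\}\subset\{1,\dots,m\}$ put $e_A=e_{j_1}\cdots e_{j_s}$, $e_\emptyset=1$, and $\mathbb R_{0,m}^{(\ell)}=\mathrm{span}_{\mathbb R}(e_A:|A|=\ell)$ ($\ell$-vectors). Points of $\mathbb R^m$ are identified with $\underline x=\sum_{j=1}^m x_je_j$, so $\underline x^2=-|\underline x|^2$; $\langle\underline x,\underline t\rangle=\sum_j x_jt_j$. The functions here take values in the complexified algebra $\mathbb C\otimes\mathbb R_{0,m}$, in which the imaginary unit $i$ commutes with all $e_j$; the coefficient functions $A_h,B_h,C_h,D_h$ are complex-valued. The Dirac operator is $\partial_{\underline x}=\sum_{j=1}^me_j\partial_{x_j}$, acting from the left by $\partial_{\underline x}f=\sum_je_j\,\partial_{x_j}f$ and from the right by $f\partial_{\underline x}=\sum_j(\partial_{x_j}f)\,e_j$. A continuously differentiable function $f$ on an open subset of $\mathbb R^{m+1}$ is two-sided monogenic if $\partial_{x_0}f+\partial_{\underline x}f=0$ and $\partial_{x_0}f+f\partial_{\underline x}=0$. $\mathsf M_l(k)$ is the set of homogeneous polynomials $P$ of degree $k$ in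 $\mathbb R^m$ with $\partial_{\underline x}P=0$. $C_k(t)$ denotes the Gegenbauer polynomial $C_k^{\nu}(t)$ with $\nu=(m-2)/2$; $\sigma_{m-1}$ is the surface area of the unit sphere $S^{m-2}$ in $\mathbb R^{m-1}$; $dS$ is the surface measure on the unit sphere $S^{m-1}\subset\mathbb R^m$. *)

theory Defs
  imports "HOL-Analysis.Analysis"
begin

section \<open>The complexified Clifford algebra\<close>

text \<open>
  An element is the family of its complex coefficients with respect to the basis
  \<open>e\<^sub>A\<close>, where \<open>A\<close> ranges over the subsets of the linearly ordered index type; the
  real dimension \<open>m\<close> is the cardinality of that type. The type inherits the
  componentwise product \<open>*\<close> and the unit \<open>1\<close> of the type of vectors. These are not the
  Clifford product and its unit, which are \<open>\<odot>\<close> and \<open>blade {}\<close> below. Multiplication by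
  complex scalars is \<open>*s\<close>.
\<close>

type_synonym 'm clifford = "complex ^ ('m set)"

definition blade :: "'m::finite set \<Rightarrow> 'm clifford"
  where "blade A = axis A 1"

text \<open>
  Sorting the product \<open>e\<^sub>A e\<^sub>B\<close> costs a factor \<open>-1\<close> for every transposition of some
  \<open>e\<^sub>i\<close> with a later \<open>e\<^sub>j\<close>, \<open>j < i\<close>, and for every square \<open>e\<^sub>i e\<^sub>i = -1\<close>.
\<close>

definition blade_sign :: "'m::{finite,linorder} set \<Rightarrow> 'm set \<Rightarrow> complex"
  where "blade_sign A B = (\<Prod>i\<in>A. \<Prod>j\<in>B. if j \<le> i then - 1 else 1)"

definition clifford_mult ::
    "'m::{finite,linorder} clifford \<Rightarrow> 'm clifford \<Rightarrow> 'm clifford"  (infixl "\<odot>" 70)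
  where "a \<odot> b =
    (\<Sum>A\<in>UNIV. \<Sum>B\<in>UNIV. (blade_sign A B * a $ A * b $ B) *s blade (sym_diff A B))"

definition clifford_vector :: "real ^ 'm::finite \<Rightarrow> 'm clifford"
  where "clifford_vector x = (\<Sum>j\<in>UNIV. (x $ j) *\<^sub>R blade {j})"

definition multivectors :: "nat \<Rightarrow> 'm::finite clifford set"
  where "multivectors l = span (blade ` {A. card A = l})"

text \<open>The defining properties of the algebra.\<close>

lemma scalar_clifford_mult_left: "(c *s a) \<odot> b = c *s (a \<odot> b)"
  by (simp add: clifford_mult_def vec_eq_iff sum_distrib_left mult_ac)

lemma scalar_clifford_mult_right: "a \<odot> (c *s b) = c *s (a \<odot> b)"
  by (simp add: clifford_mult_def vec_eq_iff sum_distrib_left mult_ac)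

lemma clifford_mult_add_left: "(a + b) \<odot> c = a \<odot> c + b \<odot> c"
  by (simp add: clifford_mult_def vec_eq_iff algebra_simps sum.distrib)

lemma clifford_mult_add_right: "a \<odot> (b + c) = a \<odot> b + a \<odot> c"
  by (simp add: clifford_mult_def vec_eq_iff algebra_simps sum.distrib)

lemma clifford_mult_zero_left [simp]: "0 \<odot> a = 0"
  by (simp add: clifford_mult_def vec_eq_iff)

lemma clifford_mult_zero_right [simp]: "a \<odot> 0 = 0"
  by (simp add: clifford_mult_def vec_eq_iff)

lemma clifford_mult_sum_left: "sum f S \<odot> b = (\<Sum>x\<in>S. f x \<odot> b)"
  by (induction S rule: infinite_finite_induct) (simp_all add: clifford_mult_add_left)

lemma clifford_mult_sum_right: "a \<odot> sum f S = (\<Sum>x\<in>S. a \<odot> f x)"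
  by (induction S rule: infinite_finite_induct) (simp_all add: clifford_mult_add_right)

lemma clifford_expand: "a = (\<Sum>A\<in>UNIV. (a $ A) *s blade A)"
  by (simp add: vec_eq_iff blade_def axis_def if_distrib cong: if_cong)

lemma blade_mult: "blade A \<odot> blade B = blade_sign A B *s blade (sym_diff A B)"
proof -
  have *: "blade A \<odot> blade B = (\<Sum>C\<in>UNIV. \<Sum>D\<in>UNIV. if C = A then
      (if D = B then blade_sign A B *s blade (sym_diff A B) else 0) else 0)"
    unfolding clifford_mult_def
    by (intro sum.cong refl) (auto simp: blade_def axis_def)
  show ?thesis
    unfolding * by (subst sum.swap) simp
qed

lemma prod_sym_diff:
  fixes f :: "'a::finite \<Rightarrow> complex"
  assumes "\<And>x. f x * f x = 1"
  shows "prod f (sym_diff A B) = prod f A * prod f B"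
proof -
  have 1: "prod f (A \<inter> B) * prod f (A \<inter> B) = 1"
    by (simp add: assms flip: prod.distrib)
  have A: "prod f A = prod f (A - B) * prod f (A \<inter> B)"
    by (metis Int_Diff_Un Int_Diff_disjoint finite prod.union_disjoint mult.commute)
  have B: "prod f B = prod f (B - A) * prod f (A \<inter> B)"
    by (metis Int_commute Int_Diff_Un Int_Diff_disjoint finite prod.union_disjoint mult.commute)
  have "prod f (sym_diff A B) = prod f (A - B) * prod f (B - A)"
    by (rule prod.union_disjoint) auto
  also have "\<dots> = prod f (A - B) * prod f (B - A) * (prod f (A \<inter> B) * prod f (A \<inter> B))"
    by (simp add: 1)
  also have "\<dots> = prod f A * prod f B"
    unfolding A B by (simp only: mult_ac)
  finally show ?thesis .
qed

lemma blade_sign_sym_diff_right: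
  "blade_sign A (sym_diff B C) = blade_sign A B * blade_sign A C"
  unfolding blade_sign_def by (subst prod_sym_diff) (auto simp: prod.distrib)

lemma blade_sign_sym_diff_left:
  "blade_sign (sym_diff A B) C = blade_sign A C * blade_sign B C"
  unfolding blade_sign_def
  by (rule prod_sym_diff) (auto simp flip: prod.distrib intro!: prod.neutral)

lemma clifford_mult_assoc: "(a \<odot> b) \<odot> c = a \<odot> (b \<odot> c)"
proof -
  have blades: "(blade A \<odot> blade B) \<odot> blade C = blade A \<odot> (blade B \<odot> blade C)"
    for A B C :: "'a set"
  proof -
    have "sym_diff (sym_diff A B) C = sym_diff A (sym_diff B C)"
      by blast
    then show ?thesis
      by (simp only: blade_mult scalar_clifford_mult_left scalar_clifford_mult_right
          vector_smult_assoc blade_sign_sym_diff_left blade_sign_sym_diff_right mult_ac)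
  qed
  have "((\<Sum>A\<in>UNIV. (a $ A) *s blade A) \<odot> (\<Sum>B\<in>UNIV. (b $ B) *s blade B))
      \<odot> (\<Sum>C\<in>UNIV. (c $ C) *s blade C)
    = (\<Sum>A\<in>UNIV. (a $ A) *s blade A) \<odot> ((\<Sum>B\<in>UNIV. (b $ B) *s blade B)
      \<odot> (\<Sum>C\<in>UNIV. (c $ C) *s blade C))"
    by (simp only: clifford_mult_sum_left clifford_mult_sum_right
        scalar_clifford_mult_left scalar_clifford_mult_right blades)
  then show ?thesis
    by (simp only: clifford_expand [symmetric])
qed

lemma blade_empty_mult [simp]: "blade {} \<odot> a = a"
proof -
  have "blade {} \<odot> (\<Sum>A\<in>UNIV. (a $ A) *s blade A) = (\<Sum>A\<in>UNIV. (a $ A) *s blade A)"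
    by (simp add: clifford_mult_sum_right scalar_clifford_mult_right blade_mult blade_sign_def)
  then show ?thesis
    by (simp only: clifford_expand [symmetric])
qed

lemma mult_blade_empty [simp]: "a \<odot> blade {} = a"
proof -
  have "(\<Sum>A\<in>UNIV. (a $ A) *s blade A) \<odot> blade {} = (\<Sum>A\<in>UNIV. (a $ A) *s blade A)"
    by (simp add: clifford_mult_sum_left scalar_clifford_mult_left blade_mult blade_sign_def)
  then show ?thesis
    by (simp only: clifford_expand [symmetric])
qed

lemma blade_anticommute:
  "blade {j} \<odot> blade {k} + blade {k} \<odot> blade {j} = (if j = k then - 2 else 0) *s blade {}"
proof (cases "j = k")
  case True
  then show ?thesis
    by (simp add: blade_mult blade_sign_def vec_eq_iff)
next
  case False
  then have "sym_diff {j} {k} = {j, k}" "sym_diff {k} {j} = {j, k}"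
    by auto
  with False show ?thesis
    by (auto simp: blade_mult blade_sign_def vec_eq_iff)
qed

lemma blade_eq_prod: "blade A = foldr (\<lambda>j b. blade {j} \<odot> b) (sorted_list_of_set A) (blade {})"
proof -
  have "blade (set js) = foldr (\<lambda>j b. blade {j} \<odot> b) js (blade {})"
    if "sorted js" "distinct js" for js :: "'a list"
    using that
  proof (induction js)
    case Nil
    then show ?case by simp
  next
    case (Cons j js)
    then have j: "j \<notin> set js" "\<forall>i\<in>set js. j < i"
      by (auto simp: order.strict_iff_order)
    then have "blade_sign {j} (set js) = 1"
      by (auto simp: blade_sign_def intro!: prod.neutral)
    moreover have "sym_diff {j} (set js) = set (j # js)"
      using j by auto
    ultimately have "blade {j} \<odot> blade (set js) = blade (set (j # js))"
      by (simp only: blade_mult vector_smult_lid)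
    then show ?case
      using Cons by simp
  qed
  from this [of "sorted_list_of_set A"] show ?thesis
    by simp
qed


section \<open>Monogenic functions\<close>

definition directional_deriv ::
    "('a::real_normed_vector \<Rightarrow> 'b::real_normed_vector) \<Rightarrow> 'a \<Rightarrow> 'a \<Rightarrow> 'b"
  where "directional_deriv f v p = vector_derivative (\<lambda>t. f (p + t *\<^sub>R v)) (at 0)"

definition dirac_left ::
    "(real ^ 'm::{finite,linorder} \<Rightarrow> 'm clifford) \<Rightarrow> real ^ 'm::{finite,linorder} \<Rightarrow> 'm clifford"
  where "dirac_left f x = (\<Sum>j\<in>UNIV. blade {j} \<odot> directional_deriv f (axis j 1) x)"

definition dirac_right ::
    "(real ^ 'm::{finite,linorder} \<Rightarrow> 'm clifford) \<Rightarrow> real ^ 'm::{finite,linorder} \<Rightarrow> 'm clifford"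
  where "dirac_right f x = (\<Sum>j\<in>UNIV. directional_deriv f (axis j 1) x \<odot> blade {j})"

definition continuously_differentiable_on ::
    "('a::real_normed_vector \<Rightarrow> 'b::real_normed_vector) \<Rightarrow> 'a set \<Rightarrow> bool"
  where "continuously_differentiable_on f S \<longleftrightarrow>
    (\<exists>f' :: 'a \<Rightarrow> 'a \<Rightarrow>\<^sub>L 'b.
      (\<forall>p\<in>S. (f has_derivative blinfun_apply (f' p)) (at p)) \<and> continuous_on S f')"

definition two_sided_monogenic_on ::
    "(real \<times> (real ^ 'm::{finite,linorder}) \<Rightarrow> 'm clifford) \<Rightarrow> (real \<times> (real ^ 'm::{finite,linorder})) set \<Rightarrow> bool"
  where "two_sided_monogenic_on f S \<longleftrightarrow>
    open S \<and> continuously_differentiable_on f S \<and>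
    (\<forall>(x0, x)\<in>S.
      directional_deriv f (1, 0) (x0, x) + dirac_left (\<lambda>y. f (x0, y)) x = 0 \<and>
      directional_deriv f (1, 0) (x0, x) + dirac_right (\<lambda>y. f (x0, y)) x = 0)"

definition homogeneous_polynomial ::
    "nat \<Rightarrow> (real ^ 'm::finite \<Rightarrow> 'b::real_vector) \<Rightarrow> bool"
  where "homogeneous_polynomial k P \<longleftrightarrow>
    (\<exists>a :: ('m \<Rightarrow> nat) \<Rightarrow> 'b. \<forall>x.
      P x = (\<Sum>\<alpha> | (\<Sum>j\<in>UNIV. \<alpha> j) = k. (\<Prod>j\<in>UNIV. x $ j ^ \<alpha> j) *\<^sub>R a \<alpha>))"

text \<open>The index set of the sum above is finite, so no monomial is silently dropped.\<close>

lemma finite_multi_indices: "finite {\<alpha> :: 'm::finite \<Rightarrow> nat. (\<Sum>j\<in>UNIV. \<alpha> j) = k}"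
proof (rule finite_subset)
  show "{\<alpha> :: 'm \<Rightarrow> nat. (\<Sum>j\<in>UNIV. \<alpha> j) = k} \<subseteq> (\<Pi>\<^sub>E j\<in>UNIV. {..k})"
    by (auto simp: PiE_UNIV_domain intro: member_le_sum)
qed (rule finite_PiE, auto)

definition left_monogenic_polynomials ::
    "nat \<Rightarrow> (real ^ 'm::{finite,linorder} \<Rightarrow> 'm clifford) set"
  where "left_monogenic_polynomials k =
    {P. homogeneous_polynomial k P \<and> (\<forall>x. dirac_left P x = 0)}"


section \<open>Surface measure of the unit sphere\<close>

text \<open>
  The surface measure of a Borel set \<open>E\<close> on the unit sphere of an \<open>n\<close>-dimensional space
  is \<open>n\<close> times the volume of the cone \<open>{s x | 0 < s < 1, x \<in> E}\<close>. The function
  \<^const>\<open>sgn\<close> is the radial projection \<open>x \<mapsto> x / |x|\<close>.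
\<close>

definition sphere_measure :: "'a::euclidean_space measure"
  where "sphere_measure = scale_measure (ennreal DIM('a))
    (distr (restrict_space lborel (ball 0 1 - {0})) (restrict_space borel (sphere 0 1)) sgn)"

definition sphere_area :: "nat \<Rightarrow> real"
  where "sphere_area n = n * unit_ball_vol n"

lemma measurable_sgn_sphere:
  "sgn \<in> restrict_space lborel (ball 0 1 - {0 :: 'a::euclidean_space}) \<rightarrow>\<^sub>M
     restrict_space borel (sphere 0 1)"
proof (rule measurable_restrict_space3)
  have "(\<lambda>x::'a. x /\<^sub>R norm x) \<in> borel_measurable borel"
    by measurable
  then show "sgn \<in> lborel \<rightarrow>\<^sub>M (borel :: 'a measure)"
    by (simp add: sgn_div_norm [abs_def])
qed (auto simp: norm_sgn)

lemma emeasure_sphere_measure: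
  fixes E :: "'a::euclidean_space set"
  assumes "E \<in> sets borel" and "E \<subseteq> sphere 0 1"
  shows "emeasure sphere_measure E =
    DIM('a) * emeasure lborel {s *\<^sub>R x | s x. 0 < s \<and> s < 1 \<and> x \<in> E}"
proof -
  have E: "E \<in> sets (restrict_space borel (sphere 0 1))"
    using assms by (auto simp: sets_restrict_space image_iff)
  let ?R = "{s *\<^sub>R x | s x. 0 < s \<and> s < 1 \<and> x \<in> E}"
  have "sgn -` E \<inter> space (restrict_space lborel (ball 0 1 - {0})) = ?R" (is "?L = _")
  proof (rule set_eqI, rule iffI)
    fix y assume "y \<in> ?L"
    then have "y = norm y *\<^sub>R sgn y" "0 < norm y" "norm y < 1" "sgn y \<in> E"
      by (auto simp: space_restrict_space sgn_div_norm)
    then show "y \<in> ?R"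
      by blast
  next
    fix y assume "y \<in> ?R"
    then obtain s x where y: "y = s *\<^sub>R x" "0 < s" "s < 1" "x \<in> E"
      by blast
    then have "norm x = 1"
      using assms(2) by auto
    with y show "y \<in> ?L"
      by (auto simp: space_restrict_space sgn_div_norm)
  qed
  then have "emeasure (distr (restrict_space lborel (ball 0 1 - {0}))
      (restrict_space borel (sphere 0 1)) sgn) E =
      emeasure (restrict_space lborel (ball 0 1 - {0})) ?R"
    by (simp only: emeasure_distr [OF measurable_sgn_sphere E])
  also have "\<dots> = emeasure lborel ?R"
  proof (rule emeasure_restrict_space)
    have "norm (s *\<^sub>R x) < 1 \<and> s *\<^sub>R x \<noteq> 0" if "0 < s" "s < 1" "x \<in> E" for s x
    proof -
      have "norm x = 1"
        using assms(2) that by auto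
      then show ?thesis
        using that by auto
    qed
    then show "?R \<subseteq> ball 0 1 - {0}"
      by auto
  qed simp
  finally show ?thesis
    by (simp add: sphere_measure_def ennreal_of_nat_eq_real_of_nat)
qed

lemma measure_sphere_measure:
  "measure sphere_measure (sphere (0 :: 'a::euclidean_space) 1) = sphere_area DIM('a)"
proof -
  have "{s *\<^sub>R x | s x. 0 < s \<and> s < 1 \<and> x \<in> sphere (0::'a) 1} = ball 0 1 - {0}" (is "?L = ?R")
  proof (rule set_eqI, rule iffI)
    fix y assume "y \<in> ?R"
    then have "y = norm y *\<^sub>R sgn y" "0 < norm y" "norm y < 1" "sgn y \<in> sphere 0 1"
      by (auto simp: sgn_div_norm)
    then show "y \<in> ?L"
      by blast
  qed auto
  then have "emeasure sphere_measure (sphere (0::'a) 1) =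
      DIM('a) * emeasure lborel (ball (0::'a) 1 - {0})"
    by (simp add: emeasure_sphere_measure)
  also have "emeasure lborel (ball (0::'a) 1 - {0}) = emeasure lborel (ball (0::'a) 1)"
    by (intro emeasure_Diff_null_set) auto
  also have "\<dots> = ennreal (unit_ball_vol DIM('a))"
    by (simp add: emeasure_ball)
  finally show ?thesis
    by (simp add: measure_def sphere_area_def enn2real_mult)
qed


section \<open>The coefficient functions\<close>

text \<open>The coefficient of \<open>s\<^sup>n\<close> in the expansion of \<open>(1 - 2 t s + s\<^sup>2)\<^bsup>-\<nu>\<^esup>\<close>.\<close>

definition gegenbauer :: "real \<Rightarrow> nat \<Rightarrow> real \<Rightarrow> real"
  where "gegenbauer \<nu> n t =
    (\<Sum>j\<le>n div 2. (- 1) ^ j * pochhammer \<nu> (n - j) / (fact j * fact (n - 2 * j))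
      * (2 * t) ^ (n - 2 * j))"

definition mu :: "nat \<Rightarrow> nat \<Rightarrow> real"
  where "mu m l = (- 1) ^ l * (2 * real l - real m)"

text \<open>The common building block \<open>C\<^sub>n(1)\<^sup>-\<^sup>1 \<integral> h(x\<^sub>0, r t) C\<^sub>n(t) (1 - t\<^sup>2)\<^bsup>(m - 3)/2\<^esup> dt\<close>.\<close>

definition gegenbauer_transform ::
    "(complex \<Rightarrow> complex) \<Rightarrow> nat \<Rightarrow> nat \<Rightarrow> real \<Rightarrow> real \<Rightarrow> complex"
  where "gegenbauer_transform h m n x0 r =
    inverse (of_real (gegenbauer ((real m - 2) / 2) n 1)) *
    integral {- 1..1} (\<lambda>t. h (Complex x0 (r * t)) *
      of_real (gegenbauer ((real m - 2) / 2) n t * (1 - t\<^sup>2) powr ((real m - 3) / 2)))"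

definition coeff_A ::
    "(complex \<Rightarrow> complex) \<Rightarrow> nat \<Rightarrow> nat \<Rightarrow> nat \<Rightarrow> real \<Rightarrow> real \<Rightarrow> complex"
  where "coeff_A h m k l x0 r =
    of_real (r powi (- int k) / (2 * real k + real m)) *
    (of_real (2 * real k + real m - mu m l) * gegenbauer_transform h m k x0 r +
     of_real (mu m l) * gegenbauer_transform h m (k + 2) x0 r)"

definition coeff_B ::
    "(complex \<Rightarrow> complex) \<Rightarrow> nat \<Rightarrow> nat \<Rightarrow> real \<Rightarrow> real \<Rightarrow> complex"
  where "coeff_B h m k x0 r =
    - \<i> * of_real (r powi (- int k - 1)) * gegenbauer_transform h m (k + 1) x0 r"

definition coeff_C ::
    "(complex \<Rightarrow> complex) \<Rightarrow> nat \<Rightarrow> nat \<Rightarrow> real \<Rightarrow> real \<Rightarrow> complex"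
  where "coeff_C h m k x0 r = coeff_B h m k x0 r"

definition coeff_D ::
    "(complex \<Rightarrow> complex) \<Rightarrow> nat \<Rightarrow> nat \<Rightarrow> real \<Rightarrow> real \<Rightarrow> complex"
  where "coeff_D h m k x0 r =
    - of_real (r powi (- int k - 2)) * gegenbauer_transform h m (k + 2) x0 r"


section \<open>The plane wave integral\<close>

definition axial_domain :: "complex set \<Rightarrow> (real \<times> (real ^ 'm::finite)) set"
  where "axial_domain U = {(x0, x). \<forall>y\<in>{- norm x..norm x}. Complex x0 y \<in> U}"

definition plane_wave_integral ::
    "(complex \<Rightarrow> complex) \<Rightarrow> (real ^ 'm::{finite,linorder} \<Rightarrow> 'm clifford) \<Rightarrow>
      real \<times> (real ^ 'm::{finite,linorder}) \<Rightarrow> 'm clifford"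
  where "plane_wave_integral h P = (\<lambda>(x0, x).
    (1 / sphere_area (CARD('m) - 1)) *\<^sub>R
    (\<integral>t. h (Complex x0 (x \<bullet> t)) *s
      ((blade {} - \<i> *s clifford_vector t) \<odot> P t \<odot> (blade {} - \<i> *s clifford_vector t))
      \<partial>sphere_measure))"

end

theory Submission
  imports Defs "HOL-Complex_Analysis.Cauchy_Integral_Formula"
begin

text \<open>
  Differentiating under the integral sign, the operator \<open>\<partial>\<^sub>0 + \<partial>\<^sub>x\<close> acts on the plane wave
  \<open>h (x\<^sub>0, \<langle>x, t\<rangle>)\<close> as multiplication by \<open>h' (1 + i t)\<close>, and \<open>(1 + i t) (1 - i t) = 1 + t\<^sup>2 = 0\<close> on
  the unit sphere; this gives monogenicity from both sides. For the coefficients, expand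
  \<open>(1 - i t) P (1 - i t) = P - i (t P + P t) - t P t\<close> on the sphere. Left monogenic polynomials
  with values in the \<open>l\<close>-vectors are also right monogenic, so \<open>P\<close>, \<open>t P\<close>, \<open>P t\<close> are harmonic, while
  \<open>\<Sum>\<^sub>j e\<^sub>j P e\<^sub>j = \<mu> P\<close> makes \<open>t P t - \<mu> / (2k + m) |t|\<^sup>2 P\<close> harmonic. The Funk--Hecke formula then
  evaluates each of the integrals.

  The Funk--Hecke formula is reduced to monomials \<open>\<langle>\<xi>, t\<rangle>\<^sup>p\<close> by the theorem of Weierstrass. Invariance
  of the surface measure under infinitesimal rotations yields the recursion
  \<open>(p + n + m - 2) M\<^sub>p(H) = (p - 1) M\<^bsub>p-2\<^esub>(H) + M\<^bsub>p-1\<^esub>(\<partial>\<^sub>\<xi> H)\<close> for the moments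
  \<open>M\<^sub>p(H) = \<integral> \<langle>\<xi>, t\<rangle>\<^sup>p H(t) dS(t)\<close> of a harmonic \<open>H\<close> of degree \<open>n\<close>; integration by parts gives the
  same recursion for the moments of the Gegenbauer polynomials.
\<close>

section \<open>Rotation invariance of the surface measure\<close>

text \<open>The sphere is never cut into parallels: the two sides of the Funk-Hecke formula are
  compared through a recursion in \<open>p\<close> that both satisfy, so the invariance of the
  surface measure and the values at \<open>p = 0\<close> suffice. For \<open>n = 0\<close> that
  start value is the relation between the areas of consecutive spheres, which is where the
  normalisation by \<sigma> of index \<open>m - 1\<close> comes from. The division by
  \<open>C_n(1)\<close> is equally forced: it makes the Gegenbauer recursion carry the factor
  \<open>n\<close> that Euler's identity produces on the sphere.

  The shape of the coefficients reflects the harmonic pieces. Their degrees \<open>k\<close>,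
  \<open>k + 1\<close>, \<open>k + 1\<close>, \<open>k + 2\<close> become the Gegenbauer indices,
  and the negative powers of \<open>r\<close> undo the homogeneity when the formula, valid at a unit
  vector, is rescaled to \<open>x\<close>. The coefficient of \<open>P\<close> alone is a mixture,
  since \<open>t P t\<close> is in general not harmonic: \<open>\<Delta>(x P x) = 2 \<mu> P\<close>
  and \<open>\<Delta>(|x|^2 P) = 2 (2k + m) P\<close>. This dictates the correction, which on the
  sphere is a multiple of \<open>P\<close> itself.\<close>

text \<open>
  The library has this for vectors indexed by a well-ordered type only. The argument is the
  uniqueness of translation invariant measures: \<open>\<lambda>(f\<^bsup>-1\<^esup> A) \<lambda>(B)\<close>, \<open>B\<close> the unit ball, is turned into
  \<open>\<lambda>(A) \<lambda>(B)\<close> by exchanging the integrations between two translations.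
\<close>

lemma lborel_distr_orthogonal_transformation:
  fixes f :: "'a::euclidean_space \<Rightarrow> 'a"
  assumes "orthogonal_transformation f"
  shows "distr lborel borel f = lborel"
proof (rule measure_eqI)
  have lin: "linear f" and nf: "norm (f x) = norm x" for x
    using assms by (auto simp: orthogonal_transformation)
  then have [measurable]: "f \<in> borel_measurable borel"
    by (simp add: borel_measurable_continuous_onI linear_continuous_on linear_conv_bounded_linear)
  \<comment> \<open>For fixed \<open>y\<close> the point \<open>g y\<close> serves as a translation
    vector: moving \<open>x\<close> by it moves \<open>f x\<close> by \<open>y\<close>.\<close>
  obtain g where g: "\<And>y. f (g y) = y"
    using orthogonal_transformation_surj[OF assms] by (metis surj_def)
  let ?B = "ball (0::'a) 1"
  have [measurable]: "?B \<in> sets borel" by simp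
  fix A assume "A \<in> sets (distr lborel borel f)"
  then have [measurable]: "A \<in> sets borel" by simp
  have shift: "(\<integral>\<^sup>+y. h (c + y) \<partial>lborel) = (\<integral>\<^sup>+y. h y \<partial>lborel)"
    if [measurable]: "h \<in> borel_measurable borel" for h :: "'a \<Rightarrow> ennreal" and c
  proof -
    have "(\<integral>\<^sup>+y. h y \<partial>distr lborel borel ((+) c)) = (\<integral>\<^sup>+y. h (c + y) \<partial>lborel)"
      by (rule nn_integral_distr) auto
    then show ?thesis by (simp add: lborel_distr_plus)
  qed
  have "(\<integral>\<^sup>+x. indicator A (f x) \<partial>lborel) * emeasure lborel ?B =
      (\<integral>\<^sup>+x. \<integral>\<^sup>+y. indicator A (f x) * indicator ?B y \<partial>lborel \<partial>lborel)"
    by (simp add: nn_integral_multc nn_integral_cmult_indicator)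
  also have "\<dots> = (\<integral>\<^sup>+x. \<integral>\<^sup>+y. indicator A (f x) * indicator ?B (- f x + y) \<partial>lborel \<partial>lborel)"
    by (rule nn_integral_cong, rule shift [symmetric]) measurable
  also have "\<dots> = (\<integral>\<^sup>+y. \<integral>\<^sup>+x. indicator A (f x) * indicator ?B (- f x + y) \<partial>lborel \<partial>lborel)"
    by (rule lborel_pair.Fubini' [symmetric]) measurable
  \<comment> \<open>After this shift the argument of \<open>?B\<close> becomes \<open>- f x\<close>,
    whose norm is that of \<open>x\<close>. The ball then no longer sees \<open>f\<close> or
    \<open>y\<close>, which separates the two factors.\<close>
  also have "\<dots> = (\<integral>\<^sup>+y. \<integral>\<^sup>+x. indicator A (f (g y + x)) * indicator ?B (- f (g y + x) + y) \<partial>lborel \<partial>lborel)"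
    by (rule nn_integral_cong, rule shift [symmetric]) measurable
  also have "\<dots> = (\<integral>\<^sup>+y. \<integral>\<^sup>+x. indicator A (f x + y) * indicator ?B x \<partial>lborel \<partial>lborel)"
    by (intro nn_integral_cong) (simp add: linear_add[OF lin] g nf add.commute indicator_def)
  also have "\<dots> = (\<integral>\<^sup>+x. \<integral>\<^sup>+y. indicator A (f x + y) * indicator ?B x \<partial>lborel \<partial>lborel)"
    by (rule lborel_pair.Fubini') measurable
  also have "\<dots> = (\<integral>\<^sup>+x. \<integral>\<^sup>+y. indicator A y * indicator ?B x \<partial>lborel \<partial>lborel)"
    by (rule nn_integral_cong, rule shift [where h = "\<lambda>y. indicator A y * indicator ?B _"]) measurable
  also have "\<dots> = emeasure lborel A * emeasure lborel ?B"
    by (simp add: nn_integral_multc nn_integral_cmult)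
  finally have "(\<integral>\<^sup>+x. indicator A (f x) \<partial>lborel) * emeasure lborel ?B =
      emeasure lborel A * emeasure lborel ?B" .
  moreover have "emeasure lborel ?B \<noteq> 0" "emeasure lborel ?B \<noteq> \<infinity>"
    using unit_ball_vol_pos[of "real DIM('a)"] by (auto simp: emeasure_ball simp del: unit_ball_vol_pos)
  ultimately have "(\<integral>\<^sup>+x. indicator A (f x) \<partial>lborel) = emeasure lborel A"
    by (simp add: mult.commute[of _ "emeasure lborel ?B"] ennreal_mult_cancel_left)
  moreover have "(\<integral>\<^sup>+x. indicator A (f x) \<partial>lborel) = emeasure (distr lborel borel f) A"
    by (subst nn_integral_indicator [symmetric], simp) (subst nn_integral_distr; simp)
  ultimately show "emeasure (distr lborel borel f) A = emeasure lborel A"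
    by simp
qed simp

section \<open>Integration against the surface measure\<close>

lemma space_sphere_measure [simp]: "space sphere_measure = sphere 0 1"
  and sets_sphere_measure [simp, measurable_cong]:
    "sets sphere_measure = sets (restrict_space borel (sphere 0 1))"
  by (simp_all add: sphere_measure_def space_scale_measure space_restrict_space)

lemma finite_measure_sphere_measure: "finite_measure sphere_measure"
proof
  have "emeasure sphere_measure (sphere 0 1 :: 'a set) \<le>
      DIM('a) * emeasure lborel (ball (0 :: 'a) 1)"
    unfolding emeasure_sphere_measure [OF borel_closed [OF closed_sphere] order_refl]
    by (intro mult_left_mono emeasure_mono) auto
  also have "\<dots> < \<infinity>"
    by (simp add: emeasure_ball ennreal_mult_less_top of_nat_less_top)
  finally show "emeasure (sphere_measure :: 'a measure) (space sphere_measure) \<noteq> \<infinity>"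
    by simp
qed

lemma integrable_sphere_measure:
  fixes f :: "'a::euclidean_space \<Rightarrow> 'b::{banach,second_countable_topology}"
  assumes "continuous_on (sphere 0 1) f"
  shows "integrable sphere_measure f"
proof -
  interpret finite_measure "sphere_measure :: 'a measure"
    by (rule finite_measure_sphere_measure)
  have "bounded (f ` sphere 0 1)"
    by (intro compact_imp_bounded compact_continuous_image assms) simp
  then obtain B where "\<And>x. x \<in> sphere 0 1 \<Longrightarrow> norm (f x) \<le> B"
    unfolding bounded_iff by blast
  moreover have "f \<in> borel_measurable sphere_measure"
    using borel_measurable_continuous_on_restrict [OF assms]
    by (simp add: measurable_cong_sets [OF sets_sphere_measure refl])
  ultimately show ?thesis
    by (intro integrable_const_bound [where B = B]) auto
qed

text \<open>The surface measure is defined by volumes of cones, and a linear isometry commutes with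
  the formation of cones, so the invariance of Lebesgue measure carries over.\<close>

lemma integral_sphere_measure_orthogonal_transformation:
  fixes f :: "'a::euclidean_space \<Rightarrow> 'a" and q :: "'a \<Rightarrow> 'b::{banach,second_countable_topology}"
  assumes f: "orthogonal_transformation f" and q: "continuous_on (sphere 0 1) q"
  shows "(\<integral>t. q (f t) \<partial>sphere_measure) = (\<integral>t. q t \<partial>sphere_measure)"
proof -
  have lin: "linear f" and nf: "norm (f x) = norm x" for x
    using f by (auto simp: orthogonal_transformation)
  then have borel: "f \<in> borel_measurable borel"
    by (simp add: borel_measurable_continuous_onI linear_continuous_on linear_conv_bounded_linear)
  have meas: "f \<in> sphere_measure \<rightarrow>\<^sub>M sphere_measure"
    unfolding measurable_cong_sets [OF sets_sphere_measure sets_sphere_measure]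
    by (rule measurable_restrict_space3 [OF borel]) (auto simp: nf)
  have "distr sphere_measure sphere_measure f = sphere_measure"
  proof (rule measure_eqI)
    fix E assume "E \<in> sets (distr sphere_measure sphere_measure f)"
    then have E: "E \<in> sets borel" "E \<subseteq> sphere 0 1" and E': "E \<in> sets sphere_measure"
      by (auto simp: sets_restrict_space_iff)
    let ?cone = "\<lambda>E. {s *\<^sub>R x | s x. 0 < s \<and> s < (1::real) \<and> x \<in> E}"
    have "emeasure (distr sphere_measure sphere_measure f) E =
        emeasure sphere_measure (f -` E \<inter> sphere 0 1)"
      by (simp add: emeasure_distr [OF meas E'])
    also have "\<dots> = DIM('a) * emeasure lborel (?cone (f -` E \<inter> sphere 0 1))"
    proof (rule emeasure_sphere_measure)
      have "f -` E \<in> sets borel"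
        using measurable_sets[OF borel, of E] E by simp
      then show "f -` E \<inter> sphere 0 1 \<in> sets borel" by auto
    qed simp
    also have "?cone (f -` E \<inter> sphere 0 1) = f -` ?cone E"
    proof (intro set_eqI iffI)
      fix y assume "y \<in> f -` ?cone E"
      then obtain s x where y: "f y = s *\<^sub>R x" "0 < s" "s < 1" "x \<in> E" by blast
      then have "f (y /\<^sub>R s) = x" by (simp add: linear_cmul[OF lin])
      moreover have "norm (y /\<^sub>R s) = 1" using y E nf[of y] by auto
      ultimately show "y \<in> ?cone (f -` E \<inter> sphere 0 1)"
        using y by (intro CollectI exI[of _ s] exI[of _ "y /\<^sub>R s"]) auto
    next
      fix y assume "y \<in> ?cone (f -` E \<inter> sphere 0 1)"
      then show "y \<in> f -` ?cone E"
        using linear_cmul[OF lin] by auto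
    qed
    also have "emeasure lborel \<dots> = emeasure lborel (?cone E)"
    proof -
      \<comment> \<open>Seen as a preimage under the Borel map \<open>sgn\<close>, the cone is a
        Borel set, as the transport of Lebesgue measure along \<open>f\<close> demands.\<close>
      have "sgn -` E \<inter> (ball 0 1 - {0}) = ?cone E"
      proof (intro set_eqI iffI)
        fix y assume "y \<in> sgn -` E \<inter> (ball 0 1 - {0})"
        then have "y = norm y *\<^sub>R sgn y" "0 < norm y" "norm y < 1" "sgn y \<in> E"
          by (auto simp: sgn_div_norm)
        then show "y \<in> ?cone E" by blast
      next
        fix y assume "y \<in> ?cone E"
        then obtain s x where "y = s *\<^sub>R x" "0 < s" "s < 1" "x \<in> E" by blast
        moreover from this have "norm x = 1" using E by auto
        ultimately show "y \<in> sgn -` E \<inter> (ball 0 1 - {0})"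
          by (auto simp: sgn_div_norm)
      qed
      moreover have "(\<lambda>x::'a. sgn x) \<in> borel_measurable borel"
        unfolding sgn_div_norm by measurable
      ultimately have cone: "?cone E \<in> sets borel"
        using measurable_sets[of sgn borel borel E] E by (metis borel_open inf_top_right open_ball
            open_delete sets.Int space_borel)
      have "emeasure lborel (f -` ?cone E) = emeasure (distr lborel borel f) (?cone E)"
        using cone borel by (simp add: emeasure_distr)
      then show ?thesis
        by (simp add: lborel_distr_orthogonal_transformation[OF f])
    qed
    finally show "emeasure (distr sphere_measure sphere_measure f) E = emeasure sphere_measure E"
      by (simp add: emeasure_sphere_measure [OF E])
  qed simp
  moreover have "q \<in> borel_measurable sphere_measure"
    using integrable_sphere_measure[OF q] by auto
  ultimately show ?thesis
    using integral_distr[OF meas, of q] by simp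
qed

section \<open>Estimates and dependence on parameters\<close>

lemma sphere_integral_norm_bound:
  fixes f :: "'a::euclidean_space \<Rightarrow> 'b::{banach,second_countable_topology}"
  assumes "continuous_on (sphere 0 1) f" and "\<And>t. norm t = 1 \<Longrightarrow> norm (f t) \<le> B"
  shows "norm (\<integral>t. f t \<partial>sphere_measure) \<le> B * sphere_area DIM('a)"
proof -
  interpret finite_measure "sphere_measure :: 'a measure"
    by (rule finite_measure_sphere_measure)
  have "norm (\<integral>t. f t \<partial>sphere_measure) \<le> (\<integral>t. norm (f t) \<partial>sphere_measure)"
    by (rule integral_norm_bound)
  also have "\<dots> \<le> (\<integral>t. B \<partial>(sphere_measure :: 'a measure))"
    by (intro integral_mono integrable_sphere_measure assms continuous_on_norm continuous_intros)
      (auto simp: assms)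
  also have "\<dots> = B * sphere_area DIM('a)"
    using measure_sphere_measure[where 'a='a] by simp
  finally show ?thesis .
qed

lemma sphere_area_nonneg: "0 \<le> sphere_area n"
  by (simp add: sphere_area_def)

lemma continuous_on_sphere_integral:
  fixes f :: "'p::metric_space \<Rightarrow> 'a::euclidean_space \<Rightarrow> 'b::{banach,second_countable_topology}"
  assumes cont: "continuous_on (S \<times> sphere 0 1) (\<lambda>(p, t). f p t)"
  shows "continuous_on S (\<lambda>p. \<integral>t. f p t \<partial>sphere_measure)"
  unfolding continuous_on_iff
proof (intro ballI allI impI)
  fix p0 and e :: real assume p0: "p0 \<in> S" and "0 < e"
  \<comment> \<open>The \<open>+ 1\<close> in the denominator keeps the quotient meaningful and
    makes \<open>e' * sphere_area DIM('a)\<close> strictly smaller than \<open>e\<close>.\<close>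
  define e' where "e' = e / (sphere_area DIM('a) + 1)"
  have "0 < e'" using \<open>0 < e\<close> sphere_area_nonneg[of "DIM('a)"] by (simp add: e'_def)
  have slice: "continuous_on (sphere 0 1) (f p)" if "p \<in> S" for p
    using continuous_on_compose2 [OF cont continuous_on_Pair [OF continuous_on_const [of "sphere 0 1" p]
        continuous_on_id]] that by auto
  \<comment> \<open>Compactness of the sphere gives one neighbourhood of \<open>p0\<close> that
    works for all \<open>t\<close> at once.\<close>
  obtain X where X: "p0 \<in> X" "open X"
      "\<forall>p\<in>X \<inter> S. \<forall>t\<in>sphere 0 1. dist (case (p, t) of (p, t) \<Rightarrow> f p t)
        (case (p0, t) of (p, t) \<Rightarrow> f p t) \<le> e'"
    using continuous_on_prod_compactE [OF cont compact_sphere p0 \<open>0 < e'\<close>] by metis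
  then obtain d where d: "d > 0" "ball p0 d \<subseteq> X"
    by (meson open_contains_ball)
  have "dist (\<integral>t. f p t \<partial>sphere_measure) (\<integral>t. f p0 t \<partial>sphere_measure) < e"
    if "p \<in> S" "dist p p0 < d" for p
  proof -
    have "p \<in> X \<inter> S" using d that by (auto simp: dist_commute)
    then have "norm (\<integral>t. f p t - f p0 t \<partial>sphere_measure) \<le> e' * sphere_area DIM('a)"
      using X(3) by (intro sphere_integral_norm_bound continuous_on_diff slice p0)
        (auto simp: dist_norm)
    also have "\<dots> < e"
      using \<open>0 < e\<close> sphere_area_nonneg[of "DIM('a)"] by (simp add: e'_def field_simps)
    finally show ?thesis
      using slice[OF p0] slice[OF \<open>p \<in> S\<close>] by (simp add: dist_norm integrable_sphere_measure)
  qed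
  then show "\<exists>d>0. \<forall>p\<in>S. dist p p0 < d \<longrightarrow>
      dist (\<integral>t. f p t \<partial>sphere_measure) (\<integral>t. f p0 t \<partial>sphere_measure) < e"
    using d by blast
qed

text \<open>Continuity of the derivative is only asked for in every fixed direction: in finite
  dimension this is continuity in the operator norm.\<close>

lemma has_derivative_sphere_integral:
  fixes f :: "'p::euclidean_space \<Rightarrow> 'a::euclidean_space \<Rightarrow> 'b::euclidean_space"
  assumes "open S" and p0: "p0 \<in> S"
    and deriv: "\<And>p t. p \<in> S \<Longrightarrow> norm t = 1 \<Longrightarrow> ((\<lambda>p. f p t) has_derivative f' p t) (at p)"
    and cont: "\<And>p. p \<in> S \<Longrightarrow> continuous_on (sphere 0 1) (f p)"
    and cont': "\<And>v. continuous_on (S \<times> sphere 0 1) (\<lambda>(p, t). f' p t v)"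
  shows "((\<lambda>p. \<integral>t. f p t \<partial>sphere_measure) has_derivative
    (\<lambda>v. \<integral>t. f' p0 t v \<partial>sphere_measure)) (at p0)"
proof -
  have slice': "continuous_on (sphere 0 1) (\<lambda>t. f' p t v)" if "p \<in> S" for p v
    using continuous_on_compose2 [OF cont' continuous_on_Pair [OF continuous_on_const [of "sphere 0 1" p]
        continuous_on_id]] that by auto
  have lin: "linear (f' p t)" if "p \<in> S" "norm t = 1" for p t
    using deriv[OF that] has_derivative_linear by blast
  have bl: "bounded_linear (f' p t)" if "p \<in> S" "norm t = 1" for p t
    using deriv[OF that] has_derivative_bounded_linear by blast
  have "continuous_on (S \<times> sphere 0 1) (\<lambda>z. Blinfun (f' (fst z) (snd z)))"
  proof (rule continuous_on_blinfun_componentwise)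
    fix i :: 'p assume "i \<in> Basis"
    show "continuous_on (S \<times> sphere 0 1) (\<lambda>z. blinfun_apply (Blinfun (f' (fst z) (snd z))) i)"
      by (rule continuous_on_eq [OF cont'[of i]]) (auto simp: bounded_linear_Blinfun_apply bl)
  qed
  then have contB: "continuous_on (S \<times> sphere 0 1) (\<lambda>z. Blinfun (f' (fst z) (snd z)))" .
  have "linear (\<lambda>v. \<integral>t. f' p0 t v \<partial>sphere_measure)"
  proof
    fix v w :: 'p and c :: real
    have "(\<integral>t. f' p0 t (v + w) \<partial>sphere_measure) = (\<integral>t. f' p0 t v + f' p0 t w \<partial>sphere_measure)"
      by (rule Bochner_Integration.integral_cong) (auto simp: linear_add lin p0)
    then show "(\<integral>t. f' p0 t (v + w) \<partial>sphere_measure) =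
        (\<integral>t. f' p0 t v \<partial>sphere_measure) + (\<integral>t. f' p0 t w \<partial>sphere_measure)"
      by (simp add: integrable_sphere_measure slice' p0)
    have "(\<integral>t. f' p0 t (c *\<^sub>R v) \<partial>sphere_measure) = (\<integral>t. c *\<^sub>R f' p0 t v \<partial>sphere_measure)"
      by (rule Bochner_Integration.integral_cong) (auto simp: linear_cmul lin p0)
    then show "(\<integral>t. f' p0 t (c *\<^sub>R v) \<partial>sphere_measure) = c *\<^sub>R (\<integral>t. f' p0 t v \<partial>sphere_measure)"
      by simp
  qed
  then have "bounded_linear (\<lambda>v. \<integral>t. f' p0 t v \<partial>sphere_measure)"
    by (simp add: linear_conv_bounded_linear)
  moreover have "\<exists>d>0. \<forall>p. norm (p - p0) < d \<longrightarrow>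
      norm ((\<integral>t. f p t \<partial>sphere_measure) - (\<integral>t. f p0 t \<partial>sphere_measure) -
        (\<integral>t. f' p0 t (p - p0) \<partial>sphere_measure)) \<le> e * norm (p - p0)" if "0 < e" for e
  proof -
    define e' where "e' = e / (sphere_area DIM('a) + 1)"
    have "0 < e'" using \<open>0 < e\<close> sphere_area_nonneg[of "DIM('a)"] by (simp add: e'_def)
    obtain X where X: "p0 \<in> X" "open X"
        "\<forall>p\<in>X \<inter> S. \<forall>t\<in>sphere 0 1. dist (Blinfun (f' (fst (p, t)) (snd (p, t))))
          (Blinfun (f' (fst (p0, t)) (snd (p0, t)))) \<le> e'"
      using continuous_on_prod_compactE [OF contB compact_sphere p0 \<open>0 < e'\<close>] by metis
    obtain d where d: "d > 0" "ball p0 d \<subseteq> X \<inter> S"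
      using openE[of "X \<inter> S" p0] X p0 \<open>open S\<close> by blast
    have on: "onorm (\<lambda>v. f' p t v - f' p0 t v) \<le> e'" if "p \<in> ball p0 d" "norm t = 1" for p t
    proof -
      have "p \<in> X \<inter> S" using d that by blast
      then have "norm (Blinfun (f' p t) - Blinfun (f' p0 t)) \<le> e'"
        using X(3) that by (auto simp: dist_norm)
      then show ?thesis
        using \<open>p \<in> X \<inter> S\<close> that p0
        by (simp add: norm_blinfun.rep_eq minus_blinfun.rep_eq bounded_linear_Blinfun_apply bl)
    qed
    have "norm ((\<integral>t. f p t \<partial>sphere_measure) - (\<integral>t. f p0 t \<partial>sphere_measure) -
        (\<integral>t. f' p0 t (p - p0) \<partial>sphere_measure)) \<le> e * norm (p - p0)" if "norm (p - p0) < d" for p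
    proof -
      have p: "p \<in> ball p0 d" using that by (simp add: dist_norm norm_minus_commute)
      then have "p \<in> S" using d by blast
      \<comment> \<open>Mean value inequality on the ball around \<open>p0\<close>, where the
        derivative stays within \<open>e'\<close> of its value at \<open>p0\<close>, uniformly in
        \<open>t\<close>.\<close>
      have "norm (f p t - f p0 t - f' p0 t (p - p0)) \<le> norm (p - p0) * e'" if t: "norm t = 1" for t
      proof (rule differentiable_bound_linearization [of p0 p "ball p0 d" "\<lambda>p. f p t" "\<lambda>p. f' p t" p0 e'])
        show "((\<lambda>p. f p t) has_derivative f' p t) (at p within ball p0 d)" if "p \<in> ball p0 d" for p
        proof -
          have "p \<in> S" using d that by blast
          from deriv[OF this t] show ?thesis by (rule has_derivative_at_withinI)
        qed
        show "p0 + s *\<^sub>R (p - p0) \<in> ball p0 d" if "s \<in> {0..1}" for s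
        proof -
          have "norm (s *\<^sub>R (p - p0)) \<le> 1 * norm (p - p0)"
            unfolding norm_scaleR using that by (intro mult_right_mono) auto
          then show ?thesis using \<open>norm (p - p0) < d\<close> by (simp add: dist_norm)
        qed
        show "onorm (f' p t - f' p0 t) \<le> e'" if "p \<in> ball p0 d" for p
          using on[OF that t] by (simp add: fun_diff_def)
        show "p0 \<in> ball p0 d" using d by simp
      qed
      then have "norm (\<integral>t. f p t - f p0 t - f' p0 t (p - p0) \<partial>sphere_measure)
          \<le> norm (p - p0) * e' * sphere_area DIM('a)"
        using \<open>p \<in> S\<close> p0 by (intro sphere_integral_norm_bound continuous_on_diff cont slice') auto
      also have "\<dots> = norm (p - p0) * (e' * sphere_area DIM('a))" by simp
      also have "\<dots> \<le> norm (p - p0) * e"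
        using \<open>0 < e\<close> sphere_area_nonneg[of "DIM('a)"]
        by (intro mult_left_mono) (simp_all add: e'_def field_simps)
      finally show ?thesis
        using \<open>p \<in> S\<close> p0 by (simp add: integrable_sphere_measure cont slice' mult.commute)
    qed
    then show ?thesis using d by blast
  qed
  ultimately show ?thesis
    unfolding has_derivative_at_alt by blast
qed

section \<open>Homogeneous polynomials and the Laplacian\<close>

lemma directional_deriv_eq:
  "(f has_derivative f') (at p) \<Longrightarrow> directional_deriv f v p = f' v"
proof -
  assume f: "(f has_derivative f') (at p)"
  have "((\<lambda>t. p + t *\<^sub>R v) has_vector_derivative v) (at 0)"
    by (auto intro!: derivative_eq_intros simp: has_vector_derivative_def)
  from vector_derivative_diff_chain_within [of _ _ _ UNIV, OF this, of f f'] f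
  have "((\<lambda>t. f (p + t *\<^sub>R v)) has_vector_derivative f' v) (at 0)"
    by (simp add: o_def has_derivative_at_withinI)
  then show ?thesis
    unfolding directional_deriv_def by (rule vector_derivative_at)
qed

text \<open>With the direction in front, \<open>DD v\<close> is an operator on functions and can be
  iterated.\<close>

abbreviation DD :: "'a::real_normed_vector \<Rightarrow> ('a \<Rightarrow> 'b::real_normed_vector) \<Rightarrow> 'a \<Rightarrow> 'b"
  where "DD v f \<equiv> directional_deriv f v"

lemma differentiable_has_derivative_DD:
  "f differentiable (at x) \<Longrightarrow> (f has_derivative (\<lambda>v. DD v f x)) (at x)"
  using directional_deriv_eq[of f _ x] unfolding differentiable_def
  by (metis (no_types, lifting) has_derivative_transform_within has_derivative_eq_rhs ext)

lemma DD_linear: "f differentiable (at x) \<Longrightarrow> linear (\<lambda>v. DD v f x)"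
  using differentiable_has_derivative_DD has_derivative_linear by blast

lemma DD_const [simp]: "DD v (\<lambda>_. c) x = 0"
  by (rule directional_deriv_eq) simp

lemma DD_add:
  "f differentiable (at x) \<Longrightarrow> g differentiable (at x) \<Longrightarrow>
    DD v (\<lambda>x. f x + g x) x = DD v f x + DD v g x"
  by (rule directional_deriv_eq) (intro has_derivative_add differentiable_has_derivative_DD)

lemma DD_bounded_linear:
  "bounded_linear L \<Longrightarrow> f differentiable (at x) \<Longrightarrow> DD v (\<lambda>x. L (f x)) x = L (DD v f x)"
  by (rule directional_deriv_eq)
    (rule bounded_linear.has_derivative, assumption, erule differentiable_has_derivative_DD)

lemma DD_inner_scaleR:
  fixes x :: "'a::real_inner"
  assumes "f differentiable (at x)"
  shows "DD v (\<lambda>x. (x \<bullet> b) *\<^sub>R f x) x = (v \<bullet> b) *\<^sub>R f x + (x \<bullet> b) *\<^sub>R DD v f x"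
  using differentiable_has_derivative_DD[OF assms]
  by (intro directional_deriv_eq) (auto intro!: derivative_eq_intros)

lemma DD_scaleR_add_inner_scaleR:
  fixes x :: "'a::real_inner"
  assumes "f differentiable (at x)" and "g differentiable (at x)"
  shows "DD v (\<lambda>x. c *\<^sub>R f x + (x \<bullet> b) *\<^sub>R g x) x =
    c *\<^sub>R DD v f x + (v \<bullet> b) *\<^sub>R g x + (x \<bullet> b) *\<^sub>R DD v g x"
  using assms [THEN differentiable_has_derivative_DD]
  by (intro directional_deriv_eq) (auto intro!: derivative_eq_intros)

lemma DD_sum:
  assumes "\<And>i. i \<in> I \<Longrightarrow> f i differentiable (at x)"
  shows "DD v (\<lambda>x. \<Sum>i\<in>I. f i x) x = (\<Sum>i\<in>I. DD v (f i) x)"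
  by (rule directional_deriv_eq) (intro has_derivative_sum differentiable_has_derivative_DD assms)

text \<open>Unlike the multi-index sums of \<^const>\<open>homogeneous_polynomial\<close>, this form gives closure
  under differentiation by rule induction.\<close>

inductive hom_poly :: "nat \<Rightarrow> ('a::euclidean_space \<Rightarrow> 'b::real_normed_vector) \<Rightarrow> bool" where
  const: "hom_poly 0 (\<lambda>_. c)"
| mult: "hom_poly n f \<Longrightarrow> hom_poly (Suc n) (\<lambda>x. (x \<bullet> b) *\<^sub>R f x)"
| add: "hom_poly n f \<Longrightarrow> hom_poly n g \<Longrightarrow> hom_poly n (\<lambda>x. f x + g x)"

text \<open>Zero has every degree. This makes the truncated degree \<open>n - 1\<close> correct even
  for derivatives of constants.\<close>

lemma hom_poly_zero: "hom_poly n (\<lambda>_. 0)"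
proof (induction n)
  case (Suc n)
  then show ?case using hom_poly.mult[OF Suc, of 0] by simp
qed (rule hom_poly.const)

lemma hom_poly_linear:
  "hom_poly n f \<Longrightarrow> linear L \<Longrightarrow> hom_poly n (\<lambda>x. L (f x))"
  by (induction rule: hom_poly.induct) (auto simp: linear_add linear_cmul intro: hom_poly.intros)

lemma hom_poly_scaleR: "hom_poly n f \<Longrightarrow> hom_poly n (\<lambda>x. c *\<^sub>R f x)"
  by (rule hom_poly_linear) (auto intro: linear_scale_self linearI simp: algebra_simps)

lemma hom_poly_sum:
  "(\<And>i. i \<in> I \<Longrightarrow> hom_poly n (f i)) \<Longrightarrow> hom_poly n (\<lambda>x. \<Sum>i\<in>I. f i x)"
  by (induction I rule: infinite_finite_induct) (auto intro: hom_poly_zero hom_poly.add)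

lemma hom_poly_inner_power:
  "hom_poly n f \<Longrightarrow> hom_poly (p + n) (\<lambda>x. (x \<bullet> b) ^ p *\<^sub>R f x)"
proof (induction p)
  case (Suc p)
  then show ?case using hom_poly.mult[OF Suc.IH[OF Suc.prems], of b] by simp
qed simp

lemma hom_poly_differentiable: "hom_poly n f \<Longrightarrow> f differentiable (at x)"
  by (induction rule: hom_poly.induct) (auto intro!: derivative_intros differentiable_scaleR)

lemma hom_poly_continuous_on: "hom_poly n f \<Longrightarrow> continuous_on S f"
  by (meson hom_poly_differentiable continuous_at_imp_continuous_on differentiable_imp_continuous_within)

lemma hom_poly_homogeneous: "hom_poly n f \<Longrightarrow> f (c *\<^sub>R x) = c ^ n *\<^sub>R f x"
  by (induction rule: hom_poly.induct) (auto simp: algebra_simps)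

lemma hom_poly_0: "hom_poly 0 f \<Longrightarrow> f x = f y"
  by (induction "0::nat" f rule: hom_poly.induct) auto

lemma hom_poly_euler: "hom_poly n f \<Longrightarrow> DD x f x = real n *\<^sub>R f x"
  by (induction rule: hom_poly.induct)
    (auto simp: DD_inner_scaleR DD_add hom_poly_differentiable algebra_simps)

text \<open>The clause on \<open>n = 0\<close> strengthens the induction. In the \<open>mult\<close>
  case with \<open>n = 0\<close> the product \<open>(x \<bullet> b) *\<^sub>R DD v f x\<close> would
  receive degree 1, because \<open>n - 1\<close> is truncated, while degree 0 is wanted; it has that
  degree only because \<open>DD v f\<close> vanishes.\<close>

lemma hom_poly_DD_cases:
  "hom_poly n f \<Longrightarrow> (n = 0 \<longrightarrow> DD v f = (\<lambda>_. 0)) \<and> hom_poly (n - 1) (DD v f)"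
proof (induction rule: hom_poly.induct)
  case (const c)
  have "DD v (\<lambda>_. c) = (\<lambda>_. 0)" by (rule ext) simp
  then show ?case by (simp add: hom_poly_zero)
next
  case (mult n f b)
  have *: "DD v (\<lambda>x. (x \<bullet> b) *\<^sub>R f x) = (\<lambda>x. (v \<bullet> b) *\<^sub>R f x + (x \<bullet> b) *\<^sub>R DD v f x)"
    by (rule ext) (simp add: DD_inner_scaleR hom_poly_differentiable[OF mult.hyps])
  have "hom_poly n (\<lambda>x. (x \<bullet> b) *\<^sub>R DD v f x)"
    using mult.IH hom_poly.mult[of "n - 1" "DD v f" b] by (cases n) (auto intro: hom_poly_zero)
  then show ?case
    unfolding * using mult.hyps by (auto intro!: hom_poly.add hom_poly_scaleR)
next
  case (add n f g)
  have "DD v (\<lambda>x. f x + g x) = (\<lambda>x. DD v f x + DD v g x)"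
    by (rule ext) (intro DD_add hom_poly_differentiable[OF add.hyps(1)] hom_poly_differentiable[OF add.hyps(2)])
  with add.IH show ?case by (auto intro: hom_poly.add)
qed

lemma hom_poly_DD: "hom_poly n f \<Longrightarrow> hom_poly (n - 1) (DD v f)"
  using hom_poly_DD_cases by blast

lemma hom_poly_DD_linear: "hom_poly n f \<Longrightarrow> linear (\<lambda>v. DD v f x)"
  by (intro DD_linear hom_poly_differentiable)

lemma hom_poly_DD_expand:
  "hom_poly n f \<Longrightarrow> DD v f x = (\<Sum>b\<in>Basis. (v \<bullet> b) *\<^sub>R DD b f x)"
  using linear_sum[OF hom_poly_DD_linear[of n f x], of "\<lambda>b. (v \<bullet> b) *\<^sub>R b" Basis]
  by (simp add: euclidean_representation linear_cmul[OF hom_poly_DD_linear[of n f x]])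

lemmas hom_poly_DD_inner_scaleR = DD_inner_scaleR [OF hom_poly_differentiable]
lemmas hom_poly_DD_add = DD_add [OF hom_poly_differentiable hom_poly_differentiable]

text \<open>In the product rule the two terms with a single derivative of \<open>f\<close> are
  exchanged along with \<open>u\<close> and \<open>v\<close>, so the symmetry passes from
  \<open>f\<close> to its product with a linear form.\<close>

lemma DD_commute: "hom_poly n f \<Longrightarrow> DD u (DD v f) x = DD v (DD u f) x"
proof (induction arbitrary: x rule: hom_poly.induct)
  case (const c)
  have "DD v (\<lambda>_. c) = (\<lambda>_. 0)" for v by (rule ext) simp
  then show ?case by simp
next
  case (mult n f b)
  have *: "DD v (\<lambda>x. (x \<bullet> b) *\<^sub>R f x) = (\<lambda>x. (v \<bullet> b) *\<^sub>R f x + (x \<bullet> b) *\<^sub>R DD v f x)" for v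
    by (rule ext) (rule hom_poly_DD_inner_scaleR[OF mult.hyps])
  have "DD u (\<lambda>x. (v \<bullet> b) *\<^sub>R f x + (x \<bullet> b) *\<^sub>R DD v f x) x =
      (v \<bullet> b) *\<^sub>R DD u f x + (u \<bullet> b) *\<^sub>R DD v f x + (x \<bullet> b) *\<^sub>R DD u (DD v f) x" for u v
    by (intro DD_scaleR_add_inner_scaleR hom_poly_differentiable[OF mult.hyps]
        hom_poly_differentiable[OF hom_poly_DD[OF mult.hyps]])
  then show ?case
    unfolding * by (simp add: mult.IH)
next
  case (add n f g)
  have *: "DD v (\<lambda>x. f x + g x) = (\<lambda>x. DD v f x + DD v g x)" for v
    by (rule ext) (rule hom_poly_DD_add[OF add.hyps(1,2)])
  show ?case
    unfolding * by (simp add: add.IH hom_poly_DD_add[OF hom_poly_DD[OF add.hyps(1)] hom_poly_DD[OF add.hyps(2)]])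
qed

section \<open>The Laplacian\<close>

definition laplacian :: "('a::euclidean_space \<Rightarrow> 'b::real_normed_vector) \<Rightarrow> 'a \<Rightarrow> 'b"
  where "laplacian f x = (\<Sum>b\<in>Basis. DD b (DD b f) x)"

text \<open>Directional derivatives of harmonic polynomials are therefore harmonic, which keeps the
  moment recursion inside the harmonic polynomials.\<close>

lemma laplacian_DD:
  assumes "hom_poly n f" shows "laplacian (DD v f) x = DD v (laplacian f) x"
proof -
  have f2: "hom_poly (n - 1 - 1) (DD b (DD b f))" for b
    by (intro hom_poly_DD assms)
  have swap: "DD b (DD v f) = DD v (DD b f)" for b
    using DD_commute[OF assms] by blast
  have "laplacian (DD v f) x = (\<Sum>b\<in>Basis. DD v (DD b (DD b f)) x)"
    unfolding laplacian_def swap by (simp add: DD_commute[OF hom_poly_DD[OF assms], of _ v])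
  also have "\<dots> = DD v (laplacian f) x"
    unfolding laplacian_def[abs_def] using hom_poly_differentiable[OF f2] by (subst DD_sum) auto
  finally show ?thesis .
qed

text \<open>The linear factor has no second derivative, and the cross terms
  \<open>2 (a \<bullet> b) DD b f\<close> over the basis reassemble to twice the derivative along
  \<open>a\<close>.\<close>

lemma laplacian_inner_scaleR:
  assumes f: "hom_poly n f"
  shows "laplacian (\<lambda>x. (x \<bullet> a) *\<^sub>R f x) x = 2 *\<^sub>R DD a f x + (x \<bullet> a) *\<^sub>R laplacian f x"
proof -
  have *: "DD v (\<lambda>x. (x \<bullet> a) *\<^sub>R f x) = (\<lambda>x. (v \<bullet> a) *\<^sub>R f x + (x \<bullet> a) *\<^sub>R DD v f x)" for v
    by (rule ext) (rule hom_poly_DD_inner_scaleR[OF f])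
  have "DD b (\<lambda>x. (b \<bullet> a) *\<^sub>R f x + (x \<bullet> a) *\<^sub>R DD b f x) x =
      2 *\<^sub>R ((a \<bullet> b) *\<^sub>R DD b f x) + (x \<bullet> a) *\<^sub>R DD b (DD b f) x" for b
    using DD_scaleR_add_inner_scaleR [OF hom_poly_differentiable[OF f]
        hom_poly_differentiable[OF hom_poly_DD[OF f]], where v = b and c = "b \<bullet> a" and b = a]
    by (simp add: inner_commute flip: scaleR_2 scaleR_scaleR)
  then show ?thesis
    unfolding laplacian_def * hom_poly_DD_expand[OF f, of a]
    by (simp add: sum.distrib scaleR_sum_right)
qed

lemma laplacian_add:
  "hom_poly n f \<Longrightarrow> hom_poly k g \<Longrightarrow> laplacian (\<lambda>x. f x + g x) x = laplacian f x + laplacian g x"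
proof -
  assume f: "hom_poly n f" and g: "hom_poly k g"
  have *: "DD v (\<lambda>x. f x + g x) = (\<lambda>x. DD v f x + DD v g x)" for v
    by (rule ext) (rule hom_poly_DD_add[OF f g])
  show ?thesis
    unfolding laplacian_def * by (simp add: hom_poly_DD_add[OF hom_poly_DD[OF f] hom_poly_DD[OF g]] sum.distrib)
qed

lemma laplacian_bounded_linear:
  "bounded_linear L \<Longrightarrow> hom_poly n f \<Longrightarrow> laplacian (\<lambda>x. L (f x)) x = L (laplacian f x)"
proof -
  assume L: "bounded_linear L" and f: "hom_poly n f"
  have *: "DD v (\<lambda>x. L (f x)) = (\<lambda>x. L (DD v f x))" for v
    by (rule ext) (rule DD_bounded_linear[OF L hom_poly_differentiable[OF f]])
  show ?thesis
    unfolding laplacian_def *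
    by (simp add: DD_bounded_linear[OF L hom_poly_differentiable[OF hom_poly_DD[OF f]]]
        linear_sum bounded_linear.linear[OF L])
qed

lemma laplacian_zero [simp]:
  "laplacian (\<lambda>_. 0 :: 'b::real_normed_vector) (x :: 'a::euclidean_space) = 0"
proof -
  have "DD b (\<lambda>_ :: 'a. 0 :: 'b) = (\<lambda>_. 0)" for b
    by (rule ext) simp
  then show ?thesis by (simp add: laplacian_def)
qed

lemma laplacian_sum:
  "(\<And>i. i \<in> I \<Longrightarrow> hom_poly n (f i)) \<Longrightarrow>
    laplacian (\<lambda>x. \<Sum>i\<in>I. f i x) x = (\<Sum>i\<in>I. laplacian (f i) x)"
proof (induction I rule: infinite_finite_induct)
  case (insert i I)
  have "hom_poly n (f i)" "hom_poly n (\<lambda>x. \<Sum>i\<in>I. f i x)"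
    using insert.prems by (auto intro!: hom_poly_sum)
  from laplacian_add [OF this] insert show ?case by simp
qed simp_all

lemma homogeneous_polynomial_imp_hom_poly:
  fixes P :: "real ^ 'm \<Rightarrow> 'b::real_normed_vector"
  assumes "homogeneous_polynomial k P"
  shows "hom_poly k P"
proof -
  obtain a where a: "\<And>x. P x = (\<Sum>\<alpha> | (\<Sum>j\<in>UNIV. \<alpha> j) = k. (\<Prod>j\<in>UNIV. x $ j ^ \<alpha> j) *\<^sub>R a \<alpha>)"
    using assms by (auto simp: homogeneous_polynomial_def)
  have "hom_poly (sum \<alpha> J) (\<lambda>x. (\<Prod>j\<in>J. x $ j ^ \<alpha> j) *\<^sub>R c)" if "finite J" for \<alpha> :: "'m \<Rightarrow> nat" and J c
    using that
  proof (induction J)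
    case (insert j J)
    then show ?case
      using hom_poly_inner_power[OF insert.IH, of "\<alpha> j" "axis j 1"] by (simp add: inner_axis inner_real_def)
  qed (simp add: hom_poly.const)
  from this [OF finite] have "hom_poly k (\<lambda>x. (\<Prod>j\<in>UNIV. x $ j ^ \<alpha> j) *\<^sub>R a \<alpha>)" if "(\<Sum>j\<in>UNIV. \<alpha> j) = k" for \<alpha>
    using that by blast
  then have "hom_poly k (\<lambda>x. \<Sum>\<alpha> | (\<Sum>j\<in>UNIV. \<alpha> j) = k. (\<Prod>j\<in>UNIV. x $ j ^ \<alpha> j) *\<^sub>R a \<alpha>)"
    by (intro hom_poly_sum) simp
  then show ?thesis
    unfolding a[symmetric] by simp
qed

section \<open>Divergence theorem on the sphere\<close>

text \<open>\<open>R \<theta>\<close> rotates the plane of \<open>u\<close> and \<open>w\<close> by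
  the angle \<theta> and fixes its orthogonal complement; \<open>R'\<close> is its derivative in
  \<theta>. The integral of \<open>q (R \<theta> t)\<close> is constant in \<theta>, so its
  derivative at 0, taken under the integral sign, vanishes.\<close>

lemma sphere_integral_infinitesimal_rotation:
  fixes q :: "'a::euclidean_space \<Rightarrow> 'b::euclidean_space"
  assumes q: "hom_poly n q" and uw: "u \<in> Basis" "w \<in> Basis" "u \<noteq> w"
  shows "(\<integral>t. (t \<bullet> u) *\<^sub>R DD w q t - (t \<bullet> w) *\<^sub>R DD u q t \<partial>sphere_measure) = 0"
proof -
  have uw': "u \<bullet> u = 1" "w \<bullet> w = 1" "u \<bullet> w = 0" "w \<bullet> u = 0"
    using uw by (simp_all add: inner_Basis)
  define R :: "real \<Rightarrow> 'a \<Rightarrow> 'a" where "R = (\<lambda>\<theta> t. t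
    + ((cos \<theta> - 1) * (t \<bullet> u) - sin \<theta> * (t \<bullet> w)) *\<^sub>R u
    + (sin \<theta> * (t \<bullet> u) + (cos \<theta> - 1) * (t \<bullet> w)) *\<^sub>R w)"
  define R' :: "real \<Rightarrow> 'a \<Rightarrow> 'a" where "R' = (\<lambda>\<theta> t.
    (- sin \<theta> * (t \<bullet> u) - cos \<theta> * (t \<bullet> w)) *\<^sub>R u + (cos \<theta> * (t \<bullet> u) - sin \<theta> * (t \<bullet> w)) *\<^sub>R w)"
  have orth: "orthogonal_transformation (R \<theta>)" for \<theta>
    unfolding orthogonal_transformation
  proof (intro conjI allI)
    show "linear (R \<theta>)"
      by (rule linearI) (simp_all add: R_def algebra_simps inner_simps)
    fix t :: 'a
    \<comment> \<open>\<open>a\<close> and \<open>b\<close> are the coordinates of \<open>t\<close>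
      in the plane of rotation, \<open>A\<close> and \<open>B\<close> the changes that
      \<open>R \<theta>\<close> makes to them. The total change of the squared norm contains the
      factor \<open>sin \<theta> ^ 2 + cos \<theta> ^ 2 - 1\<close>.\<close>
    define a b A B where "a = t \<bullet> u" and "b = t \<bullet> w"
      and "A = (cos \<theta> - 1) * a - sin \<theta> * b" and "B = sin \<theta> * a + (cos \<theta> - 1) * b"
    have "R \<theta> t \<bullet> R \<theta> t = t \<bullet> t + 2 * A * a + 2 * B * b + A ^ 2 + B ^ 2"
      unfolding R_def a_def[symmetric] b_def[symmetric] A_def[symmetric] B_def[symmetric]
      by (simp add: inner_simps uw' inner_commute[of u t] inner_commute[of w t] power2_eq_square
          algebra_simps flip: a_def b_def)
    also have "2 * A * a + 2 * B * b + A ^ 2 + B ^ 2 = (a ^ 2 + b ^ 2) * (sin \<theta> ^ 2 + cos \<theta> ^ 2 - 1)"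
      unfolding A_def B_def by algebra
    then have "t \<bullet> t + 2 * A * a + 2 * B * b + A ^ 2 + B ^ 2 = t \<bullet> t"
      by simp
    finally show "norm (R \<theta> t) = norm t"
      by (simp add: norm_eq_sqrt_inner)
  qed
  have cont: "continuous_on S (\<lambda>z. f (R (fst z) (snd z)))" if "continuous_on UNIV f" for S and f :: "'a \<Rightarrow> 'b"
    unfolding R_def by (rule continuous_on_compose2 [OF that]) (auto intro!: continuous_intros)
  have "((\<lambda>\<theta>. \<integral>t. q (R \<theta> t) \<partial>sphere_measure) has_derivative
      (\<lambda>s. \<integral>t. s *\<^sub>R DD (R' 0 t) q (R 0 t) \<partial>sphere_measure)) (at 0)"
  proof (rule has_derivative_sphere_integral [where S = UNIV and f' = "\<lambda>\<theta> t s. s *\<^sub>R DD (R' \<theta> t) q (R \<theta> t)"])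
    fix \<theta> :: real and t :: 'a
    have R: "((\<lambda>\<theta>. R \<theta> t) has_derivative (\<lambda>s. s *\<^sub>R R' \<theta> t)) (at \<theta>)"
      unfolding R_def R'_def by (auto intro!: derivative_eq_intros simp: algebra_simps)
    have lin: "DD (s *\<^sub>R v) q x = s *\<^sub>R DD v q x" for s v x
      by (rule linear_cmul [OF hom_poly_DD_linear [OF q]])
    have "(q has_derivative (\<lambda>v. DD v q (R \<theta> t))) (at (R \<theta> t))"
      by (rule differentiable_has_derivative_DD [OF hom_poly_differentiable [OF q]])
    from has_derivative_compose [OF R this]
    show "((\<lambda>\<theta>. q (R \<theta> t)) has_derivative (\<lambda>s. s *\<^sub>R DD (R' \<theta> t) q (R \<theta> t))) (at \<theta>)"
      by (simp add: lin)
  next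
    show "continuous_on (sphere 0 1) (\<lambda>t. q (R \<theta> t))" for \<theta>
      unfolding R_def
      by (rule continuous_on_compose2 [OF hom_poly_continuous_on [OF q, of UNIV]])
        (auto intro!: continuous_intros)
  next
    fix s :: real
    \<comment> \<open>The moving direction is split into the fixed directions \<open>u\<close> and
      \<open>w\<close>, so that joint continuity reduces to that of two polynomial
      derivatives.\<close>
    have "DD (R' \<theta> t) q x = (- sin \<theta> * (t \<bullet> u) - cos \<theta> * (t \<bullet> w)) *\<^sub>R DD u q x +
        (cos \<theta> * (t \<bullet> u) - sin \<theta> * (t \<bullet> w)) *\<^sub>R DD w q x" for \<theta> t x
      unfolding R'_def
      by (simp only: linear_add [OF hom_poly_DD_linear [OF q]] linear_cmul [OF hom_poly_DD_linear [OF q]])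
    then show "continuous_on (UNIV \<times> sphere 0 1) (\<lambda>(\<theta>, t). s *\<^sub>R DD (R' \<theta> t) q (R \<theta> t))"
      unfolding case_prod_beta
      by (auto intro!: continuous_intros cont hom_poly_continuous_on [OF hom_poly_DD [OF q]])
  qed simp_all
  moreover have "(\<integral>t. q (R \<theta> t) \<partial>sphere_measure) = (\<integral>t. q t \<partial>sphere_measure)" for \<theta>
    by (intro integral_sphere_measure_orthogonal_transformation orth hom_poly_continuous_on [OF q])
  ultimately have "((\<lambda>_ :: real. \<integral>t. q t \<partial>sphere_measure) has_derivative
      (\<lambda>s. \<integral>t. s *\<^sub>R DD (R' 0 t) q (R 0 t) \<partial>sphere_measure)) (at 0)"
    by simp
  from fun_cong [OF has_derivative_unique [OF this has_derivative_const], of 1]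
  have "(\<integral>t. DD (R' 0 t) q (R 0 t) \<partial>sphere_measure) = 0"
    by simp
  moreover have "DD (R' 0 t) q (R 0 t) = (t \<bullet> u) *\<^sub>R DD w q t - (t \<bullet> w) *\<^sub>R DD u q t" for t
    by (simp add: R_def R'_def linear_diff [OF hom_poly_DD_linear [OF q]]
        linear_cmul [OF hom_poly_DD_linear [OF q]] flip: diff_conv_add_uminus)
  ultimately show ?thesis
    by simp
qed

text \<open>Summing the rotation identity for the polynomials \<open>(t \<bullet> c) q\<close> over the basis
  vectors \<open>c\<close> turns it into the divergence theorem on the sphere.\<close>

lemma sphere_integral_DD:
  fixes q :: "'a::euclidean_space \<Rightarrow> 'b::euclidean_space"
  assumes q: "hom_poly n q"
  shows "(\<integral>t. DD v q t \<partial>sphere_measure) =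
    (real n + real DIM('a) - 1) *\<^sub>R (\<integral>t. (t \<bullet> v) *\<^sub>R q t \<partial>sphere_measure)"
proof -
  have int: "integrable sphere_measure (\<lambda>t. (t \<bullet> v) *\<^sub>R q t)" "integrable sphere_measure (DD v q)" for v :: 'a
    by (intro integrable_sphere_measure continuous_intros hom_poly_continuous_on [OF q]
        hom_poly_continuous_on [OF hom_poly_DD [OF q]])+
  have basis: "(\<integral>t. DD b q t \<partial>sphere_measure) =
    (real n + real DIM('a) - 1) *\<^sub>R (\<integral>t. (t \<bullet> b) *\<^sub>R q t \<partial>sphere_measure)" if b: "b \<in> Basis" for b
  proof -
    let ?f = "\<lambda>c t. (t \<bullet> b) *\<^sub>R DD c (\<lambda>x. (x \<bullet> c) *\<^sub>R q x) t - (t \<bullet> c) *\<^sub>R DD b (\<lambda>x. (x \<bullet> c) *\<^sub>R q x) t"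
    \<comment> \<open>The rotation identity requires two distinct basis vectors; for
      \<open>c = b\<close> the integrand is identically zero.\<close>
    have f0: "(\<integral>t. ?f c t \<partial>sphere_measure) = 0" if "c \<in> Basis" for c
      using sphere_integral_infinitesimal_rotation [OF hom_poly.mult [OF q] b that] by (cases "c = b") auto
    have intf: "integrable sphere_measure (?f c)" for c
      by (intro integrable_sphere_measure continuous_intros hom_poly_continuous_on [OF hom_poly_DD [OF hom_poly.mult [OF q]]])
    \<comment> \<open>In the constant, \<open>DIM('a)\<close> counts the terms in which
      \<open>DD c\<close> hits the factor \<open>x \<bullet> c\<close>, \<open>n\<close> is Euler's
      identity, and \<open>- 1\<close> comes from \<open>DD b\<close> hitting
      \<open>x \<bullet> c\<close>. The restriction to \<open>norm t = 1\<close> reduces the last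
      term to \<open>DD b q t\<close>.\<close>
    have f: "(\<Sum>c\<in>Basis. ?f c t) = (real n + real DIM('a) - 1) *\<^sub>R ((t \<bullet> b) *\<^sub>R q t) - DD b q t"
      if "norm t = 1" for t
    proof -
      have "?f c t = (t \<bullet> b) *\<^sub>R q t + (t \<bullet> b) *\<^sub>R ((t \<bullet> c) *\<^sub>R DD c q t)
          - ((t \<bullet> c) * (b \<bullet> c)) *\<^sub>R q t - ((t \<bullet> c) * (t \<bullet> c)) *\<^sub>R DD b q t"
        if "c \<in> Basis" for c
        using that by (simp add: hom_poly_DD_inner_scaleR [OF q] algebra_simps)
      then have "(\<Sum>c\<in>Basis. ?f c t) = real DIM('a) *\<^sub>R (t \<bullet> b) *\<^sub>R q t
          + (t \<bullet> b) *\<^sub>R (\<Sum>c\<in>Basis. (t \<bullet> c) *\<^sub>R DD c q t)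
          - (\<Sum>c\<in>Basis. (t \<bullet> c) * (b \<bullet> c)) *\<^sub>R q t - (\<Sum>c\<in>Basis. (t \<bullet> c) * (t \<bullet> c)) *\<^sub>R DD b q t"
        by (simp add: sum.distrib sum_subtractf scaleR_sum_right scaleR_sum_left sum_constant_scaleR)
      also have "\<dots> = real DIM('a) *\<^sub>R (t \<bullet> b) *\<^sub>R q t + (t \<bullet> b) *\<^sub>R real n *\<^sub>R q t
          - (t \<bullet> b) *\<^sub>R q t - DD b q t"
        using that
        by (simp add: hom_poly_DD_expand [OF q, symmetric] hom_poly_euler [OF q] euclidean_inner [symmetric]
            dot_square_norm)
      finally show ?thesis by (simp add: algebra_simps)
    qed
    have "0 = (\<integral>t. (\<Sum>c\<in>Basis. ?f c t) \<partial>sphere_measure)"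
      by (simp only: Bochner_Integration.integral_sum [OF intf] f0 sum.neutral_const cong: sum.cong)
    also have "\<dots> = (\<integral>t. (real n + real DIM('a) - 1) *\<^sub>R ((t \<bullet> b) *\<^sub>R q t) - DD b q t \<partial>sphere_measure)"
      by (intro Bochner_Integration.integral_cong refl f) simp
    also have "\<dots> = (real n + real DIM('a) - 1) *\<^sub>R (\<integral>t. (t \<bullet> b) *\<^sub>R q t \<partial>sphere_measure) - (\<integral>t. DD b q t \<partial>sphere_measure)"
      by (simp add: int del: scaleR_scaleR)
    finally show ?thesis by simp
  qed
  have "(\<integral>t. DD v q t \<partial>sphere_measure) = (\<integral>t. (\<Sum>b\<in>Basis. (v \<bullet> b) *\<^sub>R DD b q t) \<partial>sphere_measure)"
    by (simp add: hom_poly_DD_expand [OF q, of v])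
  also have "\<dots> = (\<Sum>b\<in>Basis. (v \<bullet> b) *\<^sub>R (\<integral>t. DD b q t \<partial>sphere_measure))"
    using int by simp
  also have "\<dots> = (\<Sum>b\<in>Basis. (v \<bullet> b) *\<^sub>R
      ((real n + real DIM('a) - 1) *\<^sub>R (\<integral>t. (t \<bullet> b) *\<^sub>R q t \<partial>sphere_measure)))"
    by (simp add: basis cong: sum.cong)
  also have "\<dots> = (real n + real DIM('a) - 1) *\<^sub>R
      (\<integral>t. (\<Sum>b\<in>Basis. (v \<bullet> b) *\<^sub>R (t \<bullet> b) *\<^sub>R q t) \<partial>sphere_measure)"
    by (subst Bochner_Integration.integral_sum)
      (simp_all add: int scaleR_sum_right scaleR_left_commute [of _ "v \<bullet> _"] del: scaleR_scaleR)
  also have "(\<lambda>t. \<Sum>b\<in>Basis. (v \<bullet> b) *\<^sub>R (t \<bullet> b) *\<^sub>R q t) = (\<lambda>t. (t \<bullet> v) *\<^sub>R q t)"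
    by (simp add: euclidean_inner [of _ v] scaleR_sum_left mult.commute)
  finally show ?thesis .
qed

text \<open>The divergence theorem for each \<open>DD b q\<close>, followed by Euler's identity,
  turns the integral of the Laplacian into a multiple of the integral of \<open>q\<close>. The
  factor is positive; for \<open>n = 1\<close> this relies on the dimension being at least
  2.\<close>

lemma sphere_integral_harmonic:
  fixes q :: "'a::euclidean_space \<Rightarrow> 'b::euclidean_space"
  assumes q: "hom_poly n q" and "n > 0" and dim: "2 \<le> DIM('a)" and harm: "\<And>x. laplacian q x = 0"
  shows "(\<integral>t. q t \<partial>sphere_measure) = 0"
proof -
  have int: "integrable sphere_measure (\<lambda>t. (t \<bullet> b) *\<^sub>R DD b q t)"
      "integrable sphere_measure (DD b (DD b q))" for b
    by (intro integrable_sphere_measure continuous_intros hom_poly_continuous_on [OF hom_poly_DD [OF q]]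
        hom_poly_continuous_on [OF hom_poly_DD [OF hom_poly_DD [OF q]]])+
  have "0 = (\<integral>t. laplacian q t \<partial>sphere_measure)"
    by (simp add: harm)
  also have "\<dots> = (\<Sum>b\<in>Basis. \<integral>t. DD b (DD b q) t \<partial>sphere_measure)"
    unfolding laplacian_def using int by simp
  also have "\<dots> = (real (n - 1) + real DIM('a) - 1) *\<^sub>R
      (\<integral>t. (\<Sum>b\<in>Basis. (t \<bullet> b) *\<^sub>R DD b q t) \<partial>sphere_measure)"
    using int by (simp add: sphere_integral_DD [OF hom_poly_DD [OF q]] scaleR_sum_right)
  also have "(\<lambda>t. \<Sum>b\<in>Basis. (t \<bullet> b) *\<^sub>R DD b q t) = (\<lambda>t. real n *\<^sub>R q t)"
    by (simp add: hom_poly_DD_expand [OF q, symmetric] hom_poly_euler [OF q])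
  finally have "((real (n - 1) + real DIM('a) - 1) * real n) *\<^sub>R (\<integral>t. q t \<partial>sphere_measure) = 0"
    by simp
  moreover have "(real (n - 1) + real DIM('a) - 1) * real n > 0"
    using \<open>n > 0\<close> dim by simp
  ultimately show ?thesis
    by (metis less_irrefl scaleR_eq_0_iff)
qed

section \<open>Gegenbauer polynomials\<close>

text \<open>The coefficient of \<open>(2 t)\<^bsup>n - 2j\<^esup>\<close>, extended by zero so that sums over \<open>j\<close> can be shifted freely.\<close>

definition gegenbauer_coeff :: "real \<Rightarrow> nat \<Rightarrow> nat \<Rightarrow> real"
  where "gegenbauer_coeff \<nu> n j =
    (if 2 * j \<le> n then (- 1) ^ j * pochhammer \<nu> (n - j) / (fact j * fact (n - 2 * j)) else 0)"

lemma gegenbauer_eq_sum: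
  assumes "n div 2 \<le> N"
  shows "gegenbauer \<nu> n t = (\<Sum>j\<le>N. gegenbauer_coeff \<nu> n j * (2 * t) ^ (n - 2 * j))"
  unfolding gegenbauer_def
  by (rule sum.mono_neutral_cong_left) (use assms in \<open>auto simp: gegenbauer_coeff_def\<close>)

text \<open>The sum may run to \<open>n\<close> because \<open>gegenbauer_coeff\<close> vanishes
  beyond \<open>n div 2\<close>, and the factor \<open>n - 2 * j\<close> removes the term whose
  exponent \<open>n - 2 * j - 1\<close> is truncated.\<close>

definition gegenbauer_deriv :: "real \<Rightarrow> nat \<Rightarrow> real \<Rightarrow> real"
  where "gegenbauer_deriv \<nu> n t =
    (\<Sum>j\<le>n. 2 * real (n - 2 * j) * gegenbauer_coeff \<nu> n j * (2 * t) ^ (n - 2 * j - 1))"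

lemma gegenbauer_has_derivative:
  "((gegenbauer \<nu> n) has_real_derivative gegenbauer_deriv \<nu> n t) (at t)"
proof -
  have "gegenbauer \<nu> n = (\<lambda>t. \<Sum>j\<le>n. gegenbauer_coeff \<nu> n j * (2 * t) ^ (n - 2 * j))"
    by (rule ext, rule gegenbauer_eq_sum) simp
  moreover have "((\<lambda>t. c * (2 * t) ^ k) has_real_derivative 2 * real k * c * (2 * t) ^ (k - 1)) (at t)"
    for c k
    by (rule derivative_eq_intros refl)+ simp
  ultimately show ?thesis
    unfolding gegenbauer_deriv_def by (simp only: DERIV_sum)
qed

lemma continuous_on_gegenbauer [continuous_intros]:
  "continuous_on S f \<Longrightarrow> continuous_on S (\<lambda>x. gegenbauer \<nu> n (f x))"
  unfolding gegenbauer_def by (auto intro!: continuous_intros)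

lemma continuous_on_gegenbauer_deriv [continuous_intros]:
  "continuous_on S f \<Longrightarrow> continuous_on S (\<lambda>x. gegenbauer_deriv \<nu> n (f x))"
  unfolding gegenbauer_deriv_def by (auto intro!: continuous_intros)

text \<open>Comparison of the coefficients of \<open>(2 * t) ^ (N - 2 * j)\<close> in
  \<open>gegenbauer_lower\<close>.\<close>

lemma gegenbauer_coeff_lower:
  "2 * real (Suc N - 2 * j) * gegenbauer_coeff \<nu> (Suc N) j + real (Suc j) * gegenbauer_coeff \<nu> (Suc N) (Suc j)
    = (real N + 2 * \<nu>) * gegenbauer_coeff \<nu> N j"
proof (cases "2 * j \<le> N")
  case True
  then obtain d where d: "N = 2 * j + d" using le_Suc_ex by blast
  show ?thesis
  proof (cases d)
    \<comment> \<open>Here \<open>N = 2 * j\<close>, and the coefficient with index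
      \<open>Suc j\<close> is already out of range, hence zero.\<close>
    case 0
    then show ?thesis
      by (simp add: d gegenbauer_coeff_def pochhammer_Suc field_simps)
  next
    case (Suc e)
    have eqs: "Suc N - 2 * j = Suc (Suc e)" "Suc N - j = Suc (j + Suc e)" "Suc N - Suc j = j + Suc e"
        "Suc N - 2 * Suc j = e" "N - 2 * j = Suc e" "N - j = j + Suc e"
        "2 * j \<le> Suc N" "2 * Suc j \<le> Suc N" "real N = 2 * j + e + 1"
      using d Suc by auto
    show ?thesis
      unfolding gegenbauer_coeff_def if_P[OF True] if_P[OF eqs(7)] if_P[OF eqs(8)] eqs(1-6,9)
        pochhammer_Suc [of \<nu> "j + Suc e"]
      by (simp add: divide_simps del: of_nat_Suc) (simp add: algebra_simps)
  qed
next
  case False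
  then show ?thesis by (auto simp: gegenbauer_coeff_def)
qed

text \<open>Comparison of coefficients in \<open>gegenbauer_raise\<close>, for all powers of
  \<open>2 * t\<close> except the leading one, which has no partner with a lower index and is
  treated there.\<close>

lemma gegenbauer_coeff_raise:
  "2 * real (N - 2 * j) * gegenbauer_coeff \<nu> N j - (real (N - Suc j) + \<nu>) * gegenbauer_coeff \<nu> N (Suc j)
    = - real (Suc N) * gegenbauer_coeff \<nu> (Suc N) (Suc j)"
proof (cases "2 * Suc j \<le> Suc N")
  case True
  then obtain d where d: "N = 2 * j + Suc d" using le_Suc_ex[OF True] by auto
  show ?thesis
  proof (cases d)
    case 0
    then show ?thesis
      by (simp add: d gegenbauer_coeff_def pochhammer_Suc divide_simps) (simp add: algebra_simps)
  next
    case (Suc e)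
    have eqs: "N - 2 * j = Suc (Suc e)" "N - j = Suc (j + Suc e)" "N - Suc j = j + Suc e"
        "N - 2 * Suc j = e" "Suc N - 2 * Suc j = Suc e" "Suc N - Suc j = Suc (j + Suc e)"
        "2 * j \<le> N" "2 * Suc j \<le> N" "real N = 2 * j + e + 2"
      using d Suc by auto
    show ?thesis
      unfolding gegenbauer_coeff_def if_P[OF True] if_P[OF eqs(7)] if_P[OF eqs(8)] eqs(1-6)
        pochhammer_Suc [of \<nu> "j + Suc e"]
      by (simp add: divide_simps del: of_nat_Suc) (simp add: eqs(9) algebra_simps)
  qed
next
  case False
  then show ?thesis by (auto simp: gegenbauer_coeff_def)
qed

text \<open>The counterpart on the interval of differentiating \<open>H\<close> along \<xi>: inside
  an integration by parts it lowers the index by one.\<close>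

lemma gegenbauer_lower:
  "(1 - t\<^sup>2) * gegenbauer_deriv \<nu> (Suc N) t =
    (real N + 2 * \<nu>) * gegenbauer \<nu> N t - real (Suc N) * t * gegenbauer \<nu> (Suc N) t"
proof -
  let ?c = "gegenbauer_coeff \<nu> (Suc N)" and ?e = "\<lambda>j. Suc N - 2 * j"
  have 1: "t\<^sup>2 * (2 * real (?e j) * ?c j * (2 * t) ^ (?e j - 1)) = t * real (?e j) * ?c j * (2 * t) ^ ?e j" for j
    by (cases "?e j") (simp_all add: power2_eq_square)
  have 2: "real (Suc N) * t * (?c j * (2 * t) ^ ?e j) - t * real (?e j) * ?c j * (2 * t) ^ ?e j =
      2 * t * real j * ?c j * (2 * t) ^ ?e j" for j
  proof (cases "2 * j \<le> Suc N")
    case True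
    then have e: "real (?e j) = real (Suc N) - 2 * real j" by (simp add: of_nat_diff)
    show ?thesis unfolding e by (simp add: left_diff_distrib right_diff_distrib del: of_nat_Suc)
  qed (simp add: gegenbauer_coeff_def)
  \<comment> \<open>The extra factor \<open>2 * t\<close> raises the exponent by one, so after the
    shift of \<open>j\<close> both sums run over the same powers. Where the exponents are truncated
    the coefficient is zero.\<close>
  have 3: "2 * t * real (Suc j) * ?c (Suc j) * (2 * t) ^ ?e (Suc j) =
      real (Suc j) * ?c (Suc j) * (2 * t) ^ (N - 2 * j)" for j
  proof (cases "2 * Suc j \<le> Suc N")
    case True
    then have "N - 2 * j = Suc (?e (Suc j))" by simp
    then show ?thesis by simp
  qed (simp add: gegenbauer_coeff_def)
  have "(1 - t\<^sup>2) * gegenbauer_deriv \<nu> (Suc N) t + real (Suc N) * t * gegenbauer \<nu> (Suc N) t =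
      (\<Sum>j\<le>Suc N. 2 * real (?e j) * ?c j * (2 * t) ^ (?e j - 1)) +
      (\<Sum>j\<le>Suc N. real (Suc N) * t * (?c j * (2 * t) ^ ?e j) - t * real (?e j) * ?c j * (2 * t) ^ ?e j)"
    unfolding gegenbauer_deriv_def 1 [symmetric]
    by (subst gegenbauer_eq_sum [of "Suc N" "Suc N"])
      (simp_all add: left_diff_distrib sum_distrib_left sum_subtractf del: sum.atMost_Suc of_nat_Suc)
  also have "(\<Sum>j\<le>Suc N. real (Suc N) * t * (?c j * (2 * t) ^ ?e j) - t * real (?e j) * ?c j * (2 * t) ^ ?e j) =
      (\<Sum>j\<le>Suc N. 2 * t * real j * ?c j * (2 * t) ^ ?e j)"
    unfolding 2 ..
  also have "\<dots> = (\<Sum>j\<le>N. real (Suc j) * ?c (Suc j) * (2 * t) ^ (N - 2 * j))"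
    unfolding sum.atMost_Suc_shift 3 by simp
  also have "(\<Sum>j\<le>Suc N. 2 * real (?e j) * ?c j * (2 * t) ^ (?e j - 1)) =
      (\<Sum>j\<le>N. 2 * real (?e j) * ?c j * (2 * t) ^ (N - 2 * j))"
    by (simp add: gegenbauer_coeff_def diff_right_commute del: of_nat_Suc)
  also have "(\<Sum>j\<le>N. 2 * real (?e j) * ?c j * (2 * t) ^ (N - 2 * j)) +
      (\<Sum>j\<le>N. real (Suc j) * ?c (Suc j) * (2 * t) ^ (N - 2 * j)) =
      (\<Sum>j\<le>N. (2 * real (?e j) * ?c j + real (Suc j) * ?c (Suc j)) * (2 * t) ^ (N - 2 * j))"
    by (simp only: sum.distrib distrib_right)
  also have "\<dots> = (real N + 2 * \<nu>) * gegenbauer \<nu> N t"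
    unfolding gegenbauer_coeff_lower
    by (subst gegenbauer_eq_sum [of N N]) (simp_all add: sum_distrib_left mult.assoc)
  finally show ?thesis by simp
qed

text \<open>It has two uses: at \<open>t = 1\<close> the left side vanishes and the ratio of
  consecutive values \<open>C_n(1)\<close> remains, and under the integral it yields the
  orthogonality to constants.\<close>

lemma gegenbauer_raise:
  "(1 - t\<^sup>2) * gegenbauer_deriv \<nu> N t =
    (real N + 2 * \<nu>) * t * gegenbauer \<nu> N t - real (Suc N) * gegenbauer \<nu> (Suc N) t"
proof -
  let ?c = "gegenbauer_coeff \<nu> N" and ?e = "\<lambda>j. N - 2 * j"
  have 1: "t\<^sup>2 * (2 * real (?e j) * ?c j * (2 * t) ^ (?e j - 1)) = t * real (?e j) * ?c j * (2 * t) ^ ?e j" for j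
    by (cases "?e j") (simp_all add: power2_eq_square)
  have 2: "(real N + 2 * \<nu>) * t * (?c j * (2 * t) ^ ?e j) + t * real (?e j) * ?c j * (2 * t) ^ ?e j =
      (real (N - j) + \<nu>) * ?c j * (2 * t) ^ (Suc N - 2 * j)" for j
  proof (cases "2 * j \<le> N")
    case True
    then have "Suc N - 2 * j = Suc (?e j)" "real (N - j) = real N - real j" "real (?e j) = real N - 2 * real j"
      by (auto simp: of_nat_diff)
    then show ?thesis by (simp add: algebra_simps)
  qed (simp add: gegenbauer_coeff_def)
  have "(real N + 2 * \<nu>) * t * gegenbauer \<nu> N t - (1 - t\<^sup>2) * gegenbauer_deriv \<nu> N t =
      (\<Sum>j\<le>N. (real N + 2 * \<nu>) * t * (?c j * (2 * t) ^ ?e j) + t * real (?e j) * ?c j * (2 * t) ^ ?e j)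
      - (\<Sum>j\<le>N. 2 * real (?e j) * ?c j * (2 * t) ^ (?e j - 1))"
    unfolding gegenbauer_deriv_def 1 [symmetric]
    by (subst gegenbauer_eq_sum [of N N])
      (simp_all add: left_diff_distrib sum_distrib_left sum.distrib sum_subtractf)
  also have "(\<Sum>j\<le>N. (real N + 2 * \<nu>) * t * (?c j * (2 * t) ^ ?e j) + t * real (?e j) * ?c j * (2 * t) ^ ?e j) =
      (\<Sum>j\<le>Suc N. (real (N - j) + \<nu>) * ?c j * (2 * t) ^ (Suc N - 2 * j))"
    unfolding 2 by (simp add: gegenbauer_coeff_def)
  also have "\<dots> = (real N + \<nu>) * ?c 0 * (2 * t) ^ Suc N +
      (\<Sum>j\<le>N. (real (N - Suc j) + \<nu>) * ?c (Suc j) * (2 * t) ^ (Suc N - 2 * Suc j))"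
    unfolding sum.atMost_Suc_shift by simp
  also have "(real N + \<nu>) * ?c 0 * (2 * t) ^ Suc N = real (Suc N) * gegenbauer_coeff \<nu> (Suc N) 0 * (2 * t) ^ Suc N"
    by (simp add: gegenbauer_coeff_def pochhammer_Suc divide_simps)
  also have "(\<Sum>j\<le>N. 2 * real (?e j) * ?c j * (2 * t) ^ (?e j - 1)) =
      (\<Sum>j\<le>N. 2 * real (?e j) * ?c j * (2 * t) ^ (Suc N - 2 * Suc j))"
    by simp
  also have "real (Suc N) * gegenbauer_coeff \<nu> (Suc N) 0 * (2 * t) ^ Suc N +
      (\<Sum>j\<le>N. (real (N - Suc j) + \<nu>) * ?c (Suc j) * (2 * t) ^ (Suc N - 2 * Suc j)) -
      (\<Sum>j\<le>N. 2 * real (?e j) * ?c j * (2 * t) ^ (Suc N - 2 * Suc j)) =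
      real (Suc N) * gegenbauer_coeff \<nu> (Suc N) 0 * (2 * t) ^ Suc N -
      (\<Sum>j\<le>N. (2 * real (?e j) * ?c j - (real (N - Suc j) + \<nu>) * ?c (Suc j)) * (2 * t) ^ (Suc N - 2 * Suc j))"
    by (simp only: sum_subtractf left_diff_distrib)
  also have "\<dots> = real (Suc N) * (\<Sum>j\<le>Suc N. gegenbauer_coeff \<nu> (Suc N) j * (2 * t) ^ (Suc N - 2 * j))"
    unfolding gegenbauer_coeff_raise sum.atMost_Suc_shift
    by (simp add: sum_negf sum_distrib_left distrib_left mult.assoc del: of_nat_Suc mult_Suc_right power_Suc)
  also have "\<dots> = real (Suc N) * gegenbauer \<nu> (Suc N) t"
    by (subst gegenbauer_eq_sum [of "Suc N" "Suc N"]) simp_all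
  finally show ?thesis by simp
qed

lemma gegenbauer_0 [simp]: "gegenbauer \<nu> 0 t = 1"
  by (simp add: gegenbauer_def)

lemma gegenbauer_Suc_1:
  "real (Suc n) * gegenbauer \<nu> (Suc n) 1 = (real n + 2 * \<nu>) * gegenbauer \<nu> n 1"
  using gegenbauer_raise [of 1 \<nu> n] by simp

lemma gegenbauer_1_pos: "0 < \<nu> \<Longrightarrow> 0 < gegenbauer \<nu> n 1"
proof (induction n)
  case (Suc n)
  then have "0 < real (Suc n) * gegenbauer \<nu> (Suc n) 1"
    unfolding gegenbauer_Suc_1 by (simp add: add_nonneg_pos)
  then show ?case by (simp add: zero_less_mult_iff)
qed simp

section \<open>The weight function and its total mass\<close>

definition jacobi_weight :: "nat \<Rightarrow> real \<Rightarrow> real"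
  where "jacobi_weight m t = (1 - t\<^sup>2) powr ((real m - 3) / 2)"

lemma jacobi_weight_nonneg: "0 \<le> jacobi_weight m t"
  by (simp add: jacobi_weight_def)

text \<open>At \<open>t = 1\<close> and \<open>t = -1\<close> the two sides differ for \<open>m = 3\<close>, since \<open>0 powr 0 = 0\<close>.\<close>

lemma jacobi_weight_eq_sqrt:
  assumes "3 \<le> m" and "t \<in> {- 1..1} - {- 1, 1}"
  shows "jacobi_weight m t = sqrt (1 - t\<^sup>2) ^ (m - 3)"
proof -
  have "0 < 1 - t\<^sup>2"
    using assms(2) by (auto simp: abs_square_less_1)
  then have "sqrt (1 - t\<^sup>2) ^ (m - 3) = ((1 - t\<^sup>2) powr (1 / 2)) powr real (m - 3)"
    by (simp add: powr_half_sqrt powr_realpow)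
  then show ?thesis
    using assms(1) by (simp add: jacobi_weight_def powr_powr of_nat_diff)
qed

lemma jacobi_weight_integrable:
  fixes f :: "real \<Rightarrow> 'b::banach"
  assumes "3 \<le> m" and "continuous_on {- 1..1} f"
  shows "(\<lambda>t. jacobi_weight m t *\<^sub>R f t) integrable_on {- 1..1}"
proof (rule integrable_spike)
  show "(\<lambda>t. sqrt (1 - t\<^sup>2) ^ (m - 3) *\<^sub>R f t) integrable_on {- 1..1}"
    by (intro integrable_continuous_real continuous_intros assms)
  show "negligible {- 1, 1 :: real}" by simp
qed (use assms in \<open>simp add: jacobi_weight_eq_sqrt\<close>)

lemma jacobi_weight_integrable_real:
  fixes f :: "real \<Rightarrow> real"
  shows "3 \<le> m \<Longrightarrow> continuous_on {- 1..1} f \<Longrightarrow> (\<lambda>t. f t * jacobi_weight m t) integrable_on {- 1..1}"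
  using jacobi_weight_integrable [of m f] by (simp add: mult.commute)

text \<open>This is the Beta integral behind the volume of balls,
  \<open>emeasure_cball_aux_integral\<close>. It concerns the nonnegative integral of natural powers
  of \<open>sqrt (1 - t\<^sup>2)\<close>, so the work lies in passing between the two integrals and
  the two forms of the weight.\<close>

lemma integral_jacobi_weight:
  assumes "3 \<le> m"
  shows "integral {- 1..1} (jacobi_weight m) = Beta (1 / 2) ((real m - 1) / 2)"
proof -
  let ?f = "\<lambda>t. sqrt (1 - t\<^sup>2) ^ (m - 3)"
  have f: "0 \<le> ?f t" if "t \<in> {- 1..1}" for t
    using that by (auto simp: abs_square_le_1 abs_le_iff)
  have "?f integrable_on {- 1..1}"
    by (intro integrable_continuous_real continuous_intros)
  then have "(?f has_integral integral {- 1..1} ?f) {- 1..1}"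
    by (rule integrable_integral)
  from nn_integral_has_integral_lebesgue [OF f this]
  have "ennreal (integral {- 1..1} ?f) = ennreal (Beta (1 / 2) (real (m - 3) / 2 + 1))"
    by (simp add: emeasure_cball_aux_integral)
  moreover have "0 \<le> integral {- 1..1} ?f"
    by (rule integral_nonneg) (use \<open>?f integrable_on _\<close> f in auto)
  moreover have "0 \<le> Beta (1 / 2) (real (m - 3) / 2 + 1)"
    unfolding Beta_def by (intro divide_nonneg_pos mult_nonneg_nonneg Gamma_real_nonneg Gamma_real_pos) auto
  ultimately have "integral {- 1..1} ?f = Beta (1 / 2) (real (m - 3) / 2 + 1)"
    by simp
  moreover have "real (m - 3) / 2 + 1 = (real m - 1) / 2"
    using assms by (simp add: of_nat_diff field_simps)
  moreover have "integral {- 1..1} (jacobi_weight m) = integral {- 1..1} ?f"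
    by (rule integral_spike [where S = "{- 1, 1}"]) (use assms in \<open>auto simp: jacobi_weight_eq_sqrt\<close>)
  ultimately show ?thesis by simp
qed

lemma sphere_area_eq_Gamma:
  assumes "0 < n"
  shows "sphere_area n = 2 * pi powr (real n / 2) / Gamma (real n / 2)"
proof -
  have G: "Gamma (real n / 2 + 1) = real n / 2 * Gamma (real n / 2)"
    using assms by (intro Gamma_plus1) (auto elim!: nonpos_Ints_cases)
  show ?thesis
    unfolding sphere_area_def unit_ball_vol_def G using assms by simp
qed

text \<open>Geometrically, the unit sphere is sliced orthogonally to an axis; here the identity is
  read off from the Gamma values. It supplies the start of the moment recursion.\<close>

lemma sphere_area_slice:
  assumes "3 \<le> m"
  shows "sphere_area (m - 1) * integral {- 1..1} (jacobi_weight m) = sphere_area m"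
proof -
  have r: "real (m - 1) = real m - 1" using assms by simp
  have "0 < Gamma ((real m - 1) / 2)"
    using assms by (intro Gamma_real_pos) simp
  then have "Gamma ((real m - 1) / 2) \<noteq> 0"
    by (metis less_irrefl)
  moreover have "pi powr (real m / 2) = pi powr ((real m - 1) / 2) * sqrt pi"
    by (simp add: diff_divide_distrib powr_diff powr_half_sqrt)
  moreover have "Beta (1 / 2) ((real m - 1) / 2) = sqrt pi * Gamma ((real m - 1) / 2) / Gamma (real m / 2)"
    unfolding Beta_def Gamma_one_half_real by (simp flip: add_divide_distrib)
  ultimately show ?thesis
    using assms by (simp add: integral_jacobi_weight sphere_area_eq_Gamma r)
qed

text \<open>The integrand is the derivative of
  \<open>g t * (1 - t\<^sup>2) powr ((m - 1) / 2)\<close> on the open interval, and this function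
  vanishes at both endpoints because the exponent is positive.\<close>

lemma jacobi_weight_by_parts:
  assumes m: "3 \<le> m" and g: "\<And>t. (g has_real_derivative g' t) (at t)"
    and g': "continuous_on {- 1..1} g'"
  shows "integral {- 1..1} (\<lambda>t. ((1 - t\<^sup>2) * g' t - (real m - 1) * t * g t) * jacobi_weight m t) = 0"
proof -
  let ?p = "(real m - 1) / 2"
  have "continuous_on {- 1..1} g"
    using g by (meson DERIV_continuous_on has_field_derivative_at_within)
  have "((\<lambda>t. ((1 - t\<^sup>2) * g' t - (real m - 1) * t * g t) * jacobi_weight m t) has_integral
      (g 1 * (1 - 1\<^sup>2) powr ?p - g (- 1) * (1 - (- 1)\<^sup>2) powr ?p)) {- 1..1}"
  proof (rule fundamental_theorem_of_calculus_interior)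
    show "continuous_on {- 1..1} (\<lambda>t. g t * (1 - t\<^sup>2) powr ?p)"
      using m by (intro continuous_intros continuous_on_powr' \<open>continuous_on _ g\<close>)
        (auto simp: abs_square_le_1 abs_le_iff)
    fix t :: real assume "t \<in> {- 1<..<1}"
    then have pos: "0 < 1 - t\<^sup>2"
      by (auto simp: abs_square_less_1)
    have "((\<lambda>t. g t * (1 - t\<^sup>2) powr ?p) has_real_derivative
        g' t * (1 - t\<^sup>2) powr ?p + (?p * (1 - t\<^sup>2) powr (?p - 1) * (- 2 * t)) * g t) (at t)"
      using pos by (auto intro!: derivative_eq_intros g simp: powr_diff field_simps)
    moreover have "g' t * (1 - t\<^sup>2) powr ?p + (?p * (1 - t\<^sup>2) powr (?p - 1) * (- 2 * t)) * g t =
        ((1 - t\<^sup>2) * g' t - (real m - 1) * t * g t) * jacobi_weight m t"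
    proof -
      have p: "?p - 1 = (real m - 3) / 2" "?p = 1 + (real m - 3) / 2" "?p * (c * (- 2 * t)) = - (real m - 1) * t * c"
        for c by (simp_all add: field_simps)
      have "(1 - t\<^sup>2) powr ?p = (1 - t\<^sup>2) * jacobi_weight m t"
        unfolding p(2) powr_add jacobi_weight_def using pos by simp
      then show ?thesis
        by (simp only: p(1,3) mult.assoc [of ?p] flip: jacobi_weight_def) (simp add: algebra_simps)
    qed
    ultimately show "((\<lambda>t. g t * (1 - t\<^sup>2) powr ?p) has_vector_derivative
        ((1 - t\<^sup>2) * g' t - (real m - 1) * t * g t) * jacobi_weight m t) (at t)"
      by (simp only: has_real_derivative_iff_has_vector_derivative)
  qed simp
  then show ?thesis by (simp add: has_integral_iff)
qed

section \<open>Moments of the normalised Gegenbauer polynomials\<close>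

definition gegenbauer_moment :: "nat \<Rightarrow> nat \<Rightarrow> nat \<Rightarrow> real"
  where "gegenbauer_moment m p n =
    integral {- 1..1} (\<lambda>t. t ^ p * (gegenbauer ((real m - 2) / 2) n t /
      gegenbauer ((real m - 2) / 2) n 1) * jacobi_weight m t)"

context
  fixes m :: nat and \<nu> :: real and K :: "nat \<Rightarrow> nat \<Rightarrow> real"
  defines "\<nu> \<equiv> (real m - 2) / 2"
    and "K p n \<equiv> integral {- 1..1} (\<lambda>t. t ^ p * gegenbauer \<nu> n t * jacobi_weight m t)"
  assumes m: "3 \<le> m"
begin

lemma gegenbauer_moment_eq: "gegenbauer_moment m p n = K p n / gegenbauer \<nu> n 1"
  by (simp add: gegenbauer_moment_def K_def flip: \<nu>_def integral_divide)

lemma unnormalised_moment_integrable: "(\<lambda>t. t ^ p * gegenbauer \<nu> n t * jacobi_weight m t) integrable_on {- 1..1}"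
  using m by (intro jacobi_weight_integrable_real continuous_intros)

lemma gegenbauer_pos: "0 < gegenbauer \<nu> n 1"
  using m by (intro gegenbauer_1_pos) (simp add: \<nu>_def)

text \<open>Integration by parts for \<open>t ^ p * C_n(t)\<close>. The assumption abstracts
  \<open>gegenbauer_lower\<close>, so that \<open>n = 0\<close>, where the derivative vanishes and
  \<open>a = 0\<close>, is an instance as well.\<close>

lemma unnormalised_moment_rec:
  assumes "\<And>t. (1 - t\<^sup>2) * gegenbauer_deriv \<nu> n t = a * gegenbauer \<nu> i t - real n * t * gegenbauer \<nu> n t"
  shows "(real p + real n + real m - 1) * K (Suc p) n = real p * K (p - 1) n + a * K p i"
proof -
  let ?g = "\<lambda>t. t ^ p * gegenbauer \<nu> n t"
  let ?g' = "\<lambda>t. real p * t ^ (p - 1) * gegenbauer \<nu> n t + t ^ p * gegenbauer_deriv \<nu> n t"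
  have "(?g has_real_derivative ?g' t) (at t)" for t
    by (rule derivative_eq_intros gegenbauer_has_derivative refl)+ (simp add: algebra_simps)
  then have "0 = integral {- 1..1} (\<lambda>t. ((1 - t\<^sup>2) * ?g' t - (real m - 1) * t * ?g t) * jacobi_weight m t)"
    by (intro jacobi_weight_by_parts [symmetric] m continuous_intros)
  also have "\<dots> = integral {- 1..1} (\<lambda>t.
      (real p * (t ^ (p - 1) * gegenbauer \<nu> n t * jacobi_weight m t)
      + a * (t ^ p * gegenbauer \<nu> i t * jacobi_weight m t))
      - (real p + real n + real m - 1) * (t ^ Suc p * gegenbauer \<nu> n t * jacobi_weight m t))"
  proof (rule integral_cong)
    fix t
    have "t\<^sup>2 * (real p * t ^ (p - 1)) = real p * t ^ Suc p"
      by (cases p) (simp_all add: power2_eq_square)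
    moreover have "(1 - t\<^sup>2) * ?g' t = real p * t ^ (p - 1) * gegenbauer \<nu> n t
        - t\<^sup>2 * (real p * t ^ (p - 1)) * gegenbauer \<nu> n t + t ^ p * ((1 - t\<^sup>2) * gegenbauer_deriv \<nu> n t)"
      by (simp only: ring_distribs mult_1_left mult_ac)
    ultimately have e: "(1 - t\<^sup>2) * ?g' t = real p * t ^ (p - 1) * gegenbauer \<nu> n t - real p * t ^ Suc p * gegenbauer \<nu> n t
        + t ^ p * (a * gegenbauer \<nu> i t - real n * t * gegenbauer \<nu> n t)"
      unfolding assms by simp
    show "((1 - t\<^sup>2) * ?g' t - (real m - 1) * t * ?g t) * jacobi_weight m t =
        (real p * (t ^ (p - 1) * gegenbauer \<nu> n t * jacobi_weight m t)
        + a * (t ^ p * gegenbauer \<nu> i t * jacobi_weight m t))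
        - (real p + real n + real m - 1) * (t ^ Suc p * gegenbauer \<nu> n t * jacobi_weight m t)"
      unfolding e by (simp add: algebra_simps)
  qed
  also have "\<dots> = real p * K (p - 1) n + a * K p i - (real p + real n + real m - 1) * K (Suc p) n"
    unfolding K_def
    by (simp only: integral_diff integral_add integral_mult_right integrable_add integrable_on_mult_right unnormalised_moment_integrable)
  finally show ?thesis by simp
qed

text \<open>Since \<open>n C_n(1) = (n - 1 + 2 \<nu>) C_{n-1}(1)\<close>, the normalisation replaces
  the factor \<open>n - 1 + 2 \<nu>\<close> by \<open>n\<close>. In this form the recursion
  coincides with that of the moments on the sphere. For \<open>p = 0\<close> the truncated index
  \<open>p - 1\<close> carries the factor 0.\<close>

lemma gegenbauer_moment_rec:
  "(real p + real n + real m - 1) * gegenbauer_moment m (Suc p) n =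
    real p * gegenbauer_moment m (p - 1) n + real n * gegenbauer_moment m p (n - 1)"
proof (cases n)
  case 0
  have "gegenbauer_deriv \<nu> 0 t = 0" for t by (simp add: gegenbauer_deriv_def)
  then show ?thesis
    using unnormalised_moment_rec [of 0 0 0 p] by (simp add: 0 gegenbauer_moment_eq)
next
  case (Suc N)
  let ?c = "gegenbauer \<nu> n 1"
  have c: "real n * ?c = (real N + 2 * \<nu>) * gegenbauer \<nu> N 1"
    unfolding Suc by (rule gegenbauer_Suc_1)
  have "(real p + real n + real m - 1) * K (Suc p) n = real p * K (p - 1) n + (real N + 2 * \<nu>) * K p N"
    unfolding Suc by (rule unnormalised_moment_rec) (rule gegenbauer_lower)
  then have "(real p + real n + real m - 1) * gegenbauer_moment m (Suc p) n =
      real p * gegenbauer_moment m (p - 1) n + (real N + 2 * \<nu>) * K p N / ?c"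
    by (simp add: gegenbauer_moment_eq flip: add_divide_distrib)
  also have "real N + 2 * \<nu> = real n * ?c / gegenbauer \<nu> N 1"
    unfolding c using gegenbauer_pos [of N] by simp
  also have "real n * ?c / gegenbauer \<nu> N 1 * K p N / ?c = real n * gegenbauer_moment m p N"
    using gegenbauer_pos [of n] by (simp add: gegenbauer_moment_eq)
  finally show ?thesis by (simp add: Suc)
qed

text \<open>Integration by parts for \<open>C_n\<close> with \<open>gegenbauer_raise\<close> gives
  \<open>(n + 1) K 0 (n + 1) = (n - 1) K 1 n\<close>. For \<open>n \<ge> 2\<close> the moment on the
  right is a multiple of that of \<open>C_{n-1}\<close> against 1, zero by induction; for
  \<open>n = 1\<close> the factor vanishes, and for \<open>n = 0\<close> the recursion at
  \<open>p = 0\<close> gives zero.\<close>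

lemma gegenbauer_moment_0_Suc: "gegenbauer_moment m 0 (Suc n) = 0"
proof (induction n rule: less_induct)
  case (less n)
  have "(gegenbauer \<nu> n has_real_derivative gegenbauer_deriv \<nu> n t) (at t)" for t
    by (rule gegenbauer_has_derivative)
  then have "0 = integral {- 1..1}
      (\<lambda>t. ((1 - t\<^sup>2) * gegenbauer_deriv \<nu> n t - (real m - 1) * t * gegenbauer \<nu> n t) * jacobi_weight m t)"
    by (intro jacobi_weight_by_parts [symmetric] m continuous_intros)
  also have "\<dots> = integral {- 1..1} (\<lambda>t. (real n - 1) * (t ^ 1 * gegenbauer \<nu> n t * jacobi_weight m t)
      - real (Suc n) * (t ^ 0 * gegenbauer \<nu> (Suc n) t * jacobi_weight m t))"
  proof (rule integral_cong)
    have m': "real m = 2 * \<nu> + 2" by (simp add: \<nu>_def field_simps)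
    show "((1 - t\<^sup>2) * gegenbauer_deriv \<nu> n t - (real m - 1) * t * gegenbauer \<nu> n t) * jacobi_weight m t =
        (real n - 1) * (t ^ 1 * gegenbauer \<nu> n t * jacobi_weight m t)
        - real (Suc n) * (t ^ 0 * gegenbauer \<nu> (Suc n) t * jacobi_weight m t)" for t
      unfolding gegenbauer_raise m' by (simp add: algebra_simps)
  qed
  also have "\<dots> = (real n - 1) * K 1 n - real (Suc n) * K 0 (Suc n)"
    unfolding K_def by (simp only: integral_diff integral_mult_right integrable_on_mult_right unnormalised_moment_integrable)
  finally have eq: "real (Suc n) * K 0 (Suc n) = (real n - 1) * K 1 n" by simp
  have "(real n - 1) * gegenbauer_moment m 1 n = 0"
  proof (cases "n \<ge> 2")
    case True
    then have "gegenbauer_moment m 0 (Suc (n - 2)) = 0" by (intro less) simp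
    moreover have "Suc (n - 2) = n - 1" using True by simp
    ultimately have "(real n + real m - 1) * gegenbauer_moment m 1 n = 0"
      using gegenbauer_moment_rec [of 0 n] by simp
    then show ?thesis using m by simp
  next
    case False
    then consider "n = 0" | "n = 1" by linarith
    then show ?thesis
      using gegenbauer_moment_rec [of 0 0] m by cases simp_all
  qed
  then have "(real n - 1) * K 1 n = 0"
    using gegenbauer_pos [of n] by (simp add: gegenbauer_moment_eq)
  with eq have "K 0 (Suc n) = 0"
    by (metis mult_eq_0_iff of_nat_eq_0_iff nat.distinct(1))
  then show ?case by (simp add: gegenbauer_moment_eq)
qed

lemma gegenbauer_moment_0_0: "gegenbauer_moment m 0 0 = integral {- 1..1} (jacobi_weight m)"
  by (simp add: gegenbauer_moment_def)

end

section \<open>The Funk--Hecke formula\<close>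

text \<open>The induction has to cover all degrees and all \<open>H\<close>, because the recursion
  passes to \<open>DD \<xi> H\<close>. It closes since this derivative is again harmonic and, by
  Euler's identity, equals \<open>n *\<^sub>R H \<xi>\<close> at \<xi>: every moment stays a
  multiple of \<open>H \<xi>\<close>.\<close>

lemma funk_hecke_monomial:
  fixes H :: "'a::euclidean_space \<Rightarrow> 'b::euclidean_space"
  assumes dim: "3 \<le> DIM('a)" and \<xi>: "norm \<xi> = 1"
    and "hom_poly n H" and "\<And>x. laplacian H x = 0"
  shows "(\<integral>t. (\<xi> \<bullet> t) ^ p *\<^sub>R H t \<partial>sphere_measure) =
    (sphere_area (DIM('a) - 1) * gegenbauer_moment DIM('a) p n) *\<^sub>R H \<xi>"
  using assms(3,4)
proof (induction p arbitrary: n H rule: less_induct)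
  case (less p)
  note H = less.prems(1) and harm = less.prems(2)
  let ?\<sigma> = "sphere_area (DIM('a) - 1)" and ?c = "gegenbauer_moment DIM('a)"
  show ?case
  proof (cases p)
    case 0
    show ?thesis
    proof (cases n)
      case n: 0
      have "(\<integral>t. H t \<partial>sphere_measure) = (\<integral>t. H \<xi> \<partial>(sphere_measure :: 'a measure))"
        by (rule Bochner_Integration.integral_cong [OF refl]) (use hom_poly_0 H n in blast)
      also have "\<dots> = sphere_area DIM('a) *\<^sub>R H \<xi>"
        using measure_sphere_measure [where 'a='a] by simp
      finally show ?thesis
        using sphere_area_slice [OF dim] by (simp add: 0 n gegenbauer_moment_0_0 [OF dim])
    next
      case (Suc k)
      then have "(\<integral>t. H t \<partial>sphere_measure) = 0"
        using dim by (intro sphere_integral_harmonic [OF H] harm) auto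
      then show ?thesis
        using gegenbauer_moment_0_Suc [OF dim, of k] by (simp add: 0 Suc)
    qed
  next
    case (Suc q)
    let ?f = "\<lambda>t. (t \<bullet> \<xi>) ^ q *\<^sub>R H t"
    have \<xi>\<xi>: "\<xi> \<bullet> \<xi> = 1" using \<xi> by (simp add: dot_square_norm)
    have D: "DD \<xi> ?f t = real q *\<^sub>R ((\<xi> \<bullet> t) ^ (q - 1) *\<^sub>R H t) + (\<xi> \<bullet> t) ^ q *\<^sub>R DD \<xi> H t" for t
    proof -
      have "(?f has_derivative (\<lambda>v. (real q * (v \<bullet> \<xi>) * (t \<bullet> \<xi>) ^ (q - 1)) *\<^sub>R H t
          + (t \<bullet> \<xi>) ^ q *\<^sub>R DD v H t)) (at t)"
        using differentiable_has_derivative_DD [OF hom_poly_differentiable [OF H], of t]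
        by (auto intro!: derivative_eq_intros simp: algebra_simps)
      from directional_deriv_eq [OF this, of \<xi>] show ?thesis
        by (simp add: \<xi>\<xi> inner_commute)
    qed
    have harmD: "laplacian (DD \<xi> H) x = 0" for x
    proof -
      have "laplacian H = (\<lambda>_. 0)" using harm by blast
      then show ?thesis by (simp add: laplacian_DD [OF H])
    qed
    have int: "integrable sphere_measure (\<lambda>t. (\<xi> \<bullet> t) ^ (q - 1) *\<^sub>R H t)"
        "integrable sphere_measure (\<lambda>t. (\<xi> \<bullet> t) ^ q *\<^sub>R DD \<xi> H t)"
      by (intro integrable_sphere_measure continuous_intros hom_poly_continuous_on [OF H]
          hom_poly_continuous_on [OF hom_poly_DD [OF H]])+
    have low: "real q *\<^sub>R (\<integral>t. (\<xi> \<bullet> t) ^ (q - 1) *\<^sub>R H t \<partial>sphere_measure) =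
        real q *\<^sub>R (?\<sigma> * ?c (q - 1) n) *\<^sub>R H \<xi>"
    proof (cases "q = 0")
      case False
      then show ?thesis using less.IH [of "q - 1", OF _ H harm] Suc by simp
    qed simp
    have "(real p + real n + real DIM('a) - 2) *\<^sub>R (\<integral>t. (\<xi> \<bullet> t) ^ p *\<^sub>R H t \<partial>sphere_measure) =
        (real (q + n) + real DIM('a) - 1) *\<^sub>R (\<integral>t. (t \<bullet> \<xi>) *\<^sub>R ?f t \<partial>sphere_measure)"
      by (simp add: Suc inner_commute algebra_simps)
    also have "\<dots> = (\<integral>t. DD \<xi> ?f t \<partial>sphere_measure)"
      by (rule sphere_integral_DD [symmetric]) (rule hom_poly_inner_power [OF H])
    also have "\<dots> = real q *\<^sub>R (\<integral>t. (\<xi> \<bullet> t) ^ (q - 1) *\<^sub>R H t \<partial>sphere_measure)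
        + (\<integral>t. (\<xi> \<bullet> t) ^ q *\<^sub>R DD \<xi> H t \<partial>sphere_measure)"
      unfolding D using int by (simp del: scaleR_scaleR)
    also have "\<dots> = real q *\<^sub>R (?\<sigma> * ?c (q - 1) n) *\<^sub>R H \<xi> + (?\<sigma> * ?c q (n - 1)) *\<^sub>R real n *\<^sub>R H \<xi>"
      unfolding low using less.IH [of q, OF _ hom_poly_DD [OF H] harmD] Suc
      by (simp add: hom_poly_euler [OF H])
    also have "\<dots> = (?\<sigma> * (real q * ?c (q - 1) n + real n * ?c q (n - 1))) *\<^sub>R H \<xi>"
      by (simp add: algebra_simps)
    also have "real q * ?c (q - 1) n + real n * ?c q (n - 1) = (real q + real n + real DIM('a) - 1) * ?c p n"
      using gegenbauer_moment_rec [OF dim, of q n] by (simp add: Suc)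
    also have "real q + real n + real DIM('a) - 1 = real p + real n + real DIM('a) - 2"
      by (simp add: Suc)
    finally have "(real p + real n + real DIM('a) - 2) *\<^sub>R (\<integral>t. (\<xi> \<bullet> t) ^ p *\<^sub>R H t \<partial>sphere_measure) =
        (real p + real n + real DIM('a) - 2) *\<^sub>R (?\<sigma> * ?c p n) *\<^sub>R H \<xi>"
      by (simp add: mult_ac)
    moreover have "real p + real n + real DIM('a) - 2 \<noteq> 0"
      using dim by simp
    ultimately show ?thesis
      using scaleR_left_imp_eq by blast
  qed
qed

section \<open>From monomials to continuous functions\<close>

definition gegenbauer_average :: "nat \<Rightarrow> nat \<Rightarrow> (real \<Rightarrow> 'b::real_normed_vector) \<Rightarrow> 'b"
  where "gegenbauer_average m n f =
    integral {- 1..1} (\<lambda>t. (gegenbauer ((real m - 2) / 2) n t /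
      gegenbauer ((real m - 2) / 2) n 1 * jacobi_weight m t) *\<^sub>R f t)"

lemma gegenbauer_average_integrable:
  fixes f :: "real \<Rightarrow> 'b::banach"
  assumes "3 \<le> m" and "continuous_on {- 1..1} f"
  shows "(\<lambda>t. (gegenbauer ((real m - 2) / 2) n t / gegenbauer ((real m - 2) / 2) n 1
    * jacobi_weight m t) *\<^sub>R f t) integrable_on {- 1..1}"
proof -
  have "gegenbauer ((real m - 2) / 2) n 1 \<noteq> 0"
    using gegenbauer_1_pos [of "(real m - 2) / 2" n] assms(1) by simp
  then have "continuous_on {- 1..1} (\<lambda>t. (gegenbauer ((real m - 2) / 2) n t / gegenbauer ((real m - 2) / 2) n 1) *\<^sub>R f t)"
    by (intro continuous_intros assms) auto
  from jacobi_weight_integrable [OF assms(1) this] show ?thesis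
    by (simp add: mult.commute)
qed

lemma gegenbauer_average_add:
  fixes f g :: "real \<Rightarrow> 'b::banach"
  assumes "3 \<le> m" and "continuous_on {- 1..1} f" and "continuous_on {- 1..1} g"
  shows "gegenbauer_average m n (\<lambda>t. f t + g t) = gegenbauer_average m n f + gegenbauer_average m n g"
  unfolding gegenbauer_average_def scaleR_add_right
  by (rule integral_add) (simp_all only: gegenbauer_average_integrable assms)

lemma gegenbauer_average_sum:
  fixes f :: "'i \<Rightarrow> real \<Rightarrow> 'b::banach"
  assumes "3 \<le> m" and "\<And>i. i \<in> I \<Longrightarrow> continuous_on {- 1..1} (f i)"
  shows "gegenbauer_average m n (\<lambda>t. \<Sum>i\<in>I. f i t) = (\<Sum>i\<in>I. gegenbauer_average m n (f i))"
  using assms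
proof (induction I rule: infinite_finite_induct)
  case (insert i I)
  then show ?case
    by (simp add: gegenbauer_average_add continuous_on_sum)
qed (simp_all add: gegenbauer_average_def)

lemma gegenbauer_average_bounded_linear:
  fixes f :: "real \<Rightarrow> 'b::banach" and L :: "'b \<Rightarrow> 'c::banach"
  assumes "3 \<le> m" and "continuous_on {- 1..1} f" and L: "bounded_linear L"
  shows "gegenbauer_average m n (\<lambda>t. L (f t)) = L (gegenbauer_average m n f)"
  using integral_linear [OF gegenbauer_average_integrable [OF assms(1,2), of n] L]
  by (simp add: gegenbauer_average_def o_def linear_cmul [OF bounded_linear.linear [OF L]])

lemmas gegenbauer_average_scaleR =
  gegenbauer_average_bounded_linear [OF _ _ bounded_linear_scaleR_right]

text \<open>The point is that \<open>B\<close> does not depend on \<open>f\<close>: this is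
  continuity in the supremum norm, as required by uniform approximation.\<close>

lemma gegenbauer_average_norm_bound:
  assumes "3 \<le> m"
  obtains B where "\<And>(f :: real \<Rightarrow> real) e. continuous_on {- 1..1} f \<Longrightarrow>
    (\<And>t. t \<in> {- 1..1} \<Longrightarrow> norm (f t) \<le> e) \<Longrightarrow> norm (gegenbauer_average m n f) \<le> e * B"
proof
  let ?w = "\<lambda>t. gegenbauer ((real m - 2) / 2) n t / gegenbauer ((real m - 2) / 2) n 1"
  have nz: "gegenbauer ((real m - 2) / 2) n 1 \<noteq> 0"
    using gegenbauer_1_pos [of "(real m - 2) / 2" n] assms by simp
  fix f :: "real \<Rightarrow> real" and e
  assume f: "continuous_on {- 1..1} f" and e: "\<And>t. t \<in> {- 1..1} \<Longrightarrow> norm (f t) \<le> e"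
  have "norm (gegenbauer_average m n f) \<le> integral {- 1..1} (\<lambda>t. e * (\<bar>?w t\<bar> * jacobi_weight m t))"
    unfolding gegenbauer_average_def
  proof (rule integral_norm_bound_integral)
    show "(\<lambda>t. (?w t * jacobi_weight m t) *\<^sub>R f t) integrable_on {- 1..1}"
      by (rule gegenbauer_average_integrable [OF assms f])
    show "(\<lambda>t. e * (\<bar>?w t\<bar> * jacobi_weight m t)) integrable_on {- 1..1}"
      using nz by (intro integrable_on_mult_right jacobi_weight_integrable_real assms continuous_intros) auto
    show "norm ((?w t * jacobi_weight m t) *\<^sub>R f t) \<le> e * (\<bar>?w t\<bar> * jacobi_weight m t)" if "t \<in> {- 1..1}" for t
      using mult_left_mono [OF e [OF that], of "\<bar>?w t\<bar> * jacobi_weight m t"] jacobi_weight_nonneg [of m t]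
      by (simp add: abs_mult mult_ac)
  qed
  then show "norm (gegenbauer_average m n f) \<le> e * integral {- 1..1} (\<lambda>t. \<bar>?w t\<bar> * jacobi_weight m t)"
    by simp
qed

lemma funk_hecke_real:
  fixes H :: "'a::euclidean_space \<Rightarrow> 'b::euclidean_space" and f :: "real \<Rightarrow> real"
  assumes dim: "3 \<le> DIM('a)" and \<xi>: "norm \<xi> = 1"
    and H: "hom_poly n H" and harm: "\<And>x. laplacian H x = 0"
    and f: "continuous_on {- 1..1} f"
  shows "(\<integral>t. f (\<xi> \<bullet> t) *\<^sub>R H t \<partial>sphere_measure) =
    (sphere_area (DIM('a) - 1) * gegenbauer_average DIM('a) n f) *\<^sub>R H \<xi>"
proof -
  let ?m = "DIM('a)" and ?\<sigma> = "sphere_area (DIM('a) - 1)"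
  have \<xi>t: "\<xi> \<bullet> t \<in> {- 1..1}" if "norm t = 1" for t
    using Cauchy_Schwarz_ineq2 [of \<xi> t] \<xi> that by (simp add: abs_le_iff)
  have int: "continuous_on (sphere 0 1) (\<lambda>t. g (\<xi> \<bullet> t) *\<^sub>R H t)"
    if "continuous_on {- 1..1} g" for g :: "real \<Rightarrow> real"
    using \<xi>t by (intro continuous_intros continuous_on_compose2 [OF that] hom_poly_continuous_on [OF H]) auto
  obtain C where C: "\<And>t. norm t = 1 \<Longrightarrow> norm (H t) \<le> C"
  proof -
    have "bounded (H ` sphere 0 1)"
      by (intro compact_imp_bounded compact_continuous_image hom_poly_continuous_on [OF H]) simp
    then show ?thesis using that by (force simp: bounded_iff)
  qed
  obtain B where B: "\<And>(f :: real \<Rightarrow> real) e. continuous_on {- 1..1} f \<Longrightarrow>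
      (\<And>t. t \<in> {- 1..1} \<Longrightarrow> norm (f t) \<le> e) \<Longrightarrow> norm (gegenbauer_average ?m n f) \<le> e * B"
    using gegenbauer_average_norm_bound [OF dim] by metis
  \<comment> \<open>\<open>E\<close> measures the failure of the formula. It is additive, bounded by
    \<open>K\<close> times the supremum norm, and zero on polynomials; uniform approximation then
    forces \<open>E f = 0\<close>.\<close>
  define E where "E f = (\<integral>t. f (\<xi> \<bullet> t) *\<^sub>R H t \<partial>sphere_measure) - (?\<sigma> * gegenbauer_average ?m n f) *\<^sub>R H \<xi>" for f
  define K where "K = C * sphere_area ?m + \<bar>?\<sigma>\<bar> * B * norm (H \<xi>)"
  have bound: "norm (E g) \<le> e * K"
    if g: "continuous_on {- 1..1} g" and e: "\<And>t. t \<in> {- 1..1} \<Longrightarrow> norm (g t) \<le> e" for g e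
  proof -
    have "0 \<le> e" using e [of 0] norm_ge_zero order_trans by fastforce
    have "norm (\<integral>t. g (\<xi> \<bullet> t) *\<^sub>R H t \<partial>sphere_measure) \<le> (e * C) * sphere_area ?m"
      using e \<xi>t C \<open>0 \<le> e\<close> by (intro sphere_integral_norm_bound int g) (auto intro!: mult_mono)
    moreover have "norm ((?\<sigma> * gegenbauer_average ?m n g) *\<^sub>R H \<xi>) \<le> (\<bar>?\<sigma>\<bar> * (e * B)) * norm (H \<xi>)"
      unfolding norm_scaleR abs_mult
      using B [OF g e] by (intro mult_right_mono mult_left_mono) auto
    ultimately have "norm (E g) \<le> (e * C) * sphere_area ?m + (\<bar>?\<sigma>\<bar> * (e * B)) * norm (H \<xi>)"
      unfolding E_def by (rule order_trans [OF norm_triangle_ineq4 add_mono])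
    then show ?thesis by (simp add: K_def algebra_simps)
  qed
  have poly: "E g = 0" if g': "real_polynomial_function g" for g
  proof -
    obtain a N where g: "g = (\<lambda>x. \<Sum>i\<le>N. a i * x ^ i)"
      using g' unfolding real_polynomial_function_iff_sum by auto
    have "gegenbauer_average ?m n g = (\<Sum>i\<le>N. gegenbauer_average ?m n (\<lambda>x. a i *\<^sub>R x ^ i))"
      unfolding g real_scaleR_def
      by (intro gegenbauer_average_sum dim continuous_intros)
    also have "\<dots> = (\<Sum>i\<le>N. a i * gegenbauer_moment ?m i n)"
    proof (intro sum.cong refl)
      fix i
      have "gegenbauer_average ?m n (\<lambda>x. a i *\<^sub>R x ^ i) = a i *\<^sub>R gegenbauer_average ?m n (\<lambda>x. x ^ i)"
        by (rule gegenbauer_average_scaleR [OF dim]) (intro continuous_intros)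
      also have "gegenbauer_average ?m n (\<lambda>x. x ^ i) = gegenbauer_moment ?m i n"
        unfolding gegenbauer_average_def gegenbauer_moment_def by (simp add: mult_ac)
      finally show "gegenbauer_average ?m n (\<lambda>x. a i *\<^sub>R x ^ i) = a i * gegenbauer_moment ?m i n"
        by simp
    qed
    finally have avg: "gegenbauer_average ?m n g = (\<Sum>i\<le>N. a i * gegenbauer_moment ?m i n)" .
    have "(\<integral>t. g (\<xi> \<bullet> t) *\<^sub>R H t \<partial>sphere_measure) =
        (\<integral>t. (\<Sum>i\<le>N. a i *\<^sub>R ((\<xi> \<bullet> t) ^ i *\<^sub>R H t)) \<partial>sphere_measure)"
      by (simp add: g scaleR_sum_left)
    also have "\<dots> = (\<Sum>i\<le>N. a i *\<^sub>R (\<integral>t. (\<xi> \<bullet> t) ^ i *\<^sub>R H t \<partial>sphere_measure))"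
    proof -
      have "integrable sphere_measure (\<lambda>t. (\<xi> \<bullet> t) ^ i *\<^sub>R H t)" for i
        by (intro integrable_sphere_measure continuous_intros hom_poly_continuous_on [OF H])
      then show ?thesis by (simp del: scaleR_scaleR)
    qed
    also have "\<dots> = (?\<sigma> * gegenbauer_average ?m n g) *\<^sub>R H \<xi>"
      by (simp add: funk_hecke_monomial [OF dim \<xi> H harm] avg sum_distrib_left scaleR_sum_left mult_ac)
    finally show ?thesis by (simp add: E_def)
  qed
  have "norm (E f) \<le> e * \<bar>K\<bar>" if e: "e > 0" for e
  proof -
    obtain g where g: "real_polynomial_function g" and fg: "\<And>x. x \<in> {- 1..1} \<Longrightarrow> \<bar>f x - g x\<bar> < e"
      using Stone_Weierstrass_real_polynomial_function [OF compact_Icc f e] by blast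
    have cg: "continuous_on {- 1..1} g"
      using g by (simp add: continuous_on_polymonial_function real_polynomial_function_eq)
    have "E f = E (\<lambda>x. f x - g x) + E g"
    proof -
      have "(\<integral>t. (f (\<xi> \<bullet> t) - g (\<xi> \<bullet> t)) *\<^sub>R H t \<partial>sphere_measure) =
          (\<integral>t. f (\<xi> \<bullet> t) *\<^sub>R H t \<partial>sphere_measure) - (\<integral>t. g (\<xi> \<bullet> t) *\<^sub>R H t \<partial>sphere_measure)"
        by (simp add: scaleR_left_diff_distrib integrable_sphere_measure int f cg)
      moreover have "gegenbauer_average ?m n (\<lambda>x. f x - g x + g x) =
          gegenbauer_average ?m n (\<lambda>x. f x - g x) + gegenbauer_average ?m n g"
        by (intro gegenbauer_average_add dim continuous_intros f cg)
      ultimately show ?thesis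
        by (simp add: E_def algebra_simps)
    qed
    also have "\<dots> = E (\<lambda>x. f x - g x)" by (simp add: poly g)
    also have "norm \<dots> \<le> e * K"
      using fg by (intro bound continuous_intros f cg) (simp add: less_imp_le)
    finally have "norm (E f) \<le> e * K" .
    also have "\<dots> \<le> e * \<bar>K\<bar>" using e by (intro mult_left_mono) auto
    finally show ?thesis .
  qed
  note bound_f = this
  \<comment> \<open>The sign of \<open>K\<close> is left open and \<open>K\<close> may be zero,
    hence the rescaling by \<open>\<bar>K\<bar> + 1\<close>.\<close>
  have "norm (E f) \<le> 0 + e" if "e > 0" for e
  proof -
    have pos: "0 < \<bar>K\<bar> + 1" by simp
    have "norm (E f) \<le> e / (\<bar>K\<bar> + 1) * \<bar>K\<bar>"
      by (rule bound_f) (rule divide_pos_pos [OF that pos])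
    also have "\<dots> \<le> e / (\<bar>K\<bar> + 1) * (\<bar>K\<bar> + 1)"
      using divide_pos_pos [OF that pos] by (intro mult_left_mono) auto
    also have "\<dots> = e" using pos by simp
    finally show ?thesis by simp
  qed
  then have "norm (E f) \<le> 0"
    by (rule field_le_epsilon)
  then show ?thesis by (simp add: E_def)
qed

section \<open>Clifford multiplication and harmonicity\<close>

lemma scaleR_eq_scalar: "r *\<^sub>R v = complex_of_real r *s (v :: complex ^ 'n)"
  by (simp add: vec_eq_iff scaleR_conv_of_real [where 'a = complex])

lemma linear_clifford_mult_right: "linear (\<lambda>b. a \<odot> b)"
  and linear_clifford_mult_left: "linear (\<lambda>a. a \<odot> b)"
  by (auto intro!: linearI simp: clifford_mult_add_left clifford_mult_add_right scaleR_eq_scalar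
      scalar_clifford_mult_left scalar_clifford_mult_right)

lemma linear_scalar: "linear (\<lambda>v. c *s (v :: complex ^ 'n))"
  by (auto intro!: linearI simp: vec_eq_iff algebra_simps)

lemmas bounded_linear_clifford_mult_right = linear_clifford_mult_right [unfolded linear_conv_bounded_linear]
lemmas bounded_linear_clifford_mult_left = linear_clifford_mult_left [unfolded linear_conv_bounded_linear]
lemmas bounded_linear_scalar = linear_scalar [unfolded linear_conv_bounded_linear]

lemmas clifford_linear_simps =
  linear_add [OF linear_clifford_mult_right] linear_add [OF linear_clifford_mult_left]
  linear_diff [OF linear_clifford_mult_right] linear_diff [OF linear_clifford_mult_left]
  linear_neg [OF linear_clifford_mult_right] linear_neg [OF linear_clifford_mult_left]
  linear_cmul [OF linear_clifford_mult_right] linear_cmul [OF linear_clifford_mult_left]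

lemma sum_Basis_axis: "(\<Sum>b\<in>Basis. f (b :: real ^ 'm)) = (\<Sum>j\<in>UNIV. f (axis j 1))"
proof -
  have B: "Basis = range (\<lambda>j. axis j 1 :: real ^ 'm)"
    by (auto simp: Basis_vec_def)
  have inj: "inj (\<lambda>j. axis j 1 :: real ^ 'm)"
    by (rule injI) (simp add: axis_eq_axis)
  show ?thesis
    unfolding B sum.reindex [OF inj] by simp
qed

lemma linear_clifford_vector: "linear clifford_vector"
  by (rule linearI) (simp_all add: clifford_vector_def scaleR_left_distrib sum.distrib scaleR_sum_right)

lemma clifford_vector_mult:
  "clifford_vector x \<odot> a = (\<Sum>j\<in>UNIV. (x \<bullet> axis j 1) *\<^sub>R (blade {j} \<odot> a))"
  "a \<odot> clifford_vector x = (\<Sum>j\<in>UNIV. (x \<bullet> axis j 1) *\<^sub>R (a \<odot> blade {j}))"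
  by (simp_all add: clifford_vector_def clifford_mult_sum_left clifford_mult_sum_right
      clifford_linear_simps inner_axis inner_real_def)

text \<open>Adding the sum to its transpose leaves only the anticommutators. Both
  \<open>x^2 = - |x|^2\<close> and the factorisation of the Laplacian by the Dirac operator are
  instances.\<close>

lemma sum_blade_blade_symmetric:
  fixes a :: "'m::{finite,linorder} \<Rightarrow> 'm \<Rightarrow> 'm clifford"
  assumes "\<And>j k. a j k = a k j"
  shows "(\<Sum>j\<in>UNIV. \<Sum>k\<in>UNIV. blade {j} \<odot> (blade {k} \<odot> a j k)) = - (\<Sum>j\<in>UNIV. a j j)"
proof -
  let ?S = "\<Sum>j\<in>UNIV. \<Sum>k\<in>UNIV. blade {j} \<odot> (blade {k} \<odot> a j k)"
  have "?S = (\<Sum>j\<in>UNIV. \<Sum>k\<in>UNIV. blade {k} \<odot> (blade {j} \<odot> a j k))"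
    by (subst sum.swap) (simp add: assms)
  then have "?S + ?S = (\<Sum>j\<in>UNIV. \<Sum>k\<in>UNIV. (blade {j} \<odot> blade {k} + blade {k} \<odot> blade {j}) \<odot> a j k)"
    by (simp add: clifford_mult_add_left clifford_mult_assoc sum.distrib)
  also have "\<dots> = (\<Sum>j\<in>UNIV. \<Sum>k\<in>UNIV. if j = k then (- 2) *s a j k else 0)"
    unfolding blade_anticommute by (intro sum.cong refl) (simp add: scalar_clifford_mult_left)
  also have "\<dots> = (- 2) *\<^sub>R (\<Sum>j\<in>UNIV. a j j)"
    by (simp add: scaleR_eq_scalar scaleR_sum_right vec_eq_iff sum_distrib_left sum_negf)
  finally have "2 *\<^sub>R ?S = 2 *\<^sub>R (- (\<Sum>j\<in>UNIV. a j j))"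
    by (simp add: scaleR_2)
  then show ?thesis
    by (rule scaleR_left_imp_eq [of 2, rotated]) simp
qed

lemma clifford_vector_square: "clifford_vector x \<odot> clifford_vector x = - ((x \<bullet> x) *\<^sub>R blade {})"
proof -
  have "clifford_vector x \<odot> (clifford_vector x \<odot> blade {}) =
      (\<Sum>j\<in>UNIV. \<Sum>k\<in>UNIV. blade {j} \<odot> (blade {k} \<odot> ((x \<bullet> axis j 1) * (x \<bullet> axis k 1)) *\<^sub>R blade {}))"
    unfolding clifford_vector_mult(1)
    by (simp add: clifford_linear_simps clifford_mult_sum_right scaleR_sum_right)
  also have "\<dots> = - (\<Sum>j\<in>UNIV. ((x \<bullet> axis j 1) * (x \<bullet> axis j 1)) *\<^sub>R blade {})"
    by (rule sum_blade_blade_symmetric) (simp add: mult.commute)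
  also have "\<dots> = - ((x \<bullet> x) *\<^sub>R blade {})"
    by (simp add: inner_axis inner_vec_def [of x x] scaleR_sum_left inner_real_def)
  finally show ?thesis by simp
qed

lemma hom_poly_clifford_vector_left:
    "hom_poly n f \<Longrightarrow> hom_poly (Suc n) (\<lambda>x. clifford_vector x \<odot> f x)"
  and hom_poly_clifford_vector_right:
    "hom_poly n f \<Longrightarrow> hom_poly (Suc n) (\<lambda>x. f x \<odot> clifford_vector x)"
  unfolding clifford_vector_mult
  by (rule hom_poly_sum, rule hom_poly.mult, erule hom_poly_linear,
      rule linear_clifford_mult_right linear_clifford_mult_left)+

text \<open>Each summand \<open>x_j e_j f\<close> contributes \<open>2 e_j DD (axis j 1) f\<close>
  as its cross term, and these add up to the Dirac operator. Multiplication by \<open>x\<close> thus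
  preserves harmonicity on the side on which \<open>f\<close> is monogenic.\<close>

lemma laplacian_clifford_vector_left:
    "hom_poly n f \<Longrightarrow> laplacian (\<lambda>x. clifford_vector x \<odot> f x) x =
      2 *\<^sub>R dirac_left f x + clifford_vector x \<odot> laplacian f x"
  and laplacian_clifford_vector_right:
    "hom_poly n f \<Longrightarrow> laplacian (\<lambda>x. f x \<odot> clifford_vector x) x =
      2 *\<^sub>R dirac_right f x + laplacian f x \<odot> clifford_vector x"
proof -
  assume f: "hom_poly n f"
  have *: "hom_poly n (\<lambda>x. blade {j} \<odot> f x)" "hom_poly n (\<lambda>x. f x \<odot> blade {j})" for j
    by (intro hom_poly_linear [OF f] linear_clifford_mult_left linear_clifford_mult_right)+
  show "laplacian (\<lambda>x. clifford_vector x \<odot> f x) x =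
      2 *\<^sub>R dirac_left f x + clifford_vector x \<odot> laplacian f x"
    unfolding clifford_vector_mult dirac_left_def
    by (subst laplacian_sum [where n = "Suc n"], rule hom_poly.mult [OF *(1)])
      (simp add: laplacian_inner_scaleR [OF *(1)] sum.distrib scaleR_sum_right
        laplacian_bounded_linear [OF bounded_linear_clifford_mult_right f]
        DD_bounded_linear [OF bounded_linear_clifford_mult_right hom_poly_differentiable [OF f]])
  show "laplacian (\<lambda>x. f x \<odot> clifford_vector x) x =
      2 *\<^sub>R dirac_right f x + laplacian f x \<odot> clifford_vector x"
    unfolding clifford_vector_mult dirac_right_def
    by (subst laplacian_sum [where n = "Suc n"], rule hom_poly.mult [OF *(2)])
      (simp add: laplacian_inner_scaleR [OF *(2)] sum.distrib scaleR_sum_right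
        laplacian_bounded_linear [OF bounded_linear_clifford_mult_left f]
        DD_bounded_linear [OF bounded_linear_clifford_mult_left hom_poly_differentiable [OF f]])
qed

lemma dirac_left_dirac_left:
  assumes f: "hom_poly n f"
  shows "dirac_left (dirac_left f) x = - laplacian f x"
proof -
  have "DD v (dirac_left f) x = (\<Sum>j\<in>UNIV. blade {j} \<odot> DD v (DD (axis j 1) f) x)" for v
  proof -
    have "DD v (\<lambda>x. \<Sum>j\<in>UNIV. blade {j} \<odot> DD (axis j 1) f x) x =
        (\<Sum>j\<in>UNIV. DD v (\<lambda>x. blade {j} \<odot> DD (axis j 1) f x) x)"
      by (rule DD_sum, rule hom_poly_differentiable, rule hom_poly_linear, rule hom_poly_DD,
          rule f, rule linear_clifford_mult_right)
    then show ?thesis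
      by (simp add: dirac_left_def [abs_def] hom_poly_differentiable [OF hom_poly_DD [OF f]]
          DD_bounded_linear [OF bounded_linear_clifford_mult_right])
  qed
  then have "dirac_left (dirac_left f) x =
      (\<Sum>i\<in>UNIV. \<Sum>j\<in>UNIV. blade {i} \<odot> (blade {j} \<odot> DD (axis i 1) (DD (axis j 1) f) x))"
    by (simp add: dirac_left_def [of "dirac_left f"] clifford_mult_sum_right)
  also have "\<dots> = - (\<Sum>j\<in>UNIV. DD (axis j 1) (DD (axis j 1) f) x)"
    by (rule sum_blade_blade_symmetric) (rule DD_commute [OF f])
  finally show ?thesis by (simp add: laplacian_def sum_Basis_axis)
qed

text \<open>Of the constant, \<open>2 * CARD('m)\<close> is the Laplacian of
  \<open>x \<bullet> x\<close> and \<open>4 * n\<close> arises from the cross terms by Euler's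
  identity.\<close>

lemma laplacian_inner_self_scaleR:
  fixes f :: "real ^ 'm \<Rightarrow> 'b::real_normed_vector"
  assumes f: "hom_poly n f"
  shows "laplacian (\<lambda>x. (x \<bullet> x) *\<^sub>R f x) x =
      (2 * real CARD('m) + 4 * real n) *\<^sub>R f x + (x \<bullet> x) *\<^sub>R laplacian f x"
    and "hom_poly (Suc (Suc n)) (\<lambda>x. (x \<bullet> x) *\<^sub>R f x)"
proof -
  have sq: "(\<lambda>x. (x \<bullet> x) *\<^sub>R f x) = (\<lambda>x. \<Sum>b\<in>Basis. (x \<bullet> b) *\<^sub>R (x \<bullet> b) *\<^sub>R f x)"
    by (rule ext, subst euclidean_inner) (simp add: scaleR_sum_left)
  have hp: "hom_poly (Suc (Suc n)) (\<lambda>x. (x \<bullet> b) *\<^sub>R (x \<bullet> b) *\<^sub>R f x)" for b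
    by (intro hom_poly.mult f)
  show "hom_poly (Suc (Suc n)) (\<lambda>x. (x \<bullet> x) *\<^sub>R f x)"
    unfolding sq by (intro hom_poly_sum hp)
  have "laplacian (\<lambda>x. (x \<bullet> b) *\<^sub>R (x \<bullet> b) *\<^sub>R f x) x =
      2 *\<^sub>R f x + 4 *\<^sub>R ((x \<bullet> b) *\<^sub>R DD b f x) + ((x \<bullet> b) * (x \<bullet> b)) *\<^sub>R laplacian f x"
    if "b \<in> Basis" for b
    unfolding laplacian_inner_scaleR [OF hom_poly.mult [OF f]] laplacian_inner_scaleR [OF f]
      hom_poly_DD_inner_scaleR [OF f]
    using that by (simp add: scaleR_add_right) (simp add: algebra_simps flip: scaleR_add_left)
  then have "laplacian (\<lambda>x. \<Sum>b\<in>Basis. (x \<bullet> b) *\<^sub>R (x \<bullet> b) *\<^sub>R f x) x =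
      real CARD('m) *\<^sub>R 2 *\<^sub>R f x + 4 *\<^sub>R (\<Sum>b\<in>Basis. (x \<bullet> b) *\<^sub>R DD b f x)
      + (\<Sum>b\<in>Basis. (x \<bullet> b) * (x \<bullet> b)) *\<^sub>R laplacian f x"
    by (simp add: laplacian_sum [OF hp] sum.distrib scaleR_sum_right scaleR_sum_left sum_constant_scaleR del: scaleR_scaleR)
  then show "laplacian (\<lambda>x. (x \<bullet> x) *\<^sub>R f x) x =
      (2 * real CARD('m) + 4 * real n) *\<^sub>R f x + (x \<bullet> x) *\<^sub>R laplacian f x"
    unfolding sq hom_poly_DD_expand [OF f, symmetric] hom_poly_euler [OF f] euclidean_inner [symmetric]
    by (simp add: algebra_simps)
qed

section \<open>Grades: sandwiches and the comparison of left and right\<close>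

lemma blade_sign_commute:
  "blade_sign {j} A * blade_sign A {j} = (- 1) ^ card A * (if j \<in> A then - 1 else 1)"
proof -
  \<comment> \<open>An element \<open>i \<noteq> j\<close> is counted in exactly one of the two
    signs, since the order is linear; \<open>i = j\<close> is counted in both.\<close>
  have "blade_sign {j} A * blade_sign A {j} = (\<Prod>i\<in>A. if i = j then 1 else - 1)"
    unfolding blade_sign_def by (auto simp flip: prod.distrib intro!: prod.cong)
  also have "\<dots> = (\<Prod>i\<in>A - {j}. - 1)"
    by (rule prod.mono_neutral_cong_right) auto
  also have "\<dots> = (- 1) ^ card A * (if j \<in> A then - 1 else 1)"
  proof (cases "j \<in> A")
    case True
    define n where "n = card (A - {j})"
    have cA: "card A = Suc n"
      unfolding n_def using card_Suc_Diff1 [OF finite True] by simp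
    show ?thesis
      unfolding prod_constant n_def [symmetric] cA using True by simp
  qed simp
  finally show ?thesis .
qed

lemma blade_sign_square: "blade_sign A B * blade_sign A B = 1"
  unfolding blade_sign_def by (simp flip: prod.distrib) (auto intro!: prod.neutral)

text \<open>The sign of \<open>e_j e_A e_j\<close> depends only on whether \<open>j\<close> lies in
  \<open>A\<close>: up to \<open>(- 1) ^ card A\<close> there are \<open>card A\<close> terms with
  sign plus and \<open>m - card A\<close> with sign minus.\<close>

lemma blade_sandwich:
  "(\<Sum>j\<in>UNIV. blade {j} \<odot> blade A \<odot> blade {j}) =
    mu CARD('m) (card A) *\<^sub>R blade (A :: 'm::{finite,linorder} set)"
proof -
  have "blade {j} \<odot> blade A \<odot> blade {j} = (((- 1) ^ card A * (if j \<in> A then 1 else - 1)) :: complex) *s blade A" for j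
  proof -
    have "sym_diff (sym_diff {j} A) {j} = A" by blast
    then have "blade {j} \<odot> blade A \<odot> blade {j} =
        (blade_sign {j} A * (blade_sign {j} {j} * blade_sign A {j})) *s blade A"
      by (simp only: blade_mult scalar_clifford_mult_left vector_smult_assoc blade_sign_sym_diff_left mult.commute)
    also have "blade_sign {j} A * (blade_sign {j} {j} * blade_sign A {j}) = - ((- 1) ^ card A * (if j \<in> A then - 1 else 1))"
      unfolding blade_sign_commute [symmetric] by (simp add: blade_sign_def)
    finally show ?thesis by simp
  qed
  then have "(\<Sum>j\<in>UNIV. blade {j} \<odot> blade A \<odot> blade {j}) =
      (\<Sum>j\<in>UNIV. (- 1) ^ card A * (if j \<in> A then 1 else - 1)) *s blade A"
    by (simp add: vec_eq_iff sum_distrib_right)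
  also have "(\<Sum>j\<in>UNIV. (- 1) ^ card A * (if j \<in> A then 1 else - 1)) = complex_of_real (mu CARD('m) (card A))"
  proof -
    have "(\<Sum>j\<in>UNIV. if j \<in> A then 1 else - 1) = (\<Sum>j\<in>UNIV. (if j \<in> A then 2 else 0) - (1 :: complex))"
      by (intro sum.cong) auto
    also have "\<dots> = 2 * of_nat (card A) - of_nat CARD('m)"
      by (simp add: sum_subtractf sum.If_cases)
    finally show ?thesis by (simp add: mu_def flip: sum_distrib_left)
  qed
  finally show ?thesis by (simp add: scaleR_eq_scalar)
qed

lemma multivector_sandwich:
  assumes "v \<in> multivectors l"
  shows "(\<Sum>j\<in>UNIV. blade {j} \<odot> v \<odot> blade {j}) = mu CARD('m) l *\<^sub>R (v :: 'm::{finite,linorder} clifford)"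
  using assms unfolding multivectors_def
proof (induction rule: span_induct_alt)
  case (step c x y)
  then obtain A where "x = blade A" "card A = l" by blast
  then have "(\<Sum>j\<in>UNIV. blade {j} \<odot> x \<odot> blade {j}) = mu CARD('m) l *\<^sub>R x"
    using blade_sandwich [of A] by simp
  with step.IH show ?case
    by (simp add: clifford_linear_simps sum.distrib scaleR_add_right scaleR_left_commute flip: scaleR_sum_right del: scaleR_scaleR)
qed simp

lemma multivectors_nth_eq_0:
  assumes "v \<in> multivectors l" and "card A \<noteq> l"
  shows "v $ A = 0"
  using assms(1) unfolding multivectors_def
proof (induction rule: span_induct_alt)
  case (step c x y)
  then show ?case using assms(2) by (auto simp: blade_def axis_def split: if_splits)
qed simp

lemma blade_mult_nth:
  fixes a :: "'m::{finite,linorder} clifford"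
  shows "(blade {j} \<odot> a) $ C = blade_sign {j} (sym_diff {j} C) * a $ sym_diff {j} C"
    and "(a \<odot> blade {j}) $ C = blade_sign (sym_diff {j} C) {j} * a $ sym_diff {j} C"
proof -
  have sd: "C = sym_diff {j} B \<longleftrightarrow> B = sym_diff {j} C" "C = sym_diff B {j} \<longleftrightarrow> B = sym_diff {j} C" for B
    by blast+
  have "blade {j} \<odot> (\<Sum>B\<in>UNIV. (a $ B) *s blade B) = (\<Sum>B\<in>UNIV. (a $ B * blade_sign {j} B) *s blade (sym_diff {j} B))"
    by (simp add: clifford_mult_sum_right scalar_clifford_mult_right blade_mult)
  then have "(blade {j} \<odot> a) $ C = (\<Sum>B\<in>UNIV. if B = sym_diff {j} C then a $ B * blade_sign {j} B else 0)"
    unfolding clifford_expand [symmetric] by (simp add: blade_def axis_def sd if_distrib cong: if_cong)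
  then show "(blade {j} \<odot> a) $ C = blade_sign {j} (sym_diff {j} C) * a $ sym_diff {j} C"
    by (simp add: mult.commute)
  have "(\<Sum>B\<in>UNIV. (a $ B) *s blade B) \<odot> blade {j} = (\<Sum>B\<in>UNIV. (a $ B * blade_sign B {j}) *s blade (sym_diff B {j}))"
    by (simp add: clifford_mult_sum_left scalar_clifford_mult_left blade_mult)
  then have "(a \<odot> blade {j}) $ C = (\<Sum>B\<in>UNIV. if B = sym_diff {j} C then a $ B * blade_sign B {j} else 0)"
    unfolding clifford_expand [symmetric] by (simp add: blade_def axis_def sd if_distrib cong: if_cong)
  then show "(a \<odot> blade {j}) $ C = blade_sign (sym_diff {j} C) {j} * a $ sym_diff {j} C"
    by (simp add: mult.commute)
qed

text \<open>Multiplying an \<open>l\<close>-vector by a vector from the left or from the right gives the same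
  \<open>l \<plusminus> 1\<close>-vector parts up to signs which depend on the grade only. Hence the left and the
  right Dirac operator vanish simultaneously on \<open>l\<close>-vector valued functions.\<close>

lemma mult_blade_nth_commute:
  assumes "\<And>A. card A \<noteq> l \<Longrightarrow> a $ A = 0"
  shows "(a \<odot> blade {j}) $ C = (- 1) ^ l * (if card C = Suc l then 1 else - 1) * (blade {j} \<odot> a) $ C"
proof (cases "card (sym_diff {j} C) = l")
  case False
  then show ?thesis by (simp add: blade_mult_nth assms)
next
  case True
  let ?B = "sym_diff {j} C"
  \<comment> \<open>\<open>C\<close> arises from \<open>?B\<close>, which has grade
    \<open>l\<close>, by adding or removing \<open>j\<close>. So the grade of \<open>C\<close> alone
    reveals whether \<open>j\<close> was in \<open>?B\<close>, and the sign does not depend on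
    \<open>j\<close> itself.\<close>
  have c: "card C = Suc l \<longleftrightarrow> j \<notin> ?B"
  proof (cases "j \<in> C")
    case j: True
    then have B: "?B = C - {j}" by blast
    then have "card C = Suc l" using card_Suc_Diff1 [OF finite j] True by simp
    then show ?thesis using B by blast
  next
    case j: False
    then have "?B = insert j C" by blast
    then show ?thesis using True j by auto
  qed
  have "blade_sign ?B {j} = blade_sign {j} ?B * (blade_sign {j} ?B * blade_sign ?B {j})"
    by (simp add: blade_sign_square flip: mult.assoc)
  also have "\<dots> = blade_sign {j} ?B * ((- 1) ^ l * (if card C = Suc l then 1 else - 1))"
    unfolding blade_sign_commute True c by simp
  finally show ?thesis
    by (simp only: blade_mult_nth mult_ac)
qed

lemma dirac_right_eq_0:
  assumes P: "hom_poly n P" and l: "\<And>x. P x \<in> multivectors l" and "dirac_left P x = 0"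
  shows "dirac_right P x = 0"
proof -
  have "DD v P x $ A = 0" if "card A \<noteq> l" for v A
  proof -
    have "DD v P x $ A = DD v (\<lambda>x. P x $ A) x"
      by (rule DD_bounded_linear [OF bounded_linear_vec_nth hom_poly_differentiable [OF P], symmetric])
    also have "(\<lambda>x. P x $ A) = (\<lambda>_. 0)"
      using multivectors_nth_eq_0 [OF l that] by blast
    finally show ?thesis by simp
  qed
  then have "dirac_right P x $ C = (- 1) ^ l * (if card C = Suc l then 1 else - 1) * dirac_left P x $ C" for C
    by (simp add: dirac_right_def dirac_left_def mult_blade_nth_commute [of l] flip: sum_distrib_left)
  then show ?thesis using assms(3) by (simp add: vec_eq_iff)
qed

section \<open>Harmonic pieces of the integrand\<close>

context
  fixes P :: "real ^ 'm::{finite,linorder} \<Rightarrow> 'm clifford" and k l :: nat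
  assumes P: "hom_poly k P" and left: "\<And>x. dirac_left P x = 0" and mv: "\<And>x. P x \<in> multivectors l"
begin

lemma left_monogenic_harmonic: "laplacian P x = 0"
proof -
  have "dirac_left P = (\<lambda>_. 0)" using left by blast
  then show ?thesis
    using dirac_left_dirac_left [OF P, of x] by (simp add: dirac_left_def)
qed

lemma left_monogenic_harmonic_mult_left: "laplacian (\<lambda>x. clifford_vector x \<odot> P x) x = 0"
  by (simp add: laplacian_clifford_vector_left [OF P] left left_monogenic_harmonic)

lemma left_monogenic_harmonic_mult_right: "laplacian (\<lambda>x. P x \<odot> clifford_vector x) x = 0"
  by (simp add: laplacian_clifford_vector_right [OF P] dirac_right_eq_0 [OF P mv left] left_monogenic_harmonic)

text \<open>As \<open>x P\<close> is harmonic, only twice its right Dirac derivative remains. There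
  the derivatives of the factor \<open>x\<close> give the sandwich sum, hence \<open>mu\<close>, and
  those of \<open>P\<close> give \<open>x\<close> times the right Dirac derivative of
  \<open>P\<close>, which is zero.\<close>

lemma left_monogenic_laplacian_sandwich:
  "laplacian (\<lambda>x. clifford_vector x \<odot> P x \<odot> clifford_vector x) x = (2 * mu CARD('m) l) *\<^sub>R P x"
proof -
  have "DD (axis j 1) (\<lambda>x. clifford_vector x \<odot> P x) x = blade {j} \<odot> P x + clifford_vector x \<odot> DD (axis j 1) P x" for j
  proof (rule directional_deriv_eq [where f' = "\<lambda>v. clifford_vector v \<odot> P x + clifford_vector x \<odot> DD v P x", THEN trans])
    have "bounded_bilinear (\<lambda>a b :: 'm clifford. a \<odot> b)"
      by (simp add: bilinear_conv_bounded_bilinear [symmetric] bilinear_def linear_clifford_mult_left linear_clifford_mult_right)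
    moreover have "(clifford_vector has_derivative clifford_vector) (at x)"
      using linear_clifford_vector
      by (intro bounded_linear_imp_has_derivative) (simp add: linear_conv_bounded_linear)
    ultimately show "((\<lambda>x. clifford_vector x \<odot> P x) has_derivative
        (\<lambda>v. clifford_vector v \<odot> P x + clifford_vector x \<odot> DD v P x)) (at x)"
      using differentiable_has_derivative_DD [OF hom_poly_differentiable [OF P], of x]
      by (subst add.commute) (rule bounded_bilinear.FDERIV)
    have "clifford_vector (axis j 1) = blade {j}"
      by (simp add: clifford_vector_def axis_def if_distrib if_distribR cong: if_cong)
    then show "clifford_vector (axis j 1) \<odot> P x + clifford_vector x \<odot> DD (axis j 1) P x =
        blade {j} \<odot> P x + clifford_vector x \<odot> DD (axis j 1) P x"
      by simp
  qed
  then have "dirac_right (\<lambda>x. clifford_vector x \<odot> P x) x =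
      (\<Sum>j\<in>UNIV. blade {j} \<odot> P x \<odot> blade {j}) + clifford_vector x \<odot> dirac_right P x"
    by (simp add: dirac_right_def clifford_mult_add_left sum.distrib clifford_mult_sum_right clifford_mult_assoc)
  also have "\<dots> = mu CARD('m) l *\<^sub>R P x"
    by (simp add: multivector_sandwich [OF mv] dirac_right_eq_0 [OF P mv left])
  finally show ?thesis
    by (simp add: laplacian_clifford_vector_right [OF hom_poly_clifford_vector_left [OF P]] left_monogenic_harmonic_mult_left)
qed

text \<open>\<open>c\<close> solves \<open>c (2 m + 4 k) = 2 \<mu>\<close>, so that the Laplacian of
  the correction cancels that of the sandwich.\<close>

lemma left_monogenic_harmonic_sandwich:
  defines "c \<equiv> mu CARD('m) l / (2 * real k + real CARD('m))"
  defines "H \<equiv> \<lambda>x. clifford_vector x \<odot> P x \<odot> clifford_vector x - (c * (x \<bullet> x)) *\<^sub>R P x"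
  shows "hom_poly (k + 2) H" and "laplacian H x = 0"
proof -
  have 1: "hom_poly (Suc (Suc k)) (\<lambda>x. clifford_vector x \<odot> P x \<odot> clifford_vector x)"
    by (intro hom_poly_clifford_vector_left hom_poly_clifford_vector_right P)
  have 2: "hom_poly (Suc (Suc k)) (\<lambda>x. (- c) *\<^sub>R (x \<bullet> x) *\<^sub>R P x)"
    by (intro hom_poly_scaleR laplacian_inner_self_scaleR(2) P)
  have H: "H = (\<lambda>x. clifford_vector x \<odot> P x \<odot> clifford_vector x + (- c) *\<^sub>R (x \<bullet> x) *\<^sub>R P x)"
    by (simp add: H_def)
  show "hom_poly (k + 2) H"
    unfolding H using hom_poly.add [OF 1 2] by simp
  have "c * (2 * real CARD('m) + 4 * real k) = 2 * mu CARD('m) l"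
  proof -
    define d where "d = 2 * real k + real CARD('m)"
    have "d \<noteq> 0"
      unfolding d_def using zero_less_card_finite [where 'a='m] by linarith
    moreover have e: "2 * real CARD('m) + 4 * real k = 2 * d" by (simp add: d_def)
    ultimately show ?thesis unfolding c_def d_def [symmetric] e by simp
  qed
  then show "laplacian H x = 0"
    unfolding H laplacian_add [OF 1 2] left_monogenic_laplacian_sandwich
      laplacian_bounded_linear [OF bounded_linear_scaleR_right laplacian_inner_self_scaleR(2) [OF P]]
      laplacian_inner_self_scaleR(1) [OF P] left_monogenic_harmonic
    by simp
qed

end

section \<open>The plane wave integral\<close>

lemma linear_scalar_left: "linear (\<lambda>c. c *s (v :: complex ^ 'n))"
  by (auto intro!: linearI simp: vec_eq_iff algebra_simps)

lemmas bounded_linear_scalar_left = linear_scalar_left [unfolded linear_conv_bounded_linear]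

lemma scalar_Re_Im: "c *s v = Re c *\<^sub>R v + \<i> *s (Im c *\<^sub>R (v :: complex ^ 'n))"
  by (simp add: vec_eq_iff complex_eq_iff)

text \<open>Meant for \<open>a\<close> the negative power of \<open>r\<close> in a coefficient
  function and \<open>b\<close> the power that homogeneity extracts from
  \<open>P (r *\<^sub>R \<xi>)\<close>.\<close>

lemma scalar_scaleR_cancel:
  assumes "a * b = 1"
  shows "(of_real a * X) *s (b *\<^sub>R v) = X *s (v :: complex ^ 'n)"
proof -
  have "of_real a * X * of_real b = of_real (a * b) * X" by simp
  then show ?thesis by (simp only: scaleR_eq_scalar vector_smult_assoc assms of_real_1 mult_1_left)
qed

lemma continuous_on_scalar [continuous_intros]:
  fixes g :: "'a::topological_space \<Rightarrow> complex ^ 'n"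
  assumes "continuous_on S f" and "continuous_on S g"
  shows "continuous_on S (\<lambda>x. f x *s g x)"
  unfolding vector_scalar_mult_def by (intro continuous_intros assms)

lemma continuous_on_clifford_mult [continuous_intros]:
  assumes "continuous_on S f" and "continuous_on S g"
  shows "continuous_on S (\<lambda>x. f x \<odot> g x)"
  unfolding clifford_mult_def by (intro continuous_intros assms)

lemma continuous_on_clifford_vector [continuous_intros]:
  "continuous_on S f \<Longrightarrow> continuous_on S (\<lambda>x. clifford_vector (f x))"
  unfolding clifford_vector_def by (intro continuous_intros)

lemma funk_hecke:
  fixes H :: "'a::euclidean_space \<Rightarrow> complex ^ 'n" and f :: "real \<Rightarrow> complex"
  assumes dim: "3 \<le> DIM('a)" and \<xi>: "norm \<xi> = 1"
    and H: "hom_poly n H" and harm: "\<And>x. laplacian H x = 0"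
    and f: "continuous_on {- 1..1} f"
  shows "(\<integral>t. f (\<xi> \<bullet> t) *s H t \<partial>sphere_measure) =
    (of_real (sphere_area (DIM('a) - 1)) * gegenbauer_average DIM('a) n f) *s H \<xi>"
proof -
  let ?avg = "gegenbauer_average DIM('a) n" and ?\<sigma> = "sphere_area (DIM('a) - 1)"
  have \<xi>t: "\<xi> \<bullet> t \<in> {- 1..1}" if "norm t = 1" for t
    using Cauchy_Schwarz_ineq2 [of \<xi> t] \<xi> that by (simp add: abs_le_iff)
  have int: "integrable sphere_measure (\<lambda>t. g (\<xi> \<bullet> t) *\<^sub>R H t)"
    if "continuous_on {- 1..1} g" for g :: "real \<Rightarrow> real"
    using \<xi>t by (intro integrable_sphere_measure continuous_intros continuous_on_compose2 [OF that]
        hom_poly_continuous_on [OF H]) auto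
  have re: "continuous_on {- 1..1} (\<lambda>t. Re (f t))" and im: "continuous_on {- 1..1} (\<lambda>t. Im (f t))"
    by (intro continuous_intros f)+
  have "(\<integral>t. f (\<xi> \<bullet> t) *s H t \<partial>sphere_measure) =
      (\<integral>t. Re (f (\<xi> \<bullet> t)) *\<^sub>R H t + \<i> *s (Im (f (\<xi> \<bullet> t)) *\<^sub>R H t) \<partial>sphere_measure)"
    by (subst scalar_Re_Im) (rule refl)
  also have "\<dots> = (\<integral>t. Re (f (\<xi> \<bullet> t)) *\<^sub>R H t \<partial>sphere_measure)
      + \<i> *s (\<integral>t. Im (f (\<xi> \<bullet> t)) *\<^sub>R H t \<partial>sphere_measure)"
    using int [OF re] int [OF im]
    by (simp add: integral_bounded_linear [OF bounded_linear_scalar] integrable_bounded_linear [OF bounded_linear_scalar])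
  also have "\<dots> = (?\<sigma> * Re (?avg f)) *\<^sub>R H \<xi> + \<i> *s ((?\<sigma> * Im (?avg f)) *\<^sub>R H \<xi>)"
    by (simp add: funk_hecke_real [OF dim \<xi> H harm re] funk_hecke_real [OF dim \<xi> H harm im]
        gegenbauer_average_bounded_linear [OF dim f bounded_linear_Re]
        gegenbauer_average_bounded_linear [OF dim f bounded_linear_Im])
  also have "\<dots> = (of_real ?\<sigma> * ?avg f) *s H \<xi>"
    by (subst scalar_Re_Im) simp
  finally show ?thesis .
qed

lemma gegenbauer_average_eq_transform:
  "gegenbauer_average m n (\<lambda>t. h (Complex x0 (r * t))) = gegenbauer_transform h m n x0 r"
  unfolding gegenbauer_average_def gegenbauer_transform_def jacobi_weight_def
  by (simp add: scaleR_conv_of_real field_simps flip: integral_mult_right integral_divide)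

lemma one_minus_iv_sandwich:
  "(blade {} - \<i> *s v) \<odot> p \<odot> (blade {} - \<i> *s v) =
    p - \<i> *s (v \<odot> p) - \<i> *s (p \<odot> v) - v \<odot> p \<odot> v"
  by (simp add: clifford_linear_simps scalar_clifford_mult_left scalar_clifford_mult_right
      vec_eq_iff algebra_simps)

lemma one_plus_iv_mult_one_minus_iv:
  assumes "norm t = 1"
  shows "(blade {} + \<i> *s clifford_vector t) \<odot> (blade {} - \<i> *s clifford_vector t) = 0"
    and "(blade {} - \<i> *s clifford_vector t) \<odot> (blade {} + \<i> *s clifford_vector t) = 0"
  using clifford_vector_square [of t] assms
  by (simp_all add: clifford_linear_simps scalar_clifford_mult_left scalar_clifford_mult_right
      dot_square_norm vec_eq_iff)

text \<open>Writing \<open>y = s * norm x\<close> replaces the moving interval by the fixed compact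
  interval from -1 to 1. The complement is then the projection of a closed set along a compact
  factor, hence closed.\<close>

lemma open_axial_domain:
  assumes "open U"
  shows "open (axial_domain U :: (real \<times> (real ^ 'm)) set)"
proof -
  let ?F = "\<lambda>z :: real \<times> real \<times> (real ^ 'm). Complex (fst (snd z)) (fst z * norm (snd (snd z)))"
  have "- axial_domain U = {p :: real \<times> (real ^ 'm). \<exists>s. s \<in> {- 1..1} \<and> (s, p) \<in> ?F -` (- U)}"
  proof (intro set_eqI iffI)
    fix p :: "real \<times> (real ^ 'm)"
    assume "p \<in> - axial_domain U"
    then have "\<not> (\<forall>y\<in>{- norm (snd p)..norm (snd p)}. Complex (fst p) y \<in> U)"
      by (simp add: axial_domain_def case_prod_beta)
    then obtain y where y: "y \<in> {- norm (snd p)..norm (snd p)}" "Complex (fst p) y \<notin> U"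
      by blast
    show "p \<in> {p. \<exists>s. s \<in> {- 1..1} \<and> (s, p) \<in> ?F -` (- U)}"
    proof (intro CollectI exI conjI)
      \<comment> \<open>If \<open>snd p = 0\<close> then \<open>y = 0\<close>, and division by zero
        returns 0, a valid witness in this case too.\<close>
      show "y / norm (snd p) \<in> {- 1..1}"
        using y(1) by (cases "snd p = 0") (auto simp: divide_simps)
      show "(y / norm (snd p), p) \<in> ?F -` (- U)"
        using y by (cases "snd p = 0") auto
    qed
  next
    fix p :: "real \<times> (real ^ 'm)"
    assume "p \<in> {p. \<exists>s. s \<in> {- 1..1} \<and> (s, p) \<in> ?F -` (- U)}"
    then obtain s where s: "s \<in> {- 1..1}" "Complex (fst p) (s * norm (snd p)) \<notin> U"
      by auto
    then have "s * norm (snd p) \<in> {- norm (snd p)..norm (snd p)}"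
      using mult_right_mono [of s 1 "norm (snd p)"] mult_right_mono [of "- 1" s "norm (snd p)"] by auto
    with s(2) show "p \<in> - axial_domain U"
      by (auto simp: axial_domain_def)
  qed
  moreover have "closed (?F -` (- U))"
    using assms by (intro closed_vimage continuous_intros) auto
  then have "closed {p :: real \<times> (real ^ 'm). \<exists>s. s \<in> {- 1..1} \<and> (s, p) \<in> ?F -` (- U)}"
    by (intro closed_compact_projection) auto
  ultimately show ?thesis
    by (simp only: open_closed)
qed

lemma axial_domain_inner:
  assumes "(x0, x) \<in> axial_domain U" and "norm t = 1"
  shows "Complex x0 (x \<bullet> t) \<in> U"
  using assms Cauchy_Schwarz_ineq2 [of x t] by (auto simp: axial_domain_def abs_le_iff)

lemma sphere_area_pos: "0 < n \<Longrightarrow> 0 < sphere_area n"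
  by (simp add: sphere_area_def)

lemma plane_wave_integral_axial:
  fixes P :: "real ^ 'm::{finite,linorder} \<Rightarrow> 'm clifford"
  assumes dim: "3 \<le> CARD('m)"
    and P: "hom_poly k P" and left: "\<And>x. dirac_left P x = 0" and mv: "\<And>x. P x \<in> multivectors l"
    and h: "continuous_on U h"
    and dom: "(x0, x) \<in> axial_domain U" and "x \<noteq> 0"
  shows "plane_wave_integral h P (x0, x) =
        coeff_A h CARD('m) k l x0 (norm x) *s P x +
        coeff_B h CARD('m) k x0 (norm x) *s (clifford_vector x \<odot> P x) +
        coeff_C h CARD('m) k x0 (norm x) *s (P x \<odot> clifford_vector x) +
        coeff_D h CARD('m) k x0 (norm x) *s (clifford_vector x \<odot> P x \<odot> clifford_vector x)"
proof -
  let ?m = "CARD('m)" and ?v = "clifford_vector :: (real, 'm) vec \<Rightarrow> 'm clifford"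
  define r where "r = norm x"
  define \<xi> where "\<xi> = x /\<^sub>R r"
  define T where "T n = gegenbauer_transform h ?m n x0 r" for n
  define \<sigma> where "\<sigma> = sphere_area (?m - 1)"
  define c where "c = mu ?m l / (2 * real k + real ?m)"
  define H where "H t = ?v t \<odot> P t \<odot> ?v t - (c * (t \<bullet> t)) *\<^sub>R P t" for t
  define f where "f s = h (Complex x0 (r * s))" for s
  have r: "0 < r" using \<open>x \<noteq> 0\<close> by (simp add: r_def)
  then have rn: "r ^ j \<noteq> 0" for j by simp
  have \<xi>: "norm \<xi> = 1" and x: "x = r *\<^sub>R \<xi>"
    using r by (simp_all add: \<xi>_def r_def)
  have dim': "3 \<le> DIM((real, 'm) vec)" using dim by simp
  have \<sigma>: "0 < \<sigma>" using dim by (simp add: \<sigma>_def sphere_area_pos)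
  have f: "continuous_on {- 1..1} f"
    unfolding f_def
  proof (rule continuous_on_compose2 [OF h])
    show "(\<lambda>s. Complex x0 (r * s)) ` {- 1..1} \<subseteq> U"
    proof clarify
      fix s :: real assume "s \<in> {- 1..1}"
      then have "r * s \<in> {- norm x..norm x}"
        using mult_left_mono [of s 1 r] mult_left_mono [of "- 1" s r] r by (auto simp: r_def)
      then show "Complex x0 (r * s) \<in> U" using dom by (auto simp: axial_domain_def)
    qed
  qed (intro continuous_intros)
  have fh: "(\<integral>t. f (\<xi> \<bullet> t) *s G t \<partial>sphere_measure) = (of_real \<sigma> * T n) *s G \<xi>"
    and int: "integrable sphere_measure (\<lambda>t. f (\<xi> \<bullet> t) *s G t)"
    if G: "hom_poly n G" "\<And>x. laplacian G x = 0" for n and G :: "(real, 'm) vec \<Rightarrow> 'm clifford"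
  proof -
    show "(\<integral>t. f (\<xi> \<bullet> t) *s G t \<partial>sphere_measure) = (of_real \<sigma> * T n) *s G \<xi>"
    proof -
      have "gegenbauer_average ?m n f = T n"
        unfolding f_def [abs_def] T_def by (rule gegenbauer_average_eq_transform)
      then show ?thesis
        using funk_hecke [OF dim' \<xi> G f] by (simp add: \<sigma>_def)
    qed
    have "\<xi> \<bullet> t \<in> {- 1..1}" if "norm t = 1" for t
      using Cauchy_Schwarz_ineq2 [of \<xi> t] \<xi> that by (simp add: abs_le_iff)
    then show "integrable sphere_measure (\<lambda>t. f (\<xi> \<bullet> t) *s G t)"
      by (intro integrable_sphere_measure continuous_intros continuous_on_compose2 [OF f]
          hom_poly_continuous_on [OF G(1)]) auto
  qed
  note harmonic = P left_monogenic_harmonic [OF P left mv]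
    hom_poly_clifford_vector_left [OF P] left_monogenic_harmonic_mult_left [OF P left mv]
    hom_poly_clifford_vector_right [OF P] left_monogenic_harmonic_mult_right [OF P left mv]
    left_monogenic_harmonic_sandwich [OF P left mv, folded c_def H_def]
  note fh = fh [OF harmonic(1,2)] fh [OF harmonic(3,4)] fh [OF harmonic(5,6)] fh [OF harmonic(7,8)]
  note int = int [OF harmonic(1,2)] int [OF harmonic(3,4)] int [OF harmonic(5,6)] int [OF harmonic(7,8)]
  have "(\<integral>t. h (Complex x0 (x \<bullet> t)) *s
        ((blade {} - \<i> *s ?v t) \<odot> P t \<odot> (blade {} - \<i> *s ?v t)) \<partial>sphere_measure) =
      (\<integral>t. f (\<xi> \<bullet> t) *s P t - \<i> *s (f (\<xi> \<bullet> t) *s (?v t \<odot> P t)) - \<i> *s (f (\<xi> \<bullet> t) *s (P t \<odot> ?v t))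
        - f (\<xi> \<bullet> t) *s H t - c *\<^sub>R (f (\<xi> \<bullet> t) *s P t) \<partial>sphere_measure)"
  proof (rule Bochner_Integration.integral_cong [OF refl])
    fix t :: "(real, 'm) vec" assume "t \<in> space sphere_measure"
    then have "t \<bullet> t = 1" by (simp add: dot_square_norm)
    then have "?v t \<odot> P t \<odot> ?v t = H t + c *\<^sub>R P t" by (simp add: H_def)
    then show "h (Complex x0 (x \<bullet> t)) *s ((blade {} - \<i> *s ?v t) \<odot> P t \<odot> (blade {} - \<i> *s ?v t)) =
        f (\<xi> \<bullet> t) *s P t - \<i> *s (f (\<xi> \<bullet> t) *s (?v t \<odot> P t)) - \<i> *s (f (\<xi> \<bullet> t) *s (P t \<odot> ?v t))
        - f (\<xi> \<bullet> t) *s H t - c *\<^sub>R (f (\<xi> \<bullet> t) *s P t)"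
      unfolding one_minus_iv_sandwich x f_def
      by (simp add: vec_eq_iff scaleR_eq_scalar algebra_simps)
  qed
  also have "\<dots> = (of_real \<sigma> * T k) *s P \<xi> - \<i> *s ((of_real \<sigma> * T (Suc k)) *s (?v \<xi> \<odot> P \<xi>))
      - \<i> *s ((of_real \<sigma> * T (Suc k)) *s (P \<xi> \<odot> ?v \<xi>)) - (of_real \<sigma> * T (k + 2)) *s H \<xi>
      - c *\<^sub>R ((of_real \<sigma> * T k) *s P \<xi>)"
    using int unfolding fh [symmetric]
    by (simp add: integral_bounded_linear [OF bounded_linear_scalar]
        integrable_bounded_linear [OF bounded_linear_scalar] del: vector_smult_assoc vec.scale_scale)
  \<comment> \<open>At the unit vector \<xi> the correction in \<open>H\<close> returns
    \<open>c\<close> times \<open>P \<xi>\<close>, now weighted by \<open>T (k + 2)\<close>.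
    Together with the term \<open>- c\<close> at \<open>T k\<close> this is the mixture in the
    coefficient of \<open>P\<close>.\<close>
  also have "\<dots> = of_real \<sigma> *s (((1 - of_real c) * T k + of_real c * T (k + 2)) *s P \<xi>
      - (\<i> * T (k + 1)) *s (?v \<xi> \<odot> P \<xi>) - (\<i> * T (k + 1)) *s (P \<xi> \<odot> ?v \<xi>)
      - T (k + 2) *s (?v \<xi> \<odot> P \<xi> \<odot> ?v \<xi>))"
    using \<xi> by (simp add: H_def dot_square_norm scaleR_eq_scalar vec_eq_iff algebra_simps)
  finally have "plane_wave_integral h P (x0, x) =
      ((1 - of_real c) * T k + of_real c * T (k + 2)) *s P \<xi>
      - (\<i> * T (k + 1)) *s (?v \<xi> \<odot> P \<xi>) - (\<i> * T (k + 1)) *s (P \<xi> \<odot> ?v \<xi>)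
      - T (k + 2) *s (?v \<xi> \<odot> P \<xi> \<odot> ?v \<xi>)"
    unfolding plane_wave_integral_def case_prod_conv \<sigma>_def [symmetric]
    using \<sigma> by (simp add: scaleR_eq_scalar)
  moreover have "coeff_A h ?m k l x0 r *s P x = ((1 - of_real c) * T k + of_real c * T (k + 2)) *s P \<xi>"
  proof -
    have rk: "r powi (- int k) * r ^ k = 1"
      using r by (simp add: power_int_minus)
    define d where "d = 2 * real k + real ?m"
    have "d \<noteq> 0" unfolding d_def using dim by linarith
    then have "d * c = mu ?m l" by (simp add: c_def d_def)
    then have mu: "of_real (mu ?m l) = of_real d * (of_real c :: complex)" by (metis of_real_mult)
    have "coeff_A h ?m k l x0 r = of_real (r powi (- int k) / d) *
        (of_real (d - mu ?m l) * T k + of_real (mu ?m l) * T (k + 2))"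
      unfolding coeff_A_def d_def T_def ..
    also have "of_real (d - mu ?m l) * T k + of_real (mu ?m l) * T (k + 2) =
        of_real d * ((1 - of_real c) * T k + of_real c * T (k + 2))"
      unfolding of_real_diff mu by (simp add: algebra_simps)
    also have "of_real (r powi (- int k) / d) * (of_real d * ((1 - of_real c) * T k + of_real c * T (k + 2))) =
        of_real (r powi (- int k)) * ((1 - of_real c) * T k + of_real c * T (k + 2))"
      using \<open>d \<noteq> 0\<close> by simp
    finally have "coeff_A h ?m k l x0 r = of_real (r powi (- int k)) * ((1 - of_real c) * T k + of_real c * T (k + 2))" .
    then show ?thesis
      using scalar_scaleR_cancel [OF rk] by (simp only: x hom_poly_homogeneous [OF P])
  qed
  moreover have "coeff_B h ?m k x0 r *s (?v x \<odot> P x) = - (\<i> * T (k + 1)) *s (?v \<xi> \<odot> P \<xi>)"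
    and "coeff_C h ?m k x0 r *s (P x \<odot> ?v x) = - (\<i> * T (k + 1)) *s (P \<xi> \<odot> ?v \<xi>)"
  proof -
    have "r powi (- int k - 1) = inverse (r ^ Suc k)"
      using r by (simp add: power_int_diff power_int_minus field_simps)
    then have rk: "r powi (- int k - 1) * r ^ Suc k = 1"
      by (simp only: left_inverse [OF rn])
    have B: "coeff_B h ?m k x0 r = of_real (r powi (- int k - 1)) * (- (\<i> * T (k + 1)))"
      by (simp add: coeff_B_def flip: T_def)
    show "coeff_B h ?m k x0 r *s (?v x \<odot> P x) = - (\<i> * T (k + 1)) *s (?v \<xi> \<odot> P \<xi>)"
      unfolding B x hom_poly_homogeneous [OF hom_poly_clifford_vector_left [OF P], of r \<xi>]
      by (rule scalar_scaleR_cancel [OF rk])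
    show "coeff_C h ?m k x0 r *s (P x \<odot> ?v x) = - (\<i> * T (k + 1)) *s (P \<xi> \<odot> ?v \<xi>)"
      unfolding coeff_C_def B x hom_poly_homogeneous [OF hom_poly_clifford_vector_right [OF P], of r \<xi>]
      by (rule scalar_scaleR_cancel [OF rk])
  qed
  moreover have "coeff_D h ?m k x0 r *s (?v x \<odot> P x \<odot> ?v x) = - T (k + 2) *s (?v \<xi> \<odot> P \<xi> \<odot> ?v \<xi>)"
  proof -
    have "r powi (- int k - 2) = inverse (r ^ Suc (Suc k))"
      using r by (simp add: power_int_diff power_int_minus field_simps power2_eq_square)
    then have rk: "r powi (- int k - 2) * r ^ Suc (Suc k) = 1"
      by (simp only: left_inverse [OF rn])
    have D: "coeff_D h ?m k x0 r = of_real (r powi (- int k - 2)) * (- T (k + 2))"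
      by (simp add: coeff_D_def flip: T_def)
    show ?thesis
      unfolding D x hom_poly_homogeneous
        [OF hom_poly_clifford_vector_right [OF hom_poly_clifford_vector_left [OF P]], of r \<xi>]
      by (rule scalar_scaleR_cancel [OF rk])
  qed
  ultimately show ?thesis
    unfolding r_def [symmetric] by (simp add: vec_eq_iff)
qed

lemma plane_wave_integral_monogenic:
  fixes P :: "real ^ 'm::{finite,linorder} \<Rightarrow> 'm clifford"
  assumes P: "continuous_on UNIV P" and U: "open U" and h: "h holomorphic_on U"
  shows "two_sided_monogenic_on (plane_wave_integral h P) (axial_domain U)"
proof -
  let ?S = "axial_domain U :: (real \<times> (real, 'm) vec) set"
  let ?v = "clifford_vector :: (real, 'm) vec \<Rightarrow> 'm clifford"
  define \<sigma> where "\<sigma> = 1 / sphere_area (CARD('m) - 1)"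
  define g where "g t = (blade {} - \<i> *s ?v t) \<odot> P t \<odot> (blade {} - \<i> *s ?v t)" for t
  define z where "z = (\<lambda>(p :: real \<times> (real, 'm) vec) t. Complex (fst p) (snd p \<bullet> t))"
  define f where "f p t = h (z p t) *s g t" for p t
  \<comment> \<open>\<open>z\<close> is linear in the point, hence its own derivative. The chain
    rule factor \<open>z v t\<close> is 1 in the direction of \<open>x0\<close> and
    \<open>\<i> * t $ j\<close> in the direction \<open>axis j 1\<close>; multiplied by
    \<open>blade {j}\<close> and summed, these factors form
    \<open>blade {} + \<i> *s clifford_vector t\<close>.\<close>
  define f' where "f' p t v = (z v t * deriv h (z p t)) *s g t" for p t v
  define I' where "I' p v = \<sigma> *\<^sub>R (\<integral>t. f' p t v \<partial>sphere_measure)" for p v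
  have I: "plane_wave_integral h P = (\<lambda>p. \<sigma> *\<^sub>R (\<integral>t. f p t \<partial>sphere_measure))"
    by (simp add: plane_wave_integral_def \<sigma>_def f_def g_def z_def case_prod_beta')
  have opn: "open ?S" by (rule open_axial_domain [OF U])
  have zU: "z p t \<in> U" if "p \<in> ?S" "norm t = 1" for p t
    using axial_domain_inner [of "fst p" "snd p" U t] that by (simp add: z_def)
  have zcont: "continuous_on S (\<lambda>x. z (a x) (b x))"
    if "continuous_on S a" "continuous_on S b" for S :: "'s::topological_space set" and a b
    unfolding z_def using that by (intro continuous_intros)
  have gcont: "continuous_on S g" for S
    unfolding g_def by (intro continuous_intros continuous_on_subset [OF P]) auto
  have dh: "continuous_on U (deriv h)"
    by (intro holomorphic_on_imp_continuous_on holomorphic_deriv h U)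
  have slice: "continuous_on (sphere 0 1) (f p)" if "p \<in> ?S" for p
    unfolding f_def
    by (intro continuous_intros gcont
        continuous_on_compose2 [OF holomorphic_on_imp_continuous_on [OF h]] zcont) (auto simp: zU that)
  have cont': "continuous_on (?S \<times> sphere 0 1) (\<lambda>(p, t). f' p t v)" for v
    unfolding f'_def case_prod_beta
    by (intro continuous_intros continuous_on_compose2 [OF gcont [of UNIV]]
        continuous_on_compose2 [OF dh] zcont) (auto simp: zU)
  have slice': "integrable sphere_measure (\<lambda>t. f' p t v)" if "p \<in> ?S" for p v
  proof (rule integrable_sphere_measure)
    have "continuous_on (sphere 0 1) (\<lambda>t. case (p, t) of (p, t) \<Rightarrow> f' p t v)"
      by (rule continuous_on_compose2 [OF cont' continuous_on_Pair [OF continuous_on_const continuous_on_id]])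
        (use that in auto)
    then show "continuous_on (sphere 0 1) (\<lambda>t. f' p t v)" by simp
  qed
  have deriv: "(plane_wave_integral h P has_derivative I' p) (at p)" if "p \<in> ?S" for p
    unfolding I I'_def
  proof (intro has_derivative_scaleR_right has_derivative_sphere_integral [OF opn that _ slice cont'])
    fix p t assume p: "p \<in> ?S" and t: "norm (t :: (real, 'm) vec) = 1"
    have "bounded_linear (\<lambda>p. z p t)"
      unfolding z_def Complex_eq linear_conv_bounded_linear [symmetric]
      by (rule linearI) (simp_all add: inner_simps scaleR_conv_of_real [where 'a = complex] algebra_simps)
    then have "((\<lambda>p. z p t) has_derivative (\<lambda>v. z v t)) (at p)"
      by (rule bounded_linear_imp_has_derivative)
    moreover have "(h has_derivative (\<lambda>w. w * deriv h (z p t))) (at (z p t))"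
      using holomorphic_derivI [OF h U zU [OF p t]] by (simp add: has_field_derivative_def mult_commute_abs)
    ultimately have "((\<lambda>p. h (z p t)) has_derivative (\<lambda>v. z v t * deriv h (z p t))) (at p)"
      by (rule has_derivative_compose)
    then show "((\<lambda>p. f p t) has_derivative f' p t) (at p)"
      unfolding f_def f'_def by (rule bounded_linear.has_derivative [OF bounded_linear_scalar_left])
  qed
  have "continuously_differentiable_on (plane_wave_integral h P) ?S"
    unfolding continuously_differentiable_on_def
  proof (intro exI conjI ballI)
    have ap: "blinfun_apply (Blinfun (I' p)) = I' p" if "p \<in> ?S" for p
      using deriv [OF that] by (simp add: bounded_linear_Blinfun_apply has_derivative_bounded_linear)
    then show "(plane_wave_integral h P has_derivative blinfun_apply (Blinfun (I' p))) (at p)" if "p \<in> ?S" for p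
      using deriv that by simp
    show "continuous_on ?S (\<lambda>p. Blinfun (I' p))"
    proof (rule continuous_on_blinfun_componentwise)
      fix v :: "real \<times> (real, 'm) vec"
      have "continuous_on ?S (\<lambda>p. I' p v)"
        unfolding I'_def by (intro continuous_intros continuous_on_sphere_integral cont')
      then show "continuous_on ?S (\<lambda>p. blinfun_apply (Blinfun (I' p)) v)"
        by (rule continuous_on_eq) (simp add: ap)
    qed
  qed
  moreover have "directional_deriv (plane_wave_integral h P) (1, 0) (x0, x)
        + dirac_left (\<lambda>y. plane_wave_integral h P (x0, y)) x = 0 \<and>
      directional_deriv (plane_wave_integral h P) (1, 0) (x0, x)
        + dirac_right (\<lambda>y. plane_wave_integral h P (x0, y)) x = 0"
    if p: "(x0, x) \<in> ?S" for x0 x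
  proof -
    let ?p = "(x0, x)"
    have D0: "directional_deriv (plane_wave_integral h P) v ?p = I' ?p v" for v
      by (rule directional_deriv_eq [OF deriv [OF p]])
    have D: "directional_deriv (\<lambda>y. plane_wave_integral h P (x0, y)) w x = I' ?p (0, w)" for w
      using D0 [of "(0, w)"] by (simp add: directional_deriv_def)
    have L: "L (I' ?p v) = \<sigma> *\<^sub>R (\<integral>t. L (f' ?p t v) \<partial>sphere_measure)"
      and Lint: "integrable sphere_measure (\<lambda>t. L (f' ?p t v))"
      if "bounded_linear L" for L :: "'m clifford \<Rightarrow> 'm clifford" and v
      using integral_bounded_linear [OF that slice' [OF p, of v]] linear_cmul [OF bounded_linear.linear [OF that]]
        integrable_bounded_linear [OF that slice' [OF p, of v]]
      by (simp_all add: I'_def)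
    have z: "z (1, 0) t = 1" "z (0, axis j 1) t = \<i> * of_real (t $ j)" for t :: "(real, 'm) vec" and j
      by (simp_all add: z_def complex_eq_iff inner_axis inner_commute [of "axis j 1"])
    have vec: "?v t = (\<Sum>j\<in>UNIV. of_real (t $ j) *s blade {j})" for t
      by (simp add: clifford_vector_def scaleR_eq_scalar)
    have "I' ?p (1, 0) + (\<Sum>j\<in>UNIV. blade {j} \<odot> I' ?p (0, axis j 1)) =
        \<sigma> *\<^sub>R (\<integral>t. f' ?p t (1, 0) + (\<Sum>j\<in>UNIV. blade {j} \<odot> f' ?p t (0, axis j 1)) \<partial>sphere_measure)"
      using slice' [OF p]
      by (simp add: L [OF bounded_linear_clifford_mult_right] Lint [OF bounded_linear_clifford_mult_right]
          I'_def [of ?p "(1, 0)"] scaleR_add_right scaleR_sum_right)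
    also have "\<dots> = \<sigma> *\<^sub>R (\<integral>t. 0 \<partial>(sphere_measure :: (real, 'm) vec measure))"
    proof (intro arg_cong [of _ _ "(*\<^sub>R) \<sigma>"] Bochner_Integration.integral_cong refl)
      fix t :: "(real, 'm) vec" assume "t \<in> space sphere_measure"
      then have t: "norm t = 1" by simp
      have "f' ?p t (1, 0) + (\<Sum>j\<in>UNIV. blade {j} \<odot> f' ?p t (0, axis j 1)) =
          deriv h (z ?p t) *s ((blade {} + \<i> *s ?v t) \<odot> g t)"
        unfolding f'_def z vec
        by (simp add: clifford_mult_add_left clifford_mult_sum_left scalar_clifford_mult_left scalar_clifford_mult_right
            vec_eq_iff sum_distrib_left algebra_simps)
      also have "(blade {} + \<i> *s ?v t) \<odot> g t = 0"
        unfolding g_def by (simp only: clifford_mult_assoc [symmetric] one_plus_iv_mult_one_minus_iv(1) [OF t] clifford_mult_zero_left)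
      finally show "f' ?p t (1, 0) + (\<Sum>j\<in>UNIV. blade {j} \<odot> f' ?p t (0, axis j 1)) = 0" by simp
    qed
    finally have left: "I' ?p (1, 0) + (\<Sum>j\<in>UNIV. blade {j} \<odot> I' ?p (0, axis j 1)) = 0" by simp
    have "I' ?p (1, 0) + (\<Sum>j\<in>UNIV. I' ?p (0, axis j 1) \<odot> blade {j}) =
        \<sigma> *\<^sub>R (\<integral>t. f' ?p t (1, 0) + (\<Sum>j\<in>UNIV. f' ?p t (0, axis j 1) \<odot> blade {j}) \<partial>sphere_measure)"
      using slice' [OF p]
      by (simp add: L [OF bounded_linear_clifford_mult_left] Lint [OF bounded_linear_clifford_mult_left]
          I'_def [of ?p "(1, 0)"] scaleR_add_right scaleR_sum_right)
    also have "\<dots> = \<sigma> *\<^sub>R (\<integral>t. 0 \<partial>(sphere_measure :: (real, 'm) vec measure))"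
    proof (intro arg_cong [of _ _ "(*\<^sub>R) \<sigma>"] Bochner_Integration.integral_cong refl)
      fix t :: "(real, 'm) vec" assume "t \<in> space sphere_measure"
      then have t: "norm t = 1" by simp
      have "f' ?p t (1, 0) + (\<Sum>j\<in>UNIV. f' ?p t (0, axis j 1) \<odot> blade {j}) =
          deriv h (z ?p t) *s (g t \<odot> (blade {} + \<i> *s ?v t))"
        unfolding f'_def z vec
        by (simp add: clifford_mult_add_right clifford_mult_sum_right scalar_clifford_mult_left scalar_clifford_mult_right
            vec_eq_iff sum_distrib_left algebra_simps)
      also have "g t \<odot> (blade {} + \<i> *s ?v t) = 0"
        unfolding g_def by (simp only: clifford_mult_assoc one_plus_iv_mult_one_minus_iv(2) [OF t] clifford_mult_zero_right)
      finally show "f' ?p t (1, 0) + (\<Sum>j\<in>UNIV. f' ?p t (0, axis j 1) \<odot> blade {j}) = 0" by simp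
    qed
    finally have right: "I' ?p (1, 0) + (\<Sum>j\<in>UNIV. I' ?p (0, axis j 1) \<odot> blade {j}) = 0" by simp
    show ?thesis
      unfolding dirac_left_def dirac_right_def D D0 using left right by simp
  qed
  ultimately show ?thesis
    unfolding two_sided_monogenic_on_def using opn by blast
qed

theorem theorem5:
  fixes P :: "real ^ 'm::{finite,linorder} \<Rightarrow> 'm clifford"
    and h :: "complex \<Rightarrow> complex"
    and U :: "complex set"
    and k l :: nat
  assumes "3 \<le> CARD('m)"
    and "1 \<le> l" and "l \<le> CARD('m) - 1"
    and "P \<in> left_monogenic_polynomials k"
    and "\<forall>x. P x \<in> multivectors l"
    and "open U" and "h holomorphic_on U"
  shows "two_sided_monogenic_on (plane_wave_integral h P) (axial_domain U) \<and>
    (\<forall>(x0, x)\<in>axial_domain U. x \<noteq> 0 \<longrightarrow>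
      plane_wave_integral h P (x0, x) =
        coeff_A h CARD('m) k l x0 (norm x) *s P x +
        coeff_B h CARD('m) k x0 (norm x) *s (clifford_vector x \<odot> P x) +
        coeff_C h CARD('m) k x0 (norm x) *s (P x \<odot> clifford_vector x) +
        coeff_D h CARD('m) k x0 (norm x) *s (clifford_vector x \<odot> P x \<odot> clifford_vector x))"
proof -
  have P: "hom_poly k P" and left: "\<And>x. dirac_left P x = 0"
    using assms(4) homogeneous_polynomial_imp_hom_poly by (auto simp: left_monogenic_polynomials_def)
  have "two_sided_monogenic_on (plane_wave_integral h P) (axial_domain U)"
    by (rule plane_wave_integral_monogenic [OF hom_poly_continuous_on [OF P] assms(6,7)])
  with plane_wave_integral_axial [OF assms(1) P left _ holomorphic_on_imp_continuous_on [OF assms(7)]] assms(5)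
  show ?thesis by blast
qed

end
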